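(* Let $R$ be a discrete valuation ring and let $M$ be a quasi-reflexive $R$-module. Then $M\in\mathcal{C}$, i.e. $P(M)$ is reflexive and $M/P(M)$ is finitely generated.
   Context: Let $\mathfrak{m}$ be the maximal ideal of $R$, let $E$ be the injective hull of the residue field $R/\mathfrak{m}$, let $M^\circ=\operatorname{Hom}_R(M,E)$ be the Matlis dual, and let $\varphi:M\to M^{\circ\circ}$ be the canonical (evaluation) embedding. $M$ is reflexive if $\varphi$ is an isomorphism. An $R$-module $A$ is radical-full if $A=\mathfrak{m}A$; $P(M)$ denotes the largest radical-full submodule of $M$. $\mathcal{C}$ is the class of all $R$-modules $M$ for which $P(M)$ is reflexive and $M/P(M)$ is finitely generated. An extension $A\subset B$ of $R$-modules is pure-essential if $A$ is pure in $B$ and, for every submodule $X\subset B$ with $X\cap A=0$ and $(X\oplus A)/X$ pure in $B/X$, one has $X=0$. $M$ is quasi-reflexive if $\operatorname{Im}\varphi\subset M^{\circ\circ}$ is a pure-essential extension ($\operatorname{Im}\varphi$ is always pure in $M^{\circ\circ}$). *)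

theory Defs
  imports "HOL-Algebra.Module" "HOL-Algebra.Ring_Divisibility"
begin

section \<open>Discrete valuation rings\<close>

text \<open>A discrete valuation ring is a local principal ideal domain that is not a field.\<close>

definition discrete_valuation_ring :: "('r, 'x) ring_scheme \<Rightarrow> bool" where
  "discrete_valuation_ring R \<longleftrightarrow>
     principal_domain R \<and> \<not> field R \<and> (\<exists>!m. maximalideal m R)"

text \<open>Meaningful for local rings only.\<close>

definition max_ideal :: "('r, 'x) ring_scheme \<Rightarrow> 'r set" where
  "max_ideal R = (THE m. maximalideal m R)"


section \<open>Constructions with modules\<close>

text \<open>
  The record type of modules extends that of rings. The fields \<open>mult\<close> and \<open>one\<close> play no role for
  modules; they are left undefined where a module is not a ring.
\<close>

definition ring_module :: "('r, 'x) ring_scheme \<Rightarrow> ('r, 'r) module" where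
  "ring_module R =
     \<lparr>carrier = carrier R, mult = mult R, one = one R, zero = zero R, add = add R, smult = mult R\<rparr>"

definition module_span ::
  "('r, 'x) ring_scheme \<Rightarrow> ('r, 'm, 'y) module_scheme \<Rightarrow> 'm set \<Rightarrow> 'm set" where
  "module_span R M S = \<Inter>{N. submodule N R M \<and> S \<subseteq> N}"

definition fin_gen_module :: "('r, 'x) ring_scheme \<Rightarrow> ('r, 'm, 'y) module_scheme \<Rightarrow> bool" where
  "fin_gen_module R M \<longleftrightarrow>
     (\<exists>S. finite S \<and> S \<subseteq> carrier M \<and> module_span R M S = carrier M)"

definition quot_module :: "('r, 'm, 'y) module_scheme \<Rightarrow> 'm set \<Rightarrow> ('r, 'm set) module" where
  "quot_module M N =
     \<lparr>carrier = a_rcosets\<^bsub>M\<^esub> N, mult = undefined, one = undefined, zero = N, add = set_add M,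
      smult = (\<lambda>r X. \<Union>x\<in>X. N +>\<^bsub>M\<^esub> (r \<odot>\<^bsub>M\<^esub> x))\<rparr>"

definition mod_hom ::
  "('r, 'x) ring_scheme \<Rightarrow> ('r, 'm, 'y) module_scheme \<Rightarrow> ('r, 'n, 'z) module_scheme \<Rightarrow> ('m \<Rightarrow> 'n) set"
  where
  "mod_hom R M N = {f \<in> carrier M \<rightarrow> carrier N.
     (\<forall>x\<in>carrier M. \<forall>y\<in>carrier M. f (x \<oplus>\<^bsub>M\<^esub> y) = f x \<oplus>\<^bsub>N\<^esub> f y) \<and>
     (\<forall>r\<in>carrier R. \<forall>x\<in>carrier M. f (r \<odot>\<^bsub>M\<^esub> x) = r \<odot>\<^bsub>N\<^esub> f x)}"

definition mod_iso ::
  "('r, 'x) ring_scheme \<Rightarrow> ('r, 'm, 'y) module_scheme \<Rightarrow> ('r, 'n, 'z) module_scheme \<Rightarrow> ('m \<Rightarrow> 'n) set"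
  where
  "mod_iso R M N = {f \<in> mod_hom R M N. bij_betw f (carrier M) (carrier N)}"

text \<open>
  Elements of \<open>Hom\<^sub>R(M, N)\<close> are restricted to \<open>carrier M\<close>, so that equality of
  homomorphisms is equality of HOL functions.
\<close>

definition Hom_module ::
  "('r, 'x) ring_scheme \<Rightarrow> ('r, 'm, 'y) module_scheme \<Rightarrow> ('r, 'n, 'z) module_scheme \<Rightarrow>
   ('r, 'm \<Rightarrow> 'n) module" where
  "Hom_module R M N =
     \<lparr>carrier = mod_hom R M N \<inter> extensional (carrier M), mult = undefined, one = undefined,
      zero = (\<lambda>x\<in>carrier M. \<zero>\<^bsub>N\<^esub>),
      add = (\<lambda>f g. \<lambda>x\<in>carrier M. f x \<oplus>\<^bsub>N\<^esub> g x),
      smult = (\<lambda>r f. \<lambda>x\<in>carrier M. r \<odot>\<^bsub>N\<^esub> f x)\<rparr>"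


section \<open>Injective hulls\<close>

text \<open>
  Injectivity with respect to modules carried by the type \<open>'n\<close>. HOL cannot quantify over all types
  inside a definition. By Baer's criterion it suffices to test on the ideals of \<open>R\<close>, so
  injectivity with respect to the type of elements of \<open>R\<close> is already injectivity with respect to
  every type; this is \<open>injective_module_any_type\<close> below.
\<close>

definition injective_module ::
  "'n itself \<Rightarrow> ('r, 'x) ring_scheme \<Rightarrow> ('r, 'e, 'y) module_scheme \<Rightarrow> bool" where
  "injective_module T R E \<longleftrightarrow> module R E \<and>
     (\<forall>(B :: ('r, 'n) module) A f.
        module R B \<and> submodule A R B \<and> f \<in> mod_hom R (B\<lparr>carrier := A\<rparr>) E \<longrightarrow>
        (\<exists>g \<in> mod_hom R B E. \<forall>a\<in>A. g a = f a))"

definition essential_submodule ::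
  "('r, 'x) ring_scheme \<Rightarrow> ('r, 'e, 'y) module_scheme \<Rightarrow> 'e set \<Rightarrow> bool" where
  "essential_submodule R E A \<longleftrightarrow> submodule A R E \<and>
     (\<forall>X. submodule X R E \<and> X \<inter> A = {\<zero>\<^bsub>E\<^esub>} \<longrightarrow> X = {\<zero>\<^bsub>E\<^esub>})"

definition injective_hull ::
  "('r, 'x) ring_scheme \<Rightarrow> ('r, 'm, 'y) module_scheme \<Rightarrow> ('r, 'e, 'z) module_scheme \<Rightarrow> bool" where
  "injective_hull R N E \<longleftrightarrow> injective_module TYPE('r) R E \<and>
     (\<exists>f \<in> mod_hom R N E. inj_on f (carrier N) \<and> essential_submodule R E (f ` carrier N))"

definition residue_module :: "('r, 'x) ring_scheme \<Rightarrow> ('r, 'r set) module" where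
  "residue_module R = quot_module (ring_module R) (max_ideal R)"


section \<open>Matlis duality\<close>

abbreviation bidual ::
  "('r, 'x) ring_scheme \<Rightarrow> ('r, 'e, 'z) module_scheme \<Rightarrow> ('r, 'm, 'y) module_scheme \<Rightarrow>
   ('r, ('m \<Rightarrow> 'e) \<Rightarrow> 'e) module" where
  "bidual R E M \<equiv> Hom_module R (Hom_module R M E) E"

definition eval_map ::
  "('r, 'x) ring_scheme \<Rightarrow> ('r, 'e, 'z) module_scheme \<Rightarrow> ('r, 'm, 'y) module_scheme \<Rightarrow>
   'm \<Rightarrow> ('m \<Rightarrow> 'e) \<Rightarrow> 'e" where
  "eval_map R E M x = (\<lambda>f\<in>carrier (Hom_module R M E). f x)"

definition reflexive_module ::
  "('r, 'x) ring_scheme \<Rightarrow> ('r, 'e, 'z) module_scheme \<Rightarrow> ('r, 'm, 'y) module_scheme \<Rightarrow> bool" where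
  "reflexive_module R E M \<longleftrightarrow> eval_map R E M \<in> mod_iso R M (bidual R E M)"


section \<open>Radical-full modules and the class C\<close>

definition ideal_smult ::
  "('r, 'x) ring_scheme \<Rightarrow> 'r set \<Rightarrow> ('r, 'm, 'y) module_scheme \<Rightarrow> 'm set" where
  "ideal_smult R I A = module_span R A {a \<odot>\<^bsub>A\<^esub> x | a x. a \<in> I \<and> x \<in> carrier A}"

definition radical_full :: "('r, 'x) ring_scheme \<Rightarrow> ('r, 'm, 'y) module_scheme \<Rightarrow> bool" where
  "radical_full R A \<longleftrightarrow> carrier A = ideal_smult R (max_ideal R) A"

definition is_largest_radical_full ::
  "('r, 'x) ring_scheme \<Rightarrow> ('r, 'm, 'y) module_scheme \<Rightarrow> 'm set \<Rightarrow> bool" where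
  "is_largest_radical_full R M U \<longleftrightarrow>
     submodule U R M \<and> radical_full R (M\<lparr>carrier := U\<rparr>) \<and>
     (\<forall>V. submodule V R M \<and> radical_full R (M\<lparr>carrier := V\<rparr>) \<longrightarrow> V \<subseteq> U)"

text \<open>Existence and uniqueness are shown in \<open>largest_radical_full\<close> below.\<close>

definition P_sub :: "('r, 'x) ring_scheme \<Rightarrow> ('r, 'm, 'y) module_scheme \<Rightarrow> 'm set" where
  "P_sub R M = (THE U. is_largest_radical_full R M U)"

definition in_class_C ::
  "('r, 'x) ring_scheme \<Rightarrow> ('r, 'e, 'z) module_scheme \<Rightarrow> ('r, 'm, 'y) module_scheme \<Rightarrow> bool" where
  "in_class_C R E M \<longleftrightarrow> module R M \<and>
     reflexive_module R E (M\<lparr>carrier := P_sub R M\<rparr>) \<and>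
     fin_gen_module R (quot_module M (P_sub R M))"


section \<open>Purity and quasi-reflexive modules\<close>

text \<open>
  Purity over an arbitrary commutative ring: every finite system of linear equations
  \<open>\<Sum>\<^sub>j r\<^sub>i\<^sub>j x\<^sub>j = a\<^sub>i\<close> with constants in \<open>A\<close> that is solvable in \<open>B\<close> is solvable in \<open>A\<close>.
\<close>

definition pure_submodule ::
  "('r, 'x) ring_scheme \<Rightarrow> ('r, 'b, 'y) module_scheme \<Rightarrow> 'b set \<Rightarrow> bool" where
  "pure_submodule R B A \<longleftrightarrow> submodule A R B \<and>
     (\<forall>(p::nat) (q::nat) (r :: nat \<Rightarrow> nat \<Rightarrow> 'r) (a :: nat \<Rightarrow> 'b).
        (\<forall>i<p. \<forall>j<q. r i j \<in> carrier R) \<and> (\<forall>i<p. a i \<in> A) \<and>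
        (\<exists>x. (\<forall>j<q. x j \<in> carrier B) \<and> (\<forall>i<p. (\<Oplus>\<^bsub>B\<^esub>j\<in>{..<q}. r i j \<odot>\<^bsub>B\<^esub> x j) = a i)) \<longrightarrow>
        (\<exists>y. (\<forall>j<q. y j \<in> A) \<and> (\<forall>i<p. (\<Oplus>\<^bsub>B\<^esub>j\<in>{..<q}. r i j \<odot>\<^bsub>B\<^esub> y j) = a i)))"

text \<open>\<open>(X \<oplus> A) / X\<close> is the set of the cosets modulo \<open>X\<close> of the elements of \<open>X + A\<close>.\<close>

definition pure_essential ::
  "('r, 'x) ring_scheme \<Rightarrow> ('r, 'b, 'y) module_scheme \<Rightarrow> 'b set \<Rightarrow> bool" where
  "pure_essential R B A \<longleftrightarrow> pure_submodule R B A \<and>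
     (\<forall>X. submodule X R B \<and> X \<inter> A = {\<zero>\<^bsub>B\<^esub>} \<and>
        pure_submodule R (quot_module B X) ((\<lambda>b. X +>\<^bsub>B\<^esub> b) ` (X <+>\<^bsub>B\<^esub> A)) \<longrightarrow>
        X = {\<zero>\<^bsub>B\<^esub>})"

definition quasi_reflexive ::
  "('r, 'x) ring_scheme \<Rightarrow> ('r, 'e, 'z) module_scheme \<Rightarrow> ('r, 'm, 'y) module_scheme \<Rightarrow> bool" where
  "quasi_reflexive R E M \<longleftrightarrow> pure_essential R (bidual R E M) (eval_map R E M ` carrier M)"


section \<open>The definitions above are well posed\<close>

lemma maximalideal_max_ideal:
  "discrete_valuation_ring R \<Longrightarrow> maximalideal (max_ideal R) R"
  unfolding discrete_valuation_ring_def max_ideal_def by (elim conjE) (rule theI')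

lemma (in module) submodule_Inter:
  assumes "\<And>N. N \<in> F \<Longrightarrow> submodule N R M" "F \<noteq> {}"
  shows "submodule (\<Inter>F) R M"
proof (rule submoduleI)
  show "\<Inter>F \<subseteq> carrier M" using assms(1)[THEN submoduleE(1)] assms(2) by blast
  show "\<zero>\<^bsub>M\<^esub> \<in> \<Inter>F"
    using assms(1)[THEN submodule.axioms(1), THEN subgroup.one_closed] by simp
qed (simp_all add: submoduleE[OF assms(1)])

lemma (in module) submodule_span:
  assumes "S \<subseteq> carrier M"
  shows "submodule (module_span R M S) R M" "S \<subseteq> module_span R M S"
    "\<And>N. submodule N R M \<Longrightarrow> S \<subseteq> N \<Longrightarrow> module_span R M S \<subseteq> N"
  unfolding module_span_def
  by (rule submodule_Inter; use assms carrier_is_submodule in blast) blast+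

lemma (in module) submodule_restrict:
  assumes "submodule U R M"
  shows "submodule N R (M\<lparr>carrier := U\<rparr>) \<longleftrightarrow> submodule N R M \<and> N \<subseteq> U"
proof -
  interpret U: module R "M\<lparr>carrier := U\<rparr>"
    using submodule.submodule_is_module[OF assms module_axioms] .
  show ?thesis
  proof
    assume N: "submodule N R (M\<lparr>carrier := U\<rparr>)"
    then have "N \<subseteq> U" using U.submoduleE(1) by fastforce
    moreover have "module R (M\<lparr>carrier := N\<rparr>)"
      using submodule.submodule_is_module[OF N U.module_axioms] by simp
    ultimately show "submodule N R M \<and> N \<subseteq> U"
      using module_incl_imp_submodule submoduleE(1)[OF assms] by blast
  next
    assume "submodule N R M \<and> N \<subseteq> U"
    then show "submodule N R (M\<lparr>carrier := U\<rparr>)"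
      using U.module_incl_imp_submodule[of N] submodule.submodule_is_module[OF _ module_axioms, of N]
      by simp
  qed
qed

theorem (in module) largest_radical_full:
  assumes m: "max_ideal R \<subseteq> carrier R"
  shows "is_largest_radical_full R M (P_sub R M)"
proof -
  let ?F = "{V. submodule V R M \<and> radical_full R (M\<lparr>carrier := V\<rparr>)}"
  define U where "U = module_span R M (\<Union>?F)"
  have sub: "\<Union>?F \<subseteq> carrier M" using submoduleE(1) by blast
  note U = submodule_span[OF sub, folded U_def]
  interpret U: module R "M\<lparr>carrier := U\<rparr>"
    using submodule.submodule_is_module[OF U(1) module_axioms] .
  let ?G = "\<lambda>V. {a \<odot>\<^bsub>M\<^esub> x | a x. a \<in> max_ideal R \<and> x \<in> V}"
  let ?W = "ideal_smult R (max_ideal R) (M\<lparr>carrier := U\<rparr>)"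
  have GU: "?G U \<subseteq> U" using U(1) m by (auto intro!: submoduleE(4))
  then have W: "submodule ?W R (M\<lparr>carrier := U\<rparr>)" "?G U \<subseteq> ?W"
    using U.submodule_span(1,2)[of "?G U"] by (simp_all add: ideal_smult_def)
  then have W': "submodule ?W R M" "?W \<subseteq> U" using submodule_restrict[OF U(1)] by auto
  have "V \<subseteq> ?W" if V: "V \<in> ?F" for V
  proof -
    from V have VM: "submodule V R M" by simp
    interpret V: module R "M\<lparr>carrier := V\<rparr>"
      using submodule.submodule_is_module[OF VM module_axioms] .
    have "V \<subseteq> U" using V U(2) by blast
    then have GV: "?G V \<subseteq> ?W" using W(2) by blast
    have "?G V \<subseteq> V" using VM m by (auto intro!: submoduleE(4))
    moreover have "submodule (?W \<inter> V) R M"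
      using submodule_Inter[of "{?W, V}"] W' VM by auto
    ultimately have "module_span R (M\<lparr>carrier := V\<rparr>) (?G V) \<subseteq> ?W \<inter> V"
      using GV by (intro V.submodule_span(3)) (auto simp: submodule_restrict[OF VM])
    moreover have "V = module_span R (M\<lparr>carrier := V\<rparr>) (?G V)"
      using V by (simp add: radical_full_def ideal_smult_def)
    ultimately show ?thesis by blast
  qed
  then have "U \<subseteq> ?W" using U(3)[OF W'(1)] by blast
  with W' have "radical_full R (M\<lparr>carrier := U\<rparr>)" by (simp add: radical_full_def)
  with U have "is_largest_radical_full R M U" unfolding is_largest_radical_full_def by blast
  moreover have "V = U" if "is_largest_radical_full R M V" for V
    using that calculation unfolding is_largest_radical_full_def by blast
  ultimately show ?thesis unfolding P_sub_def by (rule theI)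
qed

lemma (in cring) module_ring_module: "module R (ring_module R)"
proof (rule moduleI)
  show "abelian_group (ring_module R)"
  proof (rule abelian_groupI)
    fix x assume "x \<in> carrier (ring_module R)"
    then show "\<exists>y\<in>carrier (ring_module R). y \<oplus>\<^bsub>ring_module R\<^esub> x = \<zero>\<^bsub>ring_module R\<^esub>"
      by (intro bexI[of _ "\<ominus> x"]) (auto simp: ring_module_def l_neg)
  qed (auto simp: ring_module_def a_ac)
qed (auto simp: ring_module_def l_distr r_distr m_assoc is_cring)

lemma (in module) quot_module_simps:
  assumes N: "submodule N R M"
  shows "x \<in> carrier M \<Longrightarrow> y \<in> carrier M \<Longrightarrow>
      (N +>\<^bsub>M\<^esub> x) \<oplus>\<^bsub>quot_module M N\<^esub> (N +>\<^bsub>M\<^esub> y) = N +>\<^bsub>M\<^esub> (x \<oplus>\<^bsub>M\<^esub> y)"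
    and "r \<in> carrier R \<Longrightarrow> x \<in> carrier M \<Longrightarrow>
      r \<odot>\<^bsub>quot_module M N\<^esub> (N +>\<^bsub>M\<^esub> x) = N +>\<^bsub>M\<^esub> (r \<odot>\<^bsub>M\<^esub> x)"
    and "\<zero>\<^bsub>quot_module M N\<^esub> = N +>\<^bsub>M\<^esub> \<zero>\<^bsub>M\<^esub>"
    and "carrier (quot_module M N) = (\<lambda>x. N +>\<^bsub>M\<^esub> x) ` carrier M"
proof -
  have sub: "subgroup N (add_monoid M)" using N by (rule submodule.axioms)
  then have asub: "additive_subgroup N M" by (rule additive_subgroup.intro)
  interpret N: abelian_subgroup N M
    by (rule abelian_subgroupI3[OF asub M.abelian_group_axioms])
  show "(N +>\<^bsub>M\<^esub> x) \<oplus>\<^bsub>quot_module M N\<^esub> (N +>\<^bsub>M\<^esub> y) = N +>\<^bsub>M\<^esub> (x \<oplus>\<^bsub>M\<^esub> y)"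
    if "x \<in> carrier M" "y \<in> carrier M"
    using that N.a_rcos_sum by (simp add: quot_module_def)
  show "\<zero>\<^bsub>quot_module M N\<^esub> = N +>\<^bsub>M\<^esub> \<zero>\<^bsub>M\<^esub>"
    using M.a_coset_add_zero[OF N.a_subset] by (simp add: quot_module_def)
  show "carrier (quot_module M N) = (\<lambda>x. N +>\<^bsub>M\<^esub> x) ` carrier M"
    by (auto simp: quot_module_def A_RCOSETS_def')
  assume r: "r \<in> carrier R" and x: "x \<in> carrier M"
  have "N +>\<^bsub>M\<^esub> (r \<odot>\<^bsub>M\<^esub> z) = N +>\<^bsub>M\<^esub> (r \<odot>\<^bsub>M\<^esub> x)" if "z \<in> N +>\<^bsub>M\<^esub> x" for z
  proof -
    from that obtain n where n: "n \<in> N" "z = n \<oplus>\<^bsub>M\<^esub> x" by (auto simp: a_r_coset_def')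
    then have "n \<in> carrier M" using N.a_subset by blast
    then have "r \<odot>\<^bsub>M\<^esub> z = r \<odot>\<^bsub>M\<^esub> n \<oplus>\<^bsub>M\<^esub> r \<odot>\<^bsub>M\<^esub> x" using n r x by (simp add: smult_r_distr)
    moreover have "r \<odot>\<^bsub>M\<^esub> n \<in> N" using submoduleE(4)[OF N r n(1)] .
    ultimately have "r \<odot>\<^bsub>M\<^esub> z \<in> N +>\<^bsub>M\<^esub> (r \<odot>\<^bsub>M\<^esub> x)" by (auto simp: a_r_coset_def')
    then show ?thesis
      by (rule N.a_repr_independence'[OF _ smult_closed[OF r x], symmetric])
  qed
  moreover have "x \<in> N +>\<^bsub>M\<^esub> x" using N.a_rcos_self[OF x] .
  ultimately have "(\<Union>z\<in>N +>\<^bsub>M\<^esub> x. N +>\<^bsub>M\<^esub> (r \<odot>\<^bsub>M\<^esub> z)) = N +>\<^bsub>M\<^esub> (r \<odot>\<^bsub>M\<^esub> x)"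
    by (intro SUP_eq_const) blast+
  then show "r \<odot>\<^bsub>quot_module M N\<^esub> (N +>\<^bsub>M\<^esub> x) = N +>\<^bsub>M\<^esub> (r \<odot>\<^bsub>M\<^esub> x)"
    by (simp add: quot_module_def)
qed

lemma (in module) module_quot_module:
  assumes N: "submodule N R M"
  shows "module R (quot_module M N)"
proof (rule moduleI)
  note simps = quot_module_simps[OF N]
  show "abelian_group (quot_module M N)"
  proof (rule abelian_groupI)
    fix X assume "X \<in> carrier (quot_module M N)"
    then obtain x where x: "x \<in> carrier M" "X = N +>\<^bsub>M\<^esub> x" by (auto simp: simps(4))
    then have "(N +>\<^bsub>M\<^esub> (\<ominus>\<^bsub>M\<^esub> x)) \<oplus>\<^bsub>quot_module M N\<^esub> X = \<zero>\<^bsub>quot_module M N\<^esub>"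
      by (simp add: simps(1,3) M.l_neg)
    then show "\<exists>Y\<in>carrier (quot_module M N). Y \<oplus>\<^bsub>quot_module M N\<^esub> X = \<zero>\<^bsub>quot_module M N\<^esub>"
      using x by (auto simp: simps(4))
  qed (auto simp: simps M.a_ac)
qed (auto simp: quot_module_simps[OF N] smult_l_distr smult_r_distr smult_assoc1 is_cring)

lemma (in module) module_Hom_module:
  assumes "module R N"
  shows "module R (Hom_module R M N)"
proof -
  interpret N: module R N by fact
  have inv: "(\<lambda>x\<in>carrier M. \<ominus>\<^bsub>N\<^esub> f x) \<in> carrier (Hom_module R M N)"
    if "f \<in> carrier (Hom_module R M N)" for f
    using that by (auto simp: Hom_module_def mod_hom_def Pi_def N.minus_add N.smult_r_minus)
  have comm: "r \<odot>\<^bsub>N\<^esub> (s \<odot>\<^bsub>N\<^esub> y) = s \<odot>\<^bsub>N\<^esub> (r \<odot>\<^bsub>N\<^esub> y)"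
    if "r \<in> carrier R" "s \<in> carrier R" "y \<in> carrier N" for r s y
    using that by (simp add: N.smult_assoc1[symmetric] m_comm)
  show ?thesis
  proof (rule moduleI)
    show "abelian_group (Hom_module R M N)"
    proof (rule abelian_groupI)
      fix f assume f: "f \<in> carrier (Hom_module R M N)"
      then show "\<exists>g\<in>carrier (Hom_module R M N).
          g \<oplus>\<^bsub>Hom_module R M N\<^esub> f = \<zero>\<^bsub>Hom_module R M N\<^esub>"
        by (intro bexI[OF _ inv[OF f]])
          (auto simp: Hom_module_def mod_hom_def Pi_def N.l_neg fun_eq_iff)
    qed (auto simp: Hom_module_def mod_hom_def Pi_def extensional_def fun_eq_iff N.a_ac
        N.smult_r_distr)
  qed (auto simp: Hom_module_def mod_hom_def Pi_def extensional_def fun_eq_iff is_cring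
        N.smult_r_distr N.smult_l_distr N.smult_assoc1 comm)
qed

text \<open>
  Baer's criterion. A partial homomorphism from \<open>B\<close> to \<open>E\<close> is represented by its graph \<open>G\<close>.
\<close>

theorem injective_module_any_type:
  fixes R :: "('r, 'x) ring_scheme" and E :: "('r, 'e, 'z) module_scheme"
  assumes inj: "injective_module TYPE('r) R E"
  shows "injective_module TYPE('n) R E"
  unfolding injective_module_def
proof (intro conjI allI impI)
  show "module R E" using inj by (simp add: injective_module_def)
  fix B :: "('r, 'n) module" and A f
  assume "module R B \<and> submodule A R B \<and> f \<in> mod_hom R (B\<lparr>carrier := A\<rparr>) E"
  then have "module R B" and A: "submodule A R B" and f: "f \<in> mod_hom R (B\<lparr>carrier := A\<rparr>) E"
    by auto
  interpret E: module R E by fact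
  interpret B: module R B by fact
  define partial_graph where "partial_graph = (\<lambda>G. G \<subseteq> carrier B \<times> carrier E \<and>
    (\<forall>p\<in>G. \<forall>q\<in>G. (fst p \<oplus>\<^bsub>B\<^esub> fst q, snd p \<oplus>\<^bsub>E\<^esub> snd q) \<in> G) \<and>
    (\<forall>r\<in>carrier R. \<forall>p\<in>G. (r \<odot>\<^bsub>B\<^esub> fst p, r \<odot>\<^bsub>E\<^esub> snd p) \<in> G) \<and>
    (\<forall>e. (\<zero>\<^bsub>B\<^esub>, e) \<in> G \<longrightarrow> e = \<zero>\<^bsub>E\<^esub>) \<and> (\<lambda>a. (a, f a)) ` A \<subseteq> G)"
  have Asub: "A \<subseteq> carrier B" using B.submoduleE(1)[OF A] .
  have zA: "\<zero>\<^bsub>B\<^esub> \<in> A" using A by (auto simp: submodule_def dest!: subgroup.one_closed)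
  have fA: "f a \<in> carrier E" if "a \<in> A" for a using f that by (auto simp: mod_hom_def)
  have fadd: "f (a \<oplus>\<^bsub>B\<^esub> b) = f a \<oplus>\<^bsub>E\<^esub> f b" if "a \<in> A" "b \<in> A" for a b
    using f that by (auto simp: mod_hom_def)
  have fsm: "f (r \<odot>\<^bsub>B\<^esub> a) = r \<odot>\<^bsub>E\<^esub> f a" if "a \<in> A" "r \<in> carrier R" for a r
    using f that by (auto simp: mod_hom_def)
  have fz: "f \<zero>\<^bsub>B\<^esub> = \<zero>\<^bsub>E\<^esub>" using fsm[OF zA, of "\<zero>\<^bsub>R\<^esub>"] zA fA Asub by simp
  have start: "partial_graph ((\<lambda>a. (a, f a)) ` A)"
    unfolding partial_graph_def
    using Asub fA fz B.submoduleE(4,5)[OF A] by (auto simp: fadd fsm image_iff)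
  have "\<exists>G\<in>Collect partial_graph. \<forall>H\<in>Collect partial_graph. G \<subseteq> H \<longrightarrow> H = G"
  proof (rule subset_Zorn_nonempty)
    show "Collect partial_graph \<noteq> {}" using start by blast
    fix C assume ne: "C \<noteq> {}" and C: "subset.chain (Collect partial_graph) C"
    have pg: "partial_graph G" if "G \<in> C" for G
      using C that by (auto simp: subset_chain_def)
    have two: "\<exists>G\<in>C. p \<in> G \<and> q \<in> G" if "p \<in> \<Union>C" "q \<in> \<Union>C" for p q
      using C that unfolding subset_chain_def by blast
    have "partial_graph (\<Union>C)"
      unfolding partial_graph_def
    proof (intro conjI ballI allI impI)
      show "\<Union>C \<subseteq> carrier B \<times> carrier E" using pg unfolding partial_graph_def by blast
      show "(\<lambda>a. (a, f a)) ` A \<subseteq> \<Union>C" using pg ne unfolding partial_graph_def by blast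
    next
      fix p q assume "p \<in> \<Union>C" "q \<in> \<Union>C"
      then obtain G where "G \<in> C" "p \<in> G" "q \<in> G" using two by blast
      then show "(fst p \<oplus>\<^bsub>B\<^esub> fst q, snd p \<oplus>\<^bsub>E\<^esub> snd q) \<in> \<Union>C"
        using pg[of G] unfolding partial_graph_def by blast
    next
      fix r p assume "r \<in> carrier R" "p \<in> \<Union>C"
      then obtain G where "G \<in> C" "p \<in> G" by blast
      then show "(r \<odot>\<^bsub>B\<^esub> fst p, r \<odot>\<^bsub>E\<^esub> snd p) \<in> \<Union>C"
        using pg[of G] \<open>r \<in> carrier R\<close> unfolding partial_graph_def by blast
    next
      fix e assume "(\<zero>\<^bsub>B\<^esub>, e) \<in> \<Union>C"
      then show "e = \<zero>\<^bsub>E\<^esub>" using pg unfolding partial_graph_def by blast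
    qed
    then show "\<Union>C \<in> Collect partial_graph" by simp
  qed
  then obtain G where G: "partial_graph G"
    and max: "\<And>H. partial_graph H \<Longrightarrow> G \<subseteq> H \<Longrightarrow> H = G" by auto
  have Gc: "x \<in> carrier B" "e \<in> carrier E" if "(x, e) \<in> G" for x e
    using G that by (auto simp: partial_graph_def)
  have Gadd: "(x \<oplus>\<^bsub>B\<^esub> y, e \<oplus>\<^bsub>E\<^esub> e') \<in> G" if "(x, e) \<in> G" "(y, e') \<in> G" for x y e e'
  proof -
    have "\<forall>p\<in>G. \<forall>q\<in>G. (fst p \<oplus>\<^bsub>B\<^esub> fst q, snd p \<oplus>\<^bsub>E\<^esub> snd q) \<in> G"
      using G unfolding partial_graph_def by (elim conjE)
    from bspec[OF bspec[OF this that(1)] that(2)] show ?thesis by simp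
  qed
  have Gsm: "(r \<odot>\<^bsub>B\<^esub> x, r \<odot>\<^bsub>E\<^esub> e) \<in> G" if "r \<in> carrier R" "(x, e) \<in> G" for r x e
  proof -
    have "\<forall>r\<in>carrier R. \<forall>p\<in>G. (r \<odot>\<^bsub>B\<^esub> fst p, r \<odot>\<^bsub>E\<^esub> snd p) \<in> G"
      using G unfolding partial_graph_def by (elim conjE)
    from bspec[OF bspec[OF this that(1)] that(2)] show ?thesis by simp
  qed
  have Gz: "e = \<zero>\<^bsub>E\<^esub>" if "(\<zero>\<^bsub>B\<^esub>, e) \<in> G" for e
    using G that by (simp add: partial_graph_def)
  have GA: "(a, f a) \<in> G" if "a \<in> A" for a
    using G that by (auto simp: partial_graph_def)
  have G0: "(\<zero>\<^bsub>B\<^esub>, \<zero>\<^bsub>E\<^esub>) \<in> G" using GA[OF zA] fz by simp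
  have Gneg: "(\<ominus>\<^bsub>B\<^esub> x, \<ominus>\<^bsub>E\<^esub> e) \<in> G" if "(x, e) \<in> G" for x e
    using Gsm[OF _ that, of "\<ominus>\<^bsub>R\<^esub> \<one>\<^bsub>R\<^esub>"] Gc[OF that]
    by (simp add: B.smult_l_minus E.smult_l_minus)
  have Gfun: "e = e'" if "(x, e) \<in> G" "(x, e') \<in> G" for x e e'
  proof -
    have "e \<oplus>\<^bsub>E\<^esub> \<ominus>\<^bsub>E\<^esub> e' = \<zero>\<^bsub>E\<^esub>"
      using Gadd[OF that(1) Gneg[OF that(2)]] Gc[OF that(1)] by (intro Gz) (simp add: B.r_neg)
    then show ?thesis using Gc that by (metis E.minus_equality E.minus_minus E.add.inv_closed)
  qed
  have total: "\<exists>e. (b, e) \<in> G" if b: "b \<in> carrier B" for b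
  proof -
    define I where "I = {r \<in> carrier R. \<exists>e. (r \<odot>\<^bsub>B\<^esub> b, e) \<in> G}"
    define h where "h = (\<lambda>r. THE e. (r \<odot>\<^bsub>B\<^esub> b, e) \<in> G)"
    have h: "(r \<odot>\<^bsub>B\<^esub> b, h r) \<in> G" if "r \<in> I" for r
      using that Gfun unfolding I_def h_def by (auto intro: theI2)
    have hI: "r \<in> I" "h r = e" if "r \<in> carrier R" "(r \<odot>\<^bsub>B\<^esub> b, e) \<in> G" for r e
      using that Gfun unfolding I_def h_def by auto
    have IR: "I \<subseteq> carrier R" by (auto simp: I_def)
    have hadd: "r \<oplus>\<^bsub>R\<^esub> s \<in> I" "h (r \<oplus>\<^bsub>R\<^esub> s) = h r \<oplus>\<^bsub>E\<^esub> h s" if "r \<in> I" "s \<in> I" for r s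
      using hI[of "r \<oplus>\<^bsub>R\<^esub> s" "h r \<oplus>\<^bsub>E\<^esub> h s"] Gadd[OF h h, OF that] that IR b
      by (auto simp: B.smult_l_distr subset_eq)
    have hsm: "r \<otimes>\<^bsub>R\<^esub> s \<in> I" "h (r \<otimes>\<^bsub>R\<^esub> s) = r \<odot>\<^bsub>E\<^esub> h s" if "r \<in> carrier R" "s \<in> I" for r s
      using hI[of "r \<otimes>\<^bsub>R\<^esub> s" "r \<odot>\<^bsub>E\<^esub> h s"] Gsm[OF that(1) h[OF that(2)]] that IR b
      by (auto simp: B.smult_assoc1 subset_eq)
    have zI: "\<zero>\<^bsub>R\<^esub> \<in> I" using G0 b by (intro hI) auto
    have mR: "module R (ring_module R)" by (rule cring.module_ring_module[OF module.axioms(1)[OF \<open>module R E\<close>]])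
    interpret RM: module R "ring_module R" by (rule mR)
    have "submodule I R (ring_module R)"
    proof (rule RM.submoduleI)
      fix a assume a: "a \<in> I"
      have "\<ominus>\<^bsub>R\<^esub> \<one>\<^bsub>R\<^esub> \<otimes>\<^bsub>R\<^esub> a \<in> I" using a by (intro hsm) auto
      moreover have "\<ominus>\<^bsub>ring_module R\<^esub> a = \<ominus>\<^bsub>R\<^esub> \<one>\<^bsub>R\<^esub> \<otimes>\<^bsub>R\<^esub> a"
        using a IR RM.smult_l_minus[of "\<one>\<^bsub>R\<^esub>" a] by (auto simp: ring_module_def)
      ultimately show "\<ominus>\<^bsub>ring_module R\<^esub> a \<in> I" by simp
    qed (use IR zI hadd hsm in \<open>auto simp: ring_module_def\<close>)
    moreover have "h \<in> mod_hom R ((ring_module R)\<lparr>carrier := I\<rparr>) E"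
      using hadd(2) hsm(2) Gc(2)[OF h] by (auto simp: mod_hom_def ring_module_def)
    ultimately obtain k where k: "k \<in> mod_hom R (ring_module R) E" "\<And>r. r \<in> I \<Longrightarrow> k r = h r"
      using inj mR unfolding injective_module_def by blast
    define e where "e = k \<one>\<^bsub>R\<^esub>"
    have e: "e \<in> carrier E" using k(1) by (auto simp: mod_hom_def ring_module_def e_def)
    have ke: "h r = r \<odot>\<^bsub>E\<^esub> e" if "r \<in> I" for r
    proof -
      have r: "r \<in> carrier R" using that IR by blast
      have "\<forall>r\<in>carrier R. \<forall>x\<in>carrier R. k (r \<otimes>\<^bsub>R\<^esub> x) = r \<odot>\<^bsub>E\<^esub> k x"
        using k(1) by (simp add: mod_hom_def ring_module_def)
      with r have "k (r \<otimes>\<^bsub>R\<^esub> \<one>\<^bsub>R\<^esub>) = r \<odot>\<^bsub>E\<^esub> k \<one>\<^bsub>R\<^esub>" by blast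
      then show ?thesis using k(2)[OF that] r by (simp add: e_def)
    qed
    define H where "H = {(x \<oplus>\<^bsub>B\<^esub> r \<odot>\<^bsub>B\<^esub> b, y \<oplus>\<^bsub>E\<^esub> r \<odot>\<^bsub>E\<^esub> e) | x y r. (x, y) \<in> G \<and> r \<in> carrier R}"
    have HI: "(x \<oplus>\<^bsub>B\<^esub> r \<odot>\<^bsub>B\<^esub> b, y \<oplus>\<^bsub>E\<^esub> r \<odot>\<^bsub>E\<^esub> e) \<in> H" if "(x, y) \<in> G" "r \<in> carrier R" for x y r
      using that by (auto simp: H_def)
    have GH: "G \<subseteq> H"
    proof
      fix p assume "p \<in> G"
      then show "p \<in> H" using HI[of "fst p" "snd p" "\<zero>\<^bsub>R\<^esub>"] Gc[of "fst p" "snd p"] b e by simp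
    qed
    have "partial_graph H"
      unfolding partial_graph_def
    proof (intro conjI ballI allI impI)
      show "H \<subseteq> carrier B \<times> carrier E" using Gc b e by (auto simp: H_def)
      show "(\<lambda>a. (a, f a)) ` A \<subseteq> H" using GA GH by blast
    next
      fix p q assume "p \<in> H" "q \<in> H"
      then obtain x y r x' y' r' where p: "(x, y) \<in> G" "r \<in> carrier R"
          "p = (x \<oplus>\<^bsub>B\<^esub> r \<odot>\<^bsub>B\<^esub> b, y \<oplus>\<^bsub>E\<^esub> r \<odot>\<^bsub>E\<^esub> e)"
        and q: "(x', y') \<in> G" "r' \<in> carrier R"
          "q = (x' \<oplus>\<^bsub>B\<^esub> r' \<odot>\<^bsub>B\<^esub> b, y' \<oplus>\<^bsub>E\<^esub> r' \<odot>\<^bsub>E\<^esub> e)"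
        unfolding H_def by blast
      have "((x \<oplus>\<^bsub>B\<^esub> x') \<oplus>\<^bsub>B\<^esub> (r \<oplus>\<^bsub>R\<^esub> r') \<odot>\<^bsub>B\<^esub> b, (y \<oplus>\<^bsub>E\<^esub> y') \<oplus>\<^bsub>E\<^esub> (r \<oplus>\<^bsub>R\<^esub> r') \<odot>\<^bsub>E\<^esub> e) \<in> H"
        using p q by (intro HI Gadd) auto
      then show "(fst p \<oplus>\<^bsub>B\<^esub> fst q, snd p \<oplus>\<^bsub>E\<^esub> snd q) \<in> H"
        using p q Gc[OF p(1)] Gc[OF q(1)] b e
        by (simp add: B.smult_l_distr E.smult_l_distr B.M.a_ac E.M.a_ac)
    next
      fix s p assume s: "s \<in> carrier R" and "p \<in> H"
      then obtain x y r where p: "(x, y) \<in> G" "r \<in> carrier R"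
          "p = (x \<oplus>\<^bsub>B\<^esub> r \<odot>\<^bsub>B\<^esub> b, y \<oplus>\<^bsub>E\<^esub> r \<odot>\<^bsub>E\<^esub> e)"
        unfolding H_def by blast
      have "(s \<odot>\<^bsub>B\<^esub> x \<oplus>\<^bsub>B\<^esub> (s \<otimes>\<^bsub>R\<^esub> r) \<odot>\<^bsub>B\<^esub> b, s \<odot>\<^bsub>E\<^esub> y \<oplus>\<^bsub>E\<^esub> (s \<otimes>\<^bsub>R\<^esub> r) \<odot>\<^bsub>E\<^esub> e) \<in> H"
        using p s by (intro HI Gsm) auto
      then show "(s \<odot>\<^bsub>B\<^esub> fst p, s \<odot>\<^bsub>E\<^esub> snd p) \<in> H"
        using p s Gc[OF p(1)] b e
        by (simp add: B.smult_r_distr E.smult_r_distr B.smult_assoc1 E.smult_assoc1)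
    next
      fix c assume "(\<zero>\<^bsub>B\<^esub>, c) \<in> H"
      then obtain x y r where p: "(x, y) \<in> G" "r \<in> carrier R"
          "\<zero>\<^bsub>B\<^esub> = x \<oplus>\<^bsub>B\<^esub> r \<odot>\<^bsub>B\<^esub> b" "c = y \<oplus>\<^bsub>E\<^esub> r \<odot>\<^bsub>E\<^esub> e"
        unfolding H_def by blast
      note xy = Gc[OF p(1)]
      have "r \<odot>\<^bsub>B\<^esub> b = \<ominus>\<^bsub>B\<^esub> x"
        using p xy b by (metis B.M.minus_equality B.M.a_comm B.smult_closed)
      then have "(r \<odot>\<^bsub>B\<^esub> b, \<ominus>\<^bsub>E\<^esub> y) \<in> G" using Gneg[OF p(1)] by simp
      then have "r \<odot>\<^bsub>E\<^esub> e = \<ominus>\<^bsub>E\<^esub> y" using hI[OF p(2)] ke by metis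
      then show "c = \<zero>\<^bsub>E\<^esub>" using p xy by (simp add: E.M.r_neg)
    qed
    then have "H = G" using max GH by blast
    then have "(\<zero>\<^bsub>B\<^esub> \<oplus>\<^bsub>B\<^esub> \<one>\<^bsub>R\<^esub> \<odot>\<^bsub>B\<^esub> b, \<zero>\<^bsub>E\<^esub> \<oplus>\<^bsub>E\<^esub> \<one>\<^bsub>R\<^esub> \<odot>\<^bsub>E\<^esub> e) \<in> G"
      using HI[OF G0, of "\<one>\<^bsub>R\<^esub>"] by simp
    then show ?thesis using b e by auto
  qed
  define g where "g = (\<lambda>b. THE e. (b, e) \<in> G)"
  have gG: "(b, g b) \<in> G" if "b \<in> carrier B" for b
    using total[OF that] Gfun unfolding g_def by (auto intro: theI2)
  have geq: "g b = e" if "(b, e) \<in> G" for b e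
    using that Gfun unfolding g_def by auto
  show "\<exists>g\<in>mod_hom R B E. \<forall>a\<in>A. g a = f a"
  proof (intro bexI ballI)
    show "g a = f a" if "a \<in> A" for a using geq GA that by blast
    show "g \<in> mod_hom R B E"
      using Gc(2)[OF gG] geq[OF Gadd[OF gG gG]] geq[OF Gsm[OF _ gG]] by (auto simp: mod_hom_def)
  qed
qed

end

theory Submission
  imports Defs
begin

text \<open>
  Write \<open>M\<degree>\<close> for the Matlis dual, \<open>B = M\<degree>\<degree>\<close>, \<open>A\<close> for the image of \<open>M\<close> in \<open>B\<close>, and \<open>p\<close> for a
  uniformizer of \<open>R\<close>. Pure-essentiality of \<open>A\<close> in \<open>B\<close> is used through two kinds of test
  submodules \<open>X\<close>: divisible ones (\<open>pure_essential_divisible\<close>) and cyclic ones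
  (\<open>pure_essential_cyclic\<close>). Both need that over a discrete valuation ring purity can be tested on
  single equations \<open>r x = a\<close> (\<open>relatively_divisible_imp_pure_submodule\<close>).

  The cyclic test shows \<open>B = A + p B\<close> (\<open>pure_essential_quotient_divisible\<close>): a quotient \<open>B/A\<close> that is
  not divisible has a nonzero pure cyclic submodule, and it lifts to a cyclic \<open>X\<close>. Reduced modulo
  \<open>p\<close>, this says that the vector space \<open>M/pM\<close> maps onto its double dual, so it is finite-dimensional
  (\<open>no_independent_sequence\<close>). Finiteness of \<open>M/pM\<close> in turn forces the elements of infinite height,
  \<open>\<Inter>\<^sub>n p\<^sup>n M\<close>, to form a divisible submodule (\<open>p_divisible_infinite_height\<close>), which is then \<open>P(M)\<close>.

  For the divisible test take the submodule \<open>Y\<close> of \<open>B\<close> annihilating the torsion of \<open>M\<degree>\<close>. It is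
  divisible and meets \<open>A\<close> exactly in the image of the elements of infinite height, that is, of
  \<open>P(M)\<close>. As that image is divisible it has a divisible complement in \<open>Y\<close>; the complement meets \<open>A\<close>
  trivially, so it is zero and \<open>Y\<close> is the image of \<open>P(M)\<close> (\<open>quasi_reflexive_structure\<close>).

  Both claims can be read off from this equality. A functional on \<open>P(M)\<degree>\<close>, composed with restriction
  \<open>M\<degree> \<rightarrow> P(M)\<degree>\<close>, kills torsion because \<open>P(M)\<degree>\<close> is torsion-free; so it lies in \<open>Y\<close> and is evaluation
  at an element of \<open>P(M)\<close>. For finite generation let \<open>F\<close> be a finite generating set of \<open>M\<close> modulo
  \<open>pM\<close> and let \<open>f \<in> M\<degree>\<close> kill \<open>F\<close> and \<open>P(M)\<close>. As \<open>Y\<close> comes from \<open>P(M)\<close>, all of \<open>Y\<close> vanishes at \<open>f\<close>, so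
  \<open>f\<close> is torsion; as \<open>M\<close> is generated by \<open>F\<close> modulo every power of \<open>p\<close>, \<open>f = 0\<close>. Since \<open>E\<close> is a
  cogenerator, \<open>F\<close> and \<open>P(M)\<close> generate \<open>M\<close>.
\<close>

section \<open>Uniformizers\<close>

locale dvr = cring R for R (structure) +
  fixes p
  assumes p_closed [simp, intro]: "p \<in> carrier R"
    and factor: "r \<in> carrier R \<Longrightarrow> r \<noteq> \<zero> \<Longrightarrow> \<exists>k u. u \<in> Units R \<and> r = p [^] (k::nat) \<otimes> u"
    and max_ideal_eq: "max_ideal R = {p \<otimes> r | r. r \<in> carrier R}"
    and p_not_unit: "p \<notin> Units R"

text \<open>
  Every irreducible element generates a maximal ideal, and there is only one; so all irreducible
  elements are associated to a generator \<open>p\<close> of it, and factorization into irreducibles gives the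
  normal form \<open>p\<^sup>k u\<close>.
\<close>

lemma discrete_valuation_ring_uniformizer:
  fixes R (structure)
  assumes "discrete_valuation_ring R"
  shows "\<exists>p. dvr R p"
proof -
  interpret principal_domain R
    using assms by (simp add: discrete_valuation_ring_def)
  note max = maximalideal_max_ideal[OF assms]
  have uniq: "J = max_ideal R" if "maximalideal J R" for J
    using assms that max unfolding discrete_valuation_ring_def by blast
  obtain p where p: "p \<in> carrier R" "max_ideal R = PIdl p"
    using exists_gen[OF maximalideal.axioms(1)[OF max]] by blast
  have p_not_unit: "p \<notin> Units R"
    using maximalideal.I_notcarr[OF max] ideal_eq_carrier_iff[OF p(1)] p(2) by auto
  have irr: "\<exists>u\<in>Units R. q = p \<otimes> u" if q: "q \<in> carrier R" "ring_irreducible q" for q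
  proof -
    have "PIdl q = PIdl p"
      using uniq[OF irreducible_imp_maximalideal[OF q]] p(2) by simp
    then have "q \<sim> p" using associated_iff_same_ideal q(1) p(1) by blast
    then obtain u where "u \<in> Units R" "q = u \<otimes> p"
      using ring_associated_iff[OF q(1) p(1)] by blast
    then show ?thesis using p(1) m_comm[of u p] Units_closed by blast
  qed
  have prod: "\<exists>k u. u \<in> Units R \<and> foldr (\<otimes>) fs \<one> = p [^] (k::nat) \<otimes> u"
    if "set fs \<subseteq> carrier (mult_of R)" "\<forall>f\<in>set fs. irreducible (mult_of R) f" for fs
    using that
  proof (induction fs)
    case Nil
    show ?case by (rule exI[of _ 0], rule exI[of _ \<one>]) simp
  next
    case (Cons f fs)
    then obtain k u where ku: "u \<in> Units R" "foldr (\<otimes>) fs \<one> = p [^] (k::nat) \<otimes> u" by auto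
    obtain v where v: "v \<in> Units R" "f = p \<otimes> v"
      using irr[of f] Cons.prems ring_irreducibleI'[of f] by auto
    have "p \<otimes> v \<otimes> (p [^] k \<otimes> u) = p [^] Suc k \<otimes> (v \<otimes> u)"
      using v ku p by (simp add: Units_closed m_ac)
    then show ?case using ku v by (intro exI[of _ "Suc k"] exI[of _ "v \<otimes> u"]) simp
  qed
  show ?thesis
  proof (intro exI[of _ p], unfold_locales)
    show "p \<in> carrier R" "p \<notin> Units R" by fact+
    show "max_ideal R = {p \<otimes> r |r. r \<in> carrier R}"
      using p by (force simp: cgenideal_def m_comm)
  next
    fix r assume r: "r \<in> carrier R" "r \<noteq> \<zero>"
    show "\<exists>k u. u \<in> Units R \<and> r = p [^] (k::nat) \<otimes> u"
    proof (cases "r \<in> Units R")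
      case True
      then show ?thesis using r by (intro exI[of _ 0] exI[of _ r]) simp
    next
      case False
      then obtain fs where fs: "set fs \<subseteq> carrier (mult_of R)" "wfactors (mult_of R) fs r"
        using factorization_property[of r] r by auto
      then obtain k u where ku: "u \<in> Units R" "foldr (\<otimes>) fs \<one> = p [^] (k::nat) \<otimes> u"
        using prod[OF fs(1)] by (auto simp: wfactors_def)
      have fc: "foldr (\<otimes>) fs \<one> \<in> carrier R" using ku p by (simp add: Units_closed)
      have "r \<sim>\<^bsub>mult_of R\<^esub> foldr (\<otimes>) fs \<one>"
        using fs(2) by (auto simp: wfactors_def associated_def)
      then have "r \<sim> foldr (\<otimes>) fs \<one>"
        using r(1) fc by (auto simp: associated_def)
      then obtain v where v: "v \<in> Units R" "r = v \<otimes> foldr (\<otimes>) fs \<one>"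
        using ring_associated_iff[OF r(1) fc] by blast
      have "r = p [^] k \<otimes> (u \<otimes> v)" using v ku p by (simp add: Units_closed m_ac)
      then show ?thesis using ku v by blast
    qed
  qed
qed

context dvr
begin

lemma divides_total:
  assumes "r \<in> carrier R" "s \<in> carrier R"
  shows "(\<exists>c\<in>carrier R. s = r \<otimes> c) \<or> (\<exists>c\<in>carrier R. r = s \<otimes> c)"
proof -
  have *: "\<exists>c\<in>carrier R. s = r \<otimes> c"
    if u: "u \<in> Units R" "r = p [^] k \<otimes> u" and v: "v \<in> Units R" "s = p [^] l \<otimes> v"
      and "k \<le> l" for r s u v and k l :: nat
  proof -
    have "p [^] l = p [^] k \<otimes> p [^] (l - k)" using \<open>k \<le> l\<close> by (simp add: nat_pow_mult)
    then have "r \<otimes> (inv u \<otimes> p [^] (l - k) \<otimes> v) = s \<otimes> (u \<otimes> inv u)"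
      using u v by (simp add: Units_closed m_ac del: Units_r_inv)
    then have "s = r \<otimes> (inv u \<otimes> p [^] (l - k) \<otimes> v)"
      using u v by (simp add: Units_closed)
    then show ?thesis using u v by (intro bexI) (auto simp: Units_closed)
  qed
  show ?thesis
  proof (cases "r = \<zero> \<or> s = \<zero>")
    case True
    then show ?thesis using assms by (metis r_null zero_closed)
  next
    case False
    then obtain k u l v where "u \<in> Units R" "r = p [^] (k::nat) \<otimes> u"
      "v \<in> Units R" "s = p [^] (l::nat) \<otimes> v"
      using factor assms by metis
    then show ?thesis using * by (meson linear)
  qed
qed

lemma common_divisor:
  assumes "finite C" "C \<noteq> {}" "C \<subseteq> carrier R"
  shows "\<exists>c\<in>C. \<forall>d\<in>C. \<exists>e\<in>carrier R. d = c \<otimes> e"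
  using assms
proof (induction C rule: finite_ne_induct)
  case (singleton c)
  then show ?case by (auto intro!: bexI[of _ \<one>])
next
  case (insert x C)
  then obtain c where c: "c \<in> C" "\<And>d. d \<in> C \<Longrightarrow> \<exists>e\<in>carrier R. d = c \<otimes> e" by auto
  have cx: "c \<in> carrier R" "x \<in> carrier R" using insert c by auto
  from divides_total[OF this] show ?case
  proof
    assume "\<exists>e\<in>carrier R. x = c \<otimes> e"
    then show ?thesis using c by (intro bexI[of _ c]) auto
  next
    assume "\<exists>e\<in>carrier R. c = x \<otimes> e"
    then obtain e where e: "e \<in> carrier R" "c = x \<otimes> e" by blast
    have "\<exists>e\<in>carrier R. d = x \<otimes> e" if d: "d \<in> insert x C" for d
    proof (cases "d = x")
      case True
      then show ?thesis using cx by (intro bexI[of _ \<one>]) auto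
    next
      case False
      then obtain f where "f \<in> carrier R" "d = c \<otimes> f" using c d by blast
      then show ?thesis using e cx by (intro bexI[of _ "e \<otimes> f"]) (simp_all add: m_assoc)
    qed
    then show ?thesis by blast
  qed
qed

lemma unit_or_multiple:
  assumes "r \<in> carrier R"
  obtains "r \<in> Units R" | c where "c \<in> carrier R" "r = p \<otimes> c"
proof (cases "r = \<zero>")
  case True
  then show ?thesis using that(2)[of \<zero>] by simp
next
  case False
  then obtain k u where ku: "u \<in> Units R" "r = p [^] (k::nat) \<otimes> u" using factor assms by blast
  show ?thesis
  proof (cases k)
    case 0
    then show ?thesis using ku that(1) by (simp add: Units_closed)
  next
    case (Suc l)
    then have "r = p \<otimes> (p [^] l \<otimes> u)" using ku by (simp add: Units_closed m_ac)
    then show ?thesis using that(2)[of "p [^] l \<otimes> u"] ku by (simp add: Units_closed)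
  qed
qed

end

section \<open>Purity over a discrete valuation ring\<close>

locale dvr_module = dvr R p + module R M
  for R (structure) and p and M (structure)
begin

lemma unit_cancel:
  assumes "submodule N R M" "u \<in> Units R" "x \<in> carrier M" "u \<odot>\<^bsub>M\<^esub> x \<in> N"
  shows "x \<in> N"
proof -
  have "inv u \<odot>\<^bsub>M\<^esub> (u \<odot>\<^bsub>M\<^esub> x) \<in> N" using assms submoduleE(4) by blast
  then show ?thesis using assms by (simp add: smult_assoc1[symmetric] Units_closed)
qed

lemma smult_comm:
  "r \<in> carrier R \<Longrightarrow> s \<in> carrier R \<Longrightarrow> x \<in> carrier M \<Longrightarrow>
    r \<odot>\<^bsub>M\<^esub> (s \<odot>\<^bsub>M\<^esub> x) = s \<odot>\<^bsub>M\<^esub> (r \<odot>\<^bsub>M\<^esub> x)"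
  by (simp add: smult_assoc1[symmetric] m_comm)

lemma smult_minus:
  "r \<in> carrier R \<Longrightarrow> x \<in> carrier M \<Longrightarrow> y \<in> carrier M \<Longrightarrow>
    r \<odot>\<^bsub>M\<^esub> (x \<ominus>\<^bsub>M\<^esub> y) = r \<odot>\<^bsub>M\<^esub> x \<ominus>\<^bsub>M\<^esub> r \<odot>\<^bsub>M\<^esub> y"
  by (simp add: M.minus_eq smult_r_distr smult_r_minus)

lemma submodule_minus:
  "submodule N R M \<Longrightarrow> x \<in> N \<Longrightarrow> y \<in> N \<Longrightarrow> x \<ominus>\<^bsub>M\<^esub> y \<in> N"
  unfolding M.minus_eq by (intro submoduleE(3,5)) simp_all

lemma submodule_zero: "submodule N R M \<Longrightarrow> \<zero>\<^bsub>M\<^esub> \<in> N"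
  by (auto simp: submodule_def dest!: subgroup.one_closed)

lemma submodule_carrier: "submodule N R M \<Longrightarrow> x \<in> N \<Longrightarrow> x \<in> carrier M"
  using submoduleE(1) by blast

text \<open>
  Purity tested on one equation in one unknown only.
\<close>

definition relatively_divisible :: "'c set \<Rightarrow> bool" where
  "relatively_divisible N \<longleftrightarrow> submodule N R M \<and>
     (\<forall>r\<in>carrier R. \<forall>x\<in>carrier M. r \<odot>\<^bsub>M\<^esub> x \<in> N \<longrightarrow> (\<exists>y\<in>N. r \<odot>\<^bsub>M\<^esub> y = r \<odot>\<^bsub>M\<^esub> x))"

lemma relatively_divisibleI:
  assumes N: "submodule N R M"
    and pow: "\<And>k x. x \<in> carrier M \<Longrightarrow> p [^] (k::nat) \<odot>\<^bsub>M\<^esub> x \<in> N \<Longrightarrow>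
      \<exists>y\<in>N. p [^] k \<odot>\<^bsub>M\<^esub> y = p [^] k \<odot>\<^bsub>M\<^esub> x"
  shows "relatively_divisible N"
  unfolding relatively_divisible_def
proof (intro conjI ballI impI N)
  fix r x assume r: "r \<in> carrier R" and x: "x \<in> carrier M" and rx: "r \<odot>\<^bsub>M\<^esub> x \<in> N"
  show "\<exists>y\<in>N. r \<odot>\<^bsub>M\<^esub> y = r \<odot>\<^bsub>M\<^esub> x"
  proof (cases "r = \<zero>")
    case True
    then show ?thesis using x submodule_zero[OF N] by (intro bexI[of _ "\<zero>\<^bsub>M\<^esub>"]) auto
  next
    case False
    then obtain k u where ku: "u \<in> Units R" "r = p [^] (k::nat) \<otimes> u" using factor r by blast
    then have eq: "r \<odot>\<^bsub>M\<^esub> z = u \<odot>\<^bsub>M\<^esub> (p [^] k \<odot>\<^bsub>M\<^esub> z)" if "z \<in> carrier M" for z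
      using that by (simp add: Units_closed smult_assoc1[symmetric] m_comm)
    have "p [^] k \<odot>\<^bsub>M\<^esub> x \<in> N"
      using unit_cancel[OF N ku(1), of "p [^] k \<odot>\<^bsub>M\<^esub> x"] rx eq[OF x] x by auto
    then obtain y where "y \<in> N" "p [^] k \<odot>\<^bsub>M\<^esub> y = p [^] k \<odot>\<^bsub>M\<^esub> x" using pow x by blast
    then show ?thesis using eq x submodule_carrier[OF N] by metis
  qed
qed

lemma pure_submodule_imp_relatively_divisible:
  assumes "pure_submodule R M N"
  shows "relatively_divisible N"
  unfolding relatively_divisible_def
proof (intro conjI ballI impI)
  show N: "submodule N R M" using assms by (simp add: pure_submodule_def)
  fix r x assume r: "r \<in> carrier R" and x: "x \<in> carrier M" and rx: "r \<odot>\<^bsub>M\<^esub> x \<in> N"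
  have one: "(\<Oplus>\<^bsub>M\<^esub>j\<in>{..<1::nat}. r \<odot>\<^bsub>M\<^esub> f j) = r \<odot>\<^bsub>M\<^esub> f 0"
    if "f 0 \<in> carrier M" for f :: "nat \<Rightarrow> 'c"
    using that r by (simp add: lessThan_Suc)
  have "\<exists>y. (\<forall>j<1. y j \<in> N) \<and>
      (\<forall>i<1::nat. (\<Oplus>\<^bsub>M\<^esub>j\<in>{..<1::nat}. (\<lambda>_ _. r) i j \<odot>\<^bsub>M\<^esub> y j) = (\<lambda>_. r \<odot>\<^bsub>M\<^esub> x) i)"
    using assms r x rx one[of "\<lambda>_. x"] unfolding pure_submodule_def
    by (elim conjE allE[of _ "1::nat"] allE[of _ "\<lambda>_ _. r"] allE[of _ "\<lambda>_. r \<odot>\<^bsub>M\<^esub> x"]) auto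
  then obtain y :: "nat \<Rightarrow> 'c" where "y 0 \<in> N" "r \<odot>\<^bsub>M\<^esub> y 0 = r \<odot>\<^bsub>M\<^esub> x"
    using one submodule_carrier[OF N] by auto
  then show "\<exists>y\<in>N. r \<odot>\<^bsub>M\<^esub> y = r \<odot>\<^bsub>M\<^esub> x" by blast
qed

end

lemma (in abelian_group) add_minus_add:
  assumes "x \<in> carrier G" "y \<in> carrier G" "z \<in> carrier G"
  shows "(x \<oplus> y) \<ominus> (x \<oplus> z) = y \<ominus> z"
proof -
  have "(x \<oplus> y) \<ominus> (x \<oplus> z) = (y \<oplus> x) \<oplus> (\<ominus> x \<oplus> \<ominus> z)"
    using assms by (simp add: minus_eq minus_add a_comm)
  also have "\<dots> = y \<oplus> (x \<oplus> (\<ominus> x \<oplus> \<ominus> z))" using assms by (simp add: a_assoc)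
  also have "\<dots> = y \<ominus> z" using assms by (simp add: r_neg2 minus_eq)
  finally show ?thesis .
qed

context dvr_module
begin

lemma finsum_submodule:
  assumes "submodule N R M" "finite J" "\<And>j. j \<in> J \<Longrightarrow> f j \<in> N"
  shows "(\<Oplus>\<^bsub>M\<^esub>j\<in>J. f j) \<in> N"
  using assms(2,3)
proof (induction J)
  case empty
  then show ?case using submodule_zero[OF assms(1)] by simp
next
  case (insert j J)
  then have "f j \<in> carrier M" "f \<in> J \<rightarrow> carrier M"
    using submodule_carrier[OF assms(1)] by auto
  then show ?case using insert submoduleE(5)[OF assms(1)] by simp
qed

text \<open>
  Gaussian elimination. Divisibility in \<open>R\<close> is total, so some coefficient \<open>c = r\<^sub>i\<^sub>0\<^sub>j\<^sub>0\<close> divides all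
  others. Row \<open>i0\<close> then reads \<open>c w = a\<^sub>i\<^sub>0\<close>, a single equation, and can be solved with \<open>w = n0\<close> in \<open>N\<close>.
  Subtracting multiples of row \<open>i0\<close> removes the unknown \<open>j0\<close> from the other rows, which leaves a system
  in fewer unknowns (row \<open>i0\<close> stays as \<open>0 = 0\<close>); the unknown \<open>j0\<close> is recovered from \<open>n0\<close> at the end.
\<close>

lemma relatively_divisible_solve:
  assumes rd: "relatively_divisible N" and "finite J"
    and "\<And>i j. i < q \<Longrightarrow> j \<in> J \<Longrightarrow> r i j \<in> carrier R"
    and "\<And>i. i < q \<Longrightarrow> a i \<in> N"
    and "\<And>j. j \<in> J \<Longrightarrow> x j \<in> carrier M"
    and "\<And>i. i < (q::nat) \<Longrightarrow> (\<Oplus>\<^bsub>M\<^esub>j\<in>J. r i j \<odot>\<^bsub>M\<^esub> x j) = a i"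
  shows "\<exists>y. (\<forall>j\<in>J. y j \<in> N) \<and> (\<forall>i<q. (\<Oplus>\<^bsub>M\<^esub>j\<in>J. r i j \<odot>\<^bsub>M\<^esub> y j) = a i)"
  using assms(2-)
proof (induction "card J" arbitrary: J r a)
  case 0
  then show ?case by auto
next
  case (Suc n)
  have N: "submodule N R M" using rd by (simp add: relatively_divisible_def)
  note Nc = submodule_carrier[OF N]
  show ?case
  proof (cases "q = 0")
    case True
    then show ?thesis using submodule_zero[OF N] by auto
  next
    case False
    have "finite {r i j | i j. i < q \<and> j \<in> J}"
      using Suc.prems(1) finite_image_set2[of "\<lambda>i. i < q" "\<lambda>j. j \<in> J" r] by simp
    moreover have "{r i j | i j. i < q \<and> j \<in> J} \<noteq> {}"
    proof -
      have "J \<noteq> {}" using Suc.hyps(2) by auto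
      then show ?thesis using False by blast
    qed
    moreover have "{r i j | i j. i < q \<and> j \<in> J} \<subseteq> carrier R" using Suc.prems(2) by blast
    ultimately have "\<exists>c\<in>{r i j | i j. i < q \<and> j \<in> J}.
        \<forall>d\<in>{r i j | i j. i < q \<and> j \<in> J}. \<exists>e\<in>carrier R. d = c \<otimes> e"
      by (rule common_divisor)
    then obtain i0 j0 where i0: "i0 < q" and j0: "j0 \<in> J"
      and piv: "\<And>i j. i < q \<Longrightarrow> j \<in> J \<Longrightarrow> \<exists>e\<in>carrier R. r i j = r i0 j0 \<otimes> e"
      by blast
    define c where "c = r i0 j0"
    have c: "c \<in> carrier R" using Suc.prems(2) i0 j0 by (simp add: c_def)
    have "\<forall>i. \<exists>e. i < q \<longrightarrow> e \<in> carrier R \<and> r i j0 = c \<otimes> e"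
      using piv j0 unfolding c_def by blast
    then obtain d where d: "\<And>i. i < q \<Longrightarrow> d i \<in> carrier R" "\<And>i. i < q \<Longrightarrow> r i j0 = c \<otimes> d i"
      by metis
    have "\<forall>j. \<exists>e. j \<in> J \<longrightarrow> e \<in> carrier R \<and> r i0 j = c \<otimes> e"
      using piv i0 unfolding c_def by blast
    then obtain e where e: "\<And>j. j \<in> J \<Longrightarrow> e j \<in> carrier R" "\<And>j. j \<in> J \<Longrightarrow> r i0 j = c \<otimes> e j"
      by metis
    define J' where "J' = J - {j0}"
    have J': "finite J'" "j0 \<notin> J'" "J = insert j0 J'" "\<And>j. j \<in> J' \<Longrightarrow> j \<in> J"
      using Suc.prems(1) j0 by (auto simp: J'_def)
    define s where "s i j = r i j \<ominus> (c \<otimes> d i) \<otimes> e j" for i j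
    define b where "b i = a i \<ominus>\<^bsub>M\<^esub> d i \<odot>\<^bsub>M\<^esub> a i0" for i
    define W where "W z = (\<Oplus>\<^bsub>M\<^esub>j\<in>J'. e j \<odot>\<^bsub>M\<^esub> z j)" for z
    define S where "S i z = (\<Oplus>\<^bsub>M\<^esub>j\<in>J'. r i j \<odot>\<^bsub>M\<^esub> z j)" for i z
    have Wc: "W z \<in> carrier M" if "\<And>j. j \<in> J' \<Longrightarrow> z j \<in> carrier M" for z
      using that e(1) J'(4) by (auto simp: W_def intro!: M.finsum_closed)
    have Sc: "S i z \<in> carrier M" if "\<And>j. j \<in> J' \<Longrightarrow> z j \<in> carrier M" "i < q" for i z
      using that Suc.prems(2) J'(4) by (auto simp: S_def intro!: M.finsum_closed)
    have lin: "(\<Oplus>\<^bsub>M\<^esub>j\<in>J'. s i j \<odot>\<^bsub>M\<^esub> z j) = S i z \<ominus>\<^bsub>M\<^esub> (c \<otimes> d i) \<odot>\<^bsub>M\<^esub> W z"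
      if z: "\<And>j. j \<in> J' \<Longrightarrow> z j \<in> carrier M" and i: "i < q" for i z
    proof -
      let ?D = "\<ominus> (c \<otimes> d i)"
      have D: "?D \<in> carrier R" using c d i by simp
      have "(\<Oplus>\<^bsub>M\<^esub>j\<in>J'. s i j \<odot>\<^bsub>M\<^esub> z j)
          = (\<Oplus>\<^bsub>M\<^esub>j\<in>J'. r i j \<odot>\<^bsub>M\<^esub> z j \<oplus>\<^bsub>M\<^esub> ?D \<odot>\<^bsub>M\<^esub> (e j \<odot>\<^bsub>M\<^esub> z j))"
      proof (rule M.add.finprod_cong')
        fix j assume j: "j \<in> J'"
        have "s i j = r i j \<oplus> ?D \<otimes> e j"
          using j i c d e J'(4) by (simp add: s_def a_minus_def l_minus)
        then show "s i j \<odot>\<^bsub>M\<^esub> z j = r i j \<odot>\<^bsub>M\<^esub> z j \<oplus>\<^bsub>M\<^esub> ?D \<odot>\<^bsub>M\<^esub> (e j \<odot>\<^bsub>M\<^esub> z j)"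
          using z[OF j] D e(1) j J'(4) Suc.prems(2) i by (simp add: smult_l_distr smult_assoc1)
      qed (use z D e(1) J'(4) Suc.prems(2) i in auto)
      also have "\<dots> = S i z \<oplus>\<^bsub>M\<^esub> (\<Oplus>\<^bsub>M\<^esub>j\<in>J'. ?D \<odot>\<^bsub>M\<^esub> (e j \<odot>\<^bsub>M\<^esub> z j))"
        unfolding S_def
        by (rule M.finsum_addf) (use z D e(1) J'(4) Suc.prems(2) i in auto)
      also have "(\<Oplus>\<^bsub>M\<^esub>j\<in>J'. ?D \<odot>\<^bsub>M\<^esub> (e j \<odot>\<^bsub>M\<^esub> z j)) = ?D \<odot>\<^bsub>M\<^esub> W z"
        unfolding W_def
        by (rule finsum_smult_ldistr[symmetric]) (use z D e(1) J' in auto)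
      also have "\<dots> = \<ominus>\<^bsub>M\<^esub> ((c \<otimes> d i) \<odot>\<^bsub>M\<^esub> W z)"
        using c d i Wc[of z, OF z] by (simp add: smult_l_minus)
      finally show ?thesis by (simp add: M.minus_eq)
    qed
    have split: "(\<Oplus>\<^bsub>M\<^esub>j\<in>J. r i j \<odot>\<^bsub>M\<^esub> z j) = (c \<otimes> d i) \<odot>\<^bsub>M\<^esub> z j0 \<oplus>\<^bsub>M\<^esub> S i z"
      if z: "\<And>j. j \<in> J \<Longrightarrow> z j \<in> carrier M" and i: "i < q" for i z
      using z i J' Suc.prems(2) d[OF i] c unfolding S_def J'(3)
      by (subst M.finsum_insert) auto
    have row0: "S i0 z = c \<odot>\<^bsub>M\<^esub> W z" if z: "\<And>j. j \<in> J' \<Longrightarrow> z j \<in> carrier M" for z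
    proof -
      have "S i0 z = (\<Oplus>\<^bsub>M\<^esub>j\<in>J'. c \<odot>\<^bsub>M\<^esub> (e j \<odot>\<^bsub>M\<^esub> z j))"
        unfolding S_def by (rule M.add.finprod_cong') (use z c e J' in \<open>auto simp: smult_assoc1\<close>)
      also have "\<dots> = c \<odot>\<^bsub>M\<^esub> W z"
        unfolding W_def
        by (rule finsum_smult_ldistr[symmetric]) (use z c e(1) J' in auto)
      finally show ?thesis .
    qed
    have xc: "x j0 \<in> carrier M" "\<And>j. j \<in> J' \<Longrightarrow> x j \<in> carrier M"
      using Suc.prems(4) j0 J'(4) by auto
    have Wx: "W x \<in> carrier M" using Wc xc(2) by blast
    have Sx: "S i x \<in> carrier M" if "i < q" for i using Sc xc(2) that by blast
    have di0: "c \<otimes> d i0 = c" using d(2)[OF i0] by (simp add: c_def)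
    have a0: "a i0 = c \<odot>\<^bsub>M\<^esub> (x j0 \<oplus>\<^bsub>M\<^esub> W x)"
      using split[of x, OF Suc.prems(4) i0] Suc.prems(5)[OF i0] row0[of x, OF xc(2)] xc(1) Wx c di0
      by (simp add: smult_r_distr)
    obtain n0 where n0: "n0 \<in> N" "c \<odot>\<^bsub>M\<^esub> n0 = a i0"
      using rd c xc(1) Wx a0 Suc.prems(3)[OF i0] unfolding relatively_divisible_def
      by (metis M.a_closed)
    have cd: "(c \<otimes> d i) \<odot>\<^bsub>M\<^esub> z = d i \<odot>\<^bsub>M\<^esub> (c \<odot>\<^bsub>M\<^esub> z)" if "i < q" "z \<in> carrier M" for i z
      using that c d(1) by (simp add: smult_assoc1 smult_comm)
    have "\<exists>y. (\<forall>j\<in>J'. y j \<in> N) \<and> (\<forall>i<q. (\<Oplus>\<^bsub>M\<^esub>j\<in>J'. s i j \<odot>\<^bsub>M\<^esub> y j) = b i)"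
    proof (rule Suc.hyps(1))
      show "n = card J'" using Suc.hyps(2) Suc.prems(1) j0 by (simp add: J'_def)
      show "s i j \<in> carrier R" if "i < q" "j \<in> J'" for i j
        using that c d(1) e(1) J'(4) Suc.prems(2) by (simp add: s_def)
      show "b i \<in> N" if "i < q" for i
        using that submodule_minus[OF N] Suc.prems(3) i0 d(1) submoduleE(4)[OF N] by (simp add: b_def)
      show "(\<Oplus>\<^bsub>M\<^esub>j\<in>J'. s i j \<odot>\<^bsub>M\<^esub> x j) = b i" if i: "i < q" for i
      proof -
        have "a i = (c \<otimes> d i) \<odot>\<^bsub>M\<^esub> x j0 \<oplus>\<^bsub>M\<^esub> S i x"
          using split[of x, OF Suc.prems(4) i] Suc.prems(5)[OF i] by simp
        moreover have "d i \<odot>\<^bsub>M\<^esub> a i0 = (c \<otimes> d i) \<odot>\<^bsub>M\<^esub> x j0 \<oplus>\<^bsub>M\<^esub> (c \<otimes> d i) \<odot>\<^bsub>M\<^esub> W x"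
          using a0 xc(1) Wx c d(1)[OF i] by (simp add: cd i smult_r_distr)
        ultimately have "b i = S i x \<ominus>\<^bsub>M\<^esub> (c \<otimes> d i) \<odot>\<^bsub>M\<^esub> W x"
          using xc(1) Wx Sx[OF i] c d(1)[OF i]
          by (simp add: b_def M.add_minus_add)
        then show ?thesis using lin[of x, OF xc(2) i] by simp
      qed
    qed (use J' xc in auto)
    then obtain y where y: "\<And>j. j \<in> J' \<Longrightarrow> y j \<in> N"
      "\<And>i. i < q \<Longrightarrow> (\<Oplus>\<^bsub>M\<^esub>j\<in>J'. s i j \<odot>\<^bsub>M\<^esub> y j) = b i" by blast
    have yc: "\<And>j. j \<in> J' \<Longrightarrow> y j \<in> carrier M" using y(1) Nc by blast
    (* The unknown j0 is chosen so that row i0 holds, that is, so that the combination w equals n0. *)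
    define y' where "y' = y(j0 := n0 \<ominus>\<^bsub>M\<^esub> W y)"
    have "W y \<in> N"
      unfolding W_def
      by (rule finsum_submodule[OF N]) (use J' y(1) e(1) submoduleE(4)[OF N] in auto)
    then have y'0: "y' j0 \<in> N" using n0 submodule_minus[OF N] by (simp add: y'_def)
    have eqs: "S i y' = S i y" "W y' = W y" if "i < q" for i
      unfolding S_def W_def using J' that yc Suc.prems(2) e(1)
      by (auto simp: y'_def intro!: M.add.finprod_cong')
    have y'N: "y' j \<in> N" if "j \<in> J" for j
      using y'0 y(1) that J' by (cases "j = j0") (auto simp: y'_def)
    have "(\<Oplus>\<^bsub>M\<^esub>j\<in>J. r i j \<odot>\<^bsub>M\<^esub> y' j) = a i" if i: "i < q" for i
    proof -
      have Wy: "W y \<in> carrier M" using Wc yc by blast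
      have Sy: "S i y \<in> carrier M" using Sc yc i by blast
      note ac = Nc[OF Suc.prems(3)[OF i]] Nc[OF Suc.prems(3)[OF i0]]
      have "(\<Oplus>\<^bsub>M\<^esub>j\<in>J. r i j \<odot>\<^bsub>M\<^esub> y' j) = (c \<otimes> d i) \<odot>\<^bsub>M\<^esub> (n0 \<ominus>\<^bsub>M\<^esub> W y) \<oplus>\<^bsub>M\<^esub> S i y"
        using split[of y', OF _ i] y'N Nc eqs i by (simp add: y'_def)
      also have "(c \<otimes> d i) \<odot>\<^bsub>M\<^esub> (n0 \<ominus>\<^bsub>M\<^esub> W y) = d i \<odot>\<^bsub>M\<^esub> a i0 \<ominus>\<^bsub>M\<^esub> (c \<otimes> d i) \<odot>\<^bsub>M\<^esub> W y"
        using c d(1)[OF i] Wy Nc[OF n0(1)] n0(2) cd[OF i Nc[OF n0(1)]] by (simp add: smult_minus)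
      also have "\<dots> \<oplus>\<^bsub>M\<^esub> S i y = d i \<odot>\<^bsub>M\<^esub> a i0 \<oplus>\<^bsub>M\<^esub> (S i y \<ominus>\<^bsub>M\<^esub> (c \<otimes> d i) \<odot>\<^bsub>M\<^esub> W y)"
        using c d(1)[OF i] Wy Sy ac by (simp add: M.minus_eq M.a_ac)
      also have "S i y \<ominus>\<^bsub>M\<^esub> (c \<otimes> d i) \<odot>\<^bsub>M\<^esub> W y = b i" using lin[of y, OF yc i] y(2)[OF i] by simp
      also have "d i \<odot>\<^bsub>M\<^esub> a i0 \<oplus>\<^bsub>M\<^esub> b i = a i"
        using ac d(1)[OF i] by (simp add: b_def M.minus_eq M.a_ac M.r_neg1 M.r_neg)
      finally show ?thesis .
    qed
    then show ?thesis using y'N by blast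
  qed
qed

lemma relatively_divisible_imp_pure_submodule:
  assumes "relatively_divisible N"
  shows "pure_submodule R M N"
  unfolding pure_submodule_def
proof (intro conjI allI impI)
  show "submodule N R M" using assms by (simp add: relatively_divisible_def)
  fix s q :: nat and r a
  assume "(\<forall>i<s. \<forall>j<q. r i j \<in> carrier R) \<and> (\<forall>i<s. a i \<in> N) \<and>
    (\<exists>x. (\<forall>j<q. x j \<in> carrier M) \<and> (\<forall>i<s. (\<Oplus>\<^bsub>M\<^esub>j\<in>{..<q}. r i j \<odot>\<^bsub>M\<^esub> x j) = a i))"
  then obtain x where "\<forall>i<s. \<forall>j<q. r i j \<in> carrier R" "\<forall>i<s. a i \<in> N"
    "\<forall>j<q. x j \<in> carrier M" "\<forall>i<s. (\<Oplus>\<^bsub>M\<^esub>j\<in>{..<q}. r i j \<odot>\<^bsub>M\<^esub> x j) = a i"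
    by blast
  then show "\<exists>y. (\<forall>j<q. y j \<in> N) \<and> (\<forall>i<s. (\<Oplus>\<^bsub>M\<^esub>j\<in>{..<q}. r i j \<odot>\<^bsub>M\<^esub> y j) = a i)"
    using relatively_divisible_solve[OF assms, of "{..<q}" s r a x] by auto
qed

section \<open>Pure-essential submodules\<close>

lemma mem_set_add: "z \<in> N <+>\<^bsub>M\<^esub> K \<longleftrightarrow> (\<exists>n\<in>N. \<exists>k\<in>K. z = n \<oplus>\<^bsub>M\<^esub> k)"
  by (auto simp: set_add_def')

lemma submodule_set_add:
  assumes "submodule N R M" "submodule K R M"
  shows "submodule (N <+>\<^bsub>M\<^esub> K) R M" "N \<subseteq> N <+>\<^bsub>M\<^esub> K" "K \<subseteq> N <+>\<^bsub>M\<^esub> K"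
proof -
  note N = submoduleE[OF assms(1)] submodule_zero[OF assms(1)]
  note K = submoduleE[OF assms(2)] submodule_zero[OF assms(2)]
  note c = submodule_carrier[OF assms(1)] submodule_carrier[OF assms(2)]
  show "N \<subseteq> N <+>\<^bsub>M\<^esub> K" "K \<subseteq> N <+>\<^bsub>M\<^esub> K"
    using N(7) K(7) c by (auto simp: mem_set_add) (metis M.r_zero, metis M.l_zero)
  show "submodule (N <+>\<^bsub>M\<^esub> K) R M"
  proof (rule submoduleI)
    show "N <+>\<^bsub>M\<^esub> K \<subseteq> carrier M" using c by (auto simp: mem_set_add)
    show "\<zero>\<^bsub>M\<^esub> \<in> N <+>\<^bsub>M\<^esub> K"
      unfolding mem_set_add by (intro bexI[OF _ N(7)] bexI[OF _ K(7)]) simp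
  next
    fix z assume "z \<in> N <+>\<^bsub>M\<^esub> K"
    then obtain n k where nk: "n \<in> N" "k \<in> K" "z = n \<oplus>\<^bsub>M\<^esub> k" by (auto simp: mem_set_add)
    then have "\<ominus>\<^bsub>M\<^esub> z = \<ominus>\<^bsub>M\<^esub> n \<oplus>\<^bsub>M\<^esub> \<ominus>\<^bsub>M\<^esub> k" using c by (simp add: M.minus_add)
    then show "\<ominus>\<^bsub>M\<^esub> z \<in> N <+>\<^bsub>M\<^esub> K" using nk N(3) K(3) unfolding mem_set_add by blast
    fix r assume r: "r \<in> carrier R"
    have "r \<odot>\<^bsub>M\<^esub> z = r \<odot>\<^bsub>M\<^esub> n \<oplus>\<^bsub>M\<^esub> r \<odot>\<^bsub>M\<^esub> k" using nk c r by (simp add: smult_r_distr)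
    then show "r \<odot>\<^bsub>M\<^esub> z \<in> N <+>\<^bsub>M\<^esub> K" using nk N(4) K(4) r unfolding mem_set_add by blast
  next
    fix z w assume "z \<in> N <+>\<^bsub>M\<^esub> K" "w \<in> N <+>\<^bsub>M\<^esub> K"
    then obtain n k n' k' where nk: "n \<in> N" "k \<in> K" "z = n \<oplus>\<^bsub>M\<^esub> k" "n' \<in> N" "k' \<in> K" "w = n' \<oplus>\<^bsub>M\<^esub> k'"
      by (auto simp: mem_set_add)
    then have "z \<oplus>\<^bsub>M\<^esub> w = (n \<oplus>\<^bsub>M\<^esub> n') \<oplus>\<^bsub>M\<^esub> (k \<oplus>\<^bsub>M\<^esub> k')" using c by (simp add: M.a_ac)
    then show "z \<oplus>\<^bsub>M\<^esub> w \<in> N <+>\<^bsub>M\<^esub> K" using nk N(5) K(5) unfolding mem_set_add by blast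
  qed
qed

lemma set_add_least:
  "submodule U R M \<Longrightarrow> N \<subseteq> U \<Longrightarrow> K \<subseteq> U \<Longrightarrow> N <+>\<^bsub>M\<^esub> K \<subseteq> U"
  by (auto simp: mem_set_add submoduleE(5) subset_eq)

definition multiples :: "'a \<Rightarrow> 'c set" where
  "multiples r = (\<lambda>x. r \<odot>\<^bsub>M\<^esub> x) ` carrier M"

definition cyclic :: "'c \<Rightarrow> 'c set" where
  "cyclic b = (\<lambda>r. r \<odot>\<^bsub>M\<^esub> b) ` carrier R"

lemma submodule_multiples:
  assumes r: "r \<in> carrier R"
  shows "submodule (multiples r) R M"
proof (rule submoduleI)
  show "\<zero>\<^bsub>M\<^esub> \<in> multiples r" unfolding multiples_def by (rule image_eqI[of _ _ "\<zero>\<^bsub>M\<^esub>"]) (use r in auto)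
next
  fix y assume "y \<in> multiples r"
  then obtain x where x: "x \<in> carrier M" "y = r \<odot>\<^bsub>M\<^esub> x" by (auto simp: multiples_def)
  show "\<ominus>\<^bsub>M\<^esub> y \<in> multiples r"
    unfolding multiples_def by (rule image_eqI[of _ _ "\<ominus>\<^bsub>M\<^esub> x"]) (use x r in \<open>auto simp: smult_r_minus\<close>)
  fix s assume "s \<in> carrier R"
  then show "s \<odot>\<^bsub>M\<^esub> y \<in> multiples r"
    unfolding multiples_def using x r by (intro image_eqI[of _ _ "s \<odot>\<^bsub>M\<^esub> x"]) (auto simp: smult_comm)
next
  fix y z assume "y \<in> multiples r" "z \<in> multiples r"
  then show "y \<oplus>\<^bsub>M\<^esub> z \<in> multiples r"
    using r by (auto simp: multiples_def smult_r_distr[symmetric])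
qed (use r in \<open>auto simp: multiples_def\<close>)

lemma submodule_cyclic:
  assumes b: "b \<in> carrier M"
  shows "submodule (cyclic b) R M" "b \<in> cyclic b"
proof -
  show "b \<in> cyclic b" unfolding cyclic_def by (rule image_eqI[of _ _ \<one>]) (use b in auto)
  show "submodule (cyclic b) R M"
  proof (rule submoduleI)
    show "\<zero>\<^bsub>M\<^esub> \<in> cyclic b" unfolding cyclic_def by (rule image_eqI[of _ _ \<zero>]) (use b in auto)
  next
    fix y assume "y \<in> cyclic b"
    then obtain r where r: "r \<in> carrier R" "y = r \<odot>\<^bsub>M\<^esub> b" by (auto simp: cyclic_def)
    show "\<ominus>\<^bsub>M\<^esub> y \<in> cyclic b"
      unfolding cyclic_def by (rule image_eqI[of _ _ "\<ominus> r"]) (use r b in \<open>auto simp: smult_l_minus\<close>)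
    fix s assume "s \<in> carrier R"
    then show "s \<odot>\<^bsub>M\<^esub> y \<in> cyclic b"
      unfolding cyclic_def using r b by (intro image_eqI[of _ _ "s \<otimes> r"]) (auto simp: smult_assoc1)
  next
    fix y z assume "y \<in> cyclic b" "z \<in> cyclic b"
    then show "y \<oplus>\<^bsub>M\<^esub> z \<in> cyclic b"
      using b by (auto simp: cyclic_def smult_l_distr[symmetric])
  qed (use b in \<open>auto simp: cyclic_def\<close>)
qed

lemma cyclic_least: "submodule N R M \<Longrightarrow> b \<in> N \<Longrightarrow> cyclic b \<subseteq> N"
  by (auto simp: cyclic_def submoduleE(4))

definition p_divisible :: "'c set \<Rightarrow> bool" where
  "p_divisible X \<longleftrightarrow> submodule X R M \<and> (\<forall>x\<in>X. \<exists>y\<in>X. x = p \<odot>\<^bsub>M\<^esub> y)"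

lemma pow_Suc_smult:
  "x \<in> carrier M \<Longrightarrow> p [^] Suc k \<odot>\<^bsub>M\<^esub> x = p [^] k \<odot>\<^bsub>M\<^esub> (p \<odot>\<^bsub>M\<^esub> x)"
  "x \<in> carrier M \<Longrightarrow> p [^] Suc k \<odot>\<^bsub>M\<^esub> x = p \<odot>\<^bsub>M\<^esub> (p [^] k \<odot>\<^bsub>M\<^esub> x)"
  by (simp_all add: smult_assoc1[symmetric] m_comm)

lemma pow_add_smult:
  "x \<in> carrier M \<Longrightarrow> p [^] (k + l) \<odot>\<^bsub>M\<^esub> x = p [^] (k::nat) \<odot>\<^bsub>M\<^esub> (p [^] l \<odot>\<^bsub>M\<^esub> x)"
  by (simp add: smult_assoc1[symmetric] nat_pow_mult)

lemma p_divisible_pow: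
  assumes "p_divisible X" "x \<in> X"
  shows "\<exists>y\<in>X. x = p [^] (k::nat) \<odot>\<^bsub>M\<^esub> y"
proof (induction k)
  case 0
  show ?case using assms submodule_carrier[of X x] by (intro bexI[of _ x]) (auto simp: p_divisible_def)
next
  case (Suc k)
  then obtain y where y: "y \<in> X" "x = p [^] k \<odot>\<^bsub>M\<^esub> y" by blast
  then obtain z where "z \<in> X" "y = p \<odot>\<^bsub>M\<^esub> z" using assms(1) by (auto simp: p_divisible_def)
  then show ?case using y assms(1) submodule_carrier[of X z] pow_Suc_smult(1)[of z k]
    by (intro bexI[of _ z]) (auto simp: p_divisible_def)
qed

text \<open>
  Purity of the image of \<open>X + A\<close> in \<open>M/X\<close> is a statement about systems of equations in cosets; testing
  on single equations turns it into a condition in \<open>M\<close> itself.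
\<close>

lemma pure_essential_trivial:
  assumes pe: "pure_essential R M A" and X: "submodule X R M" and XA: "X \<inter> A = {\<zero>\<^bsub>M\<^esub>}"
    and rd: "relatively_divisible (X <+>\<^bsub>M\<^esub> A)"
  shows "X = {\<zero>\<^bsub>M\<^esub>}"
proof -
  let ?Q = "quot_module M X" and ?S = "X <+>\<^bsub>M\<^esub> A"
  let ?q = "\<lambda>b. X +>\<^bsub>M\<^esub> b"
  interpret Q: module R ?Q by (rule module_quot_module[OF X])
  interpret Q: dvr_module R p ?Q ..
  note qs = quot_module_simps[OF X]
  have A: "submodule A R M" using pe by (simp add: pure_essential_def pure_submodule_def)
  note S = submodule_set_add[OF X A]
  have q_mem: "b \<in> ?S" if bs: "b \<in> carrier M" "s \<in> ?S" "?q b = ?q s" for b s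
  proof -
    have "b \<in> ?q b"
      using bs(1) submodule_zero[OF X] by (force simp: a_r_coset_def')
    then obtain x where "x \<in> X" "b = x \<oplus>\<^bsub>M\<^esub> s" using bs(3) by (auto simp: a_r_coset_def')
    then show ?thesis using S bs(2) submoduleE(5)[OF S(1)] by blast
  qed
  have "submodule (?q ` ?S) R ?Q"
  proof (rule Q.submoduleI)
    show "?q ` ?S \<subseteq> carrier ?Q" using submoduleE(1)[OF S(1)] by (auto simp: qs(4))
    show "\<zero>\<^bsub>?Q\<^esub> \<in> ?q ` ?S" using submodule_zero[OF S(1)] by (simp add: qs(3))
  next
    fix Y assume "Y \<in> ?q ` ?S"
    then obtain s where s: "s \<in> ?S" "Y = ?q s" by blast
    note sc = submodule_carrier[OF S(1) s(1)]
    have smu: "r \<odot>\<^bsub>?Q\<^esub> Y \<in> ?q ` ?S" if "r \<in> carrier R" for r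
      using qs(2)[OF that sc] s submoduleE(4)[OF S(1) that s(1)] by simp
    then show "r \<odot>\<^bsub>?Q\<^esub> Y \<in> ?q ` ?S" if "r \<in> carrier R" for r using that .
    have "Y \<in> carrier ?Q" using s sc by (auto simp: qs(4))
    then show "\<ominus>\<^bsub>?Q\<^esub> Y \<in> ?q ` ?S" using smu[of "\<ominus> \<one>"] Q.smult_l_minus[of \<one> Y] by simp
  next
    fix Y Z assume "Y \<in> ?q ` ?S" "Z \<in> ?q ` ?S"
    then obtain s t where "s \<in> ?S" "Y = ?q s" "t \<in> ?S" "Z = ?q t" by blast
    then show "Y \<oplus>\<^bsub>?Q\<^esub> Z \<in> ?q ` ?S"
      using qs(1)[of s t] submodule_carrier[OF S(1)] submoduleE(5)[OF S(1)] by auto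
  qed
  then have "Q.relatively_divisible (?q ` ?S)"
    unfolding Q.relatively_divisible_def
  proof (intro conjI ballI impI)
    fix r Y assume r: "r \<in> carrier R" and "Y \<in> carrier ?Q" and rY: "r \<odot>\<^bsub>?Q\<^esub> Y \<in> ?q ` ?S"
    then obtain y where y: "y \<in> carrier M" "Y = ?q y" by (auto simp: qs(4))
    then have "r \<odot>\<^bsub>M\<^esub> y \<in> ?S" using q_mem[of "r \<odot>\<^bsub>M\<^esub> y"] r rY by (auto simp: qs(2))
    then obtain s where s: "s \<in> ?S" "r \<odot>\<^bsub>M\<^esub> s = r \<odot>\<^bsub>M\<^esub> y"
      using rd r y(1) unfolding relatively_divisible_def by blast
    then show "\<exists>Z\<in>?q ` ?S. r \<odot>\<^bsub>?Q\<^esub> Z = r \<odot>\<^bsub>?Q\<^esub> Y"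
      using y r submodule_carrier[OF S(1) s(1)] by (intro bexI[of _ "?q s"]) (simp_all add: qs(2))
  qed
  then have "pure_submodule R ?Q (?q ` ?S)" by (rule Q.relatively_divisible_imp_pure_submodule)
  then show ?thesis using pe X XA unfolding pure_essential_def by blast
qed

lemma pure_essential_relatively_divisible: "pure_essential R M A \<Longrightarrow> relatively_divisible A"
  by (simp add: pure_essential_def pure_submodule_imp_relatively_divisible)

lemma relatively_divisibleE:
  assumes "relatively_divisible A" "x \<in> carrier M" "p [^] (k::nat) \<odot>\<^bsub>M\<^esub> x \<in> A"
  obtains a where "a \<in> A" "p [^] k \<odot>\<^bsub>M\<^esub> a = p [^] k \<odot>\<^bsub>M\<^esub> x"
  using assms unfolding relatively_divisible_def by (meson nat_pow_closed p_closed)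

lemma eq_diff: "x = y \<oplus>\<^bsub>M\<^esub> z \<Longrightarrow> y \<in> carrier M \<Longrightarrow> z \<in> carrier M \<Longrightarrow> x \<ominus>\<^bsub>M\<^esub> y = z"
  using M.a_comm[of y z] by (simp add: M.minus_eq M.a_assoc M.r_neg)

lemma diff_eq: "x \<ominus>\<^bsub>M\<^esub> y = z \<Longrightarrow> x \<in> carrier M \<Longrightarrow> y \<in> carrier M \<Longrightarrow> x = y \<oplus>\<^bsub>M\<^esub> z"
  using M.r_neg2[of y x] by (auto simp add: M.minus_eq M.a_lcomm[of y x] M.r_neg)

text \<open>
  If \<open>p\<^sup>k z = x + a\<close> with \<open>x = p\<^sup>k x'\<close>, then \<open>p\<^sup>k (z - x') = a\<close> is solvable in \<open>A\<close>. So adding a divisible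
  submodule to a pure one preserves purity.
\<close>

lemma pure_essential_divisible:
  assumes pe: "pure_essential R M A" and X: "p_divisible X" and XA: "X \<inter> A = {\<zero>\<^bsub>M\<^esub>}"
  shows "X = {\<zero>\<^bsub>M\<^esub>}"
proof (rule pure_essential_trivial[OF pe _ XA])
  note rd = pure_essential_relatively_divisible[OF pe]
  have A: "submodule A R M" using rd by (simp add: relatively_divisible_def)
  show Xs: "submodule X R M" using X by (simp add: p_divisible_def)
  note S = submodule_set_add[OF Xs A]
  show "relatively_divisible (X <+>\<^bsub>M\<^esub> A)"
  proof (rule relatively_divisibleI[OF S(1)])
    fix k :: nat and z assume z: "z \<in> carrier M" "p [^] k \<odot>\<^bsub>M\<^esub> z \<in> X <+>\<^bsub>M\<^esub> A"
    then obtain x a where xa: "x \<in> X" "a \<in> A" "p [^] k \<odot>\<^bsub>M\<^esub> z = x \<oplus>\<^bsub>M\<^esub> a" by (auto simp: mem_set_add)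
    obtain x' where x': "x' \<in> X" "x = p [^] k \<odot>\<^bsub>M\<^esub> x'" using p_divisible_pow[OF X xa(1)] by blast
    note c = submodule_carrier[OF Xs x'(1)] submodule_carrier[OF Xs xa(1)] submodule_carrier[OF A xa(2)]
    have "p [^] k \<odot>\<^bsub>M\<^esub> (z \<ominus>\<^bsub>M\<^esub> x') = a"
      using c z(1) x'(2) eq_diff[OF xa(3)] by (simp add: smult_minus)
    then obtain a' where a': "a' \<in> A" "p [^] k \<odot>\<^bsub>M\<^esub> a' = a"
      using relatively_divisibleE[OF rd, of "z \<ominus>\<^bsub>M\<^esub> x'" k] c z(1) xa(2) by auto
    have "p [^] k \<odot>\<^bsub>M\<^esub> (x' \<oplus>\<^bsub>M\<^esub> a') = p [^] k \<odot>\<^bsub>M\<^esub> z"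
      using a' x' c submodule_carrier[OF A a'(1)] xa(3) by (simp add: smult_r_distr)
    then show "\<exists>y\<in>X <+>\<^bsub>M\<^esub> A. p [^] k \<odot>\<^bsub>M\<^esub> y = p [^] k \<odot>\<^bsub>M\<^esub> z"
      using x'(1) a'(1) by (intro bexI[of _ "x' \<oplus>\<^bsub>M\<^esub> a'"]) (auto simp: mem_set_add)
  qed
qed

text \<open>
  The hypothesis says that \<open>p\<^sup>i b\<close>, unless it is zero, is not divisible by \<open>p\<^bsup>i+1\<^esup>\<close> modulo
  \<open>A\<close>. It makes \<open>R b + A\<close> pure, and its instance \<open>y = 0\<close> gives \<open>R b \<inter> A = 0\<close>.
\<close>

lemma pure_essential_cyclic:
  assumes pe: "pure_essential R M A" and b: "b \<in> carrier M"
    and H: "\<And>i y. y \<in> carrier M \<Longrightarrow> p [^] Suc i \<odot>\<^bsub>M\<^esub> y \<ominus>\<^bsub>M\<^esub> p [^] i \<odot>\<^bsub>M\<^esub> b \<in> A \<Longrightarrow>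
      p [^] i \<odot>\<^bsub>M\<^esub> b = \<zero>\<^bsub>M\<^esub>"
  shows "b = \<zero>\<^bsub>M\<^esub>"
proof -
  note rd = pure_essential_relatively_divisible[OF pe]
  have A: "submodule A R M" using rd by (simp add: relatively_divisible_def)
  note X = submodule_cyclic[OF b]
  note S = submodule_set_add[OF X(1) A]
  have key: "r \<odot>\<^bsub>M\<^esub> b = \<zero>\<^bsub>M\<^esub> \<or> (\<exists>s\<in>carrier R. r = p [^] k \<otimes> s)"
    if r: "r \<in> carrier R" and y: "y \<in> carrier M" and mem: "p [^] k \<odot>\<^bsub>M\<^esub> y \<ominus>\<^bsub>M\<^esub> r \<odot>\<^bsub>M\<^esub> b \<in> A" for r y and k :: nat
  proof (cases "r = \<zero>")
    case True
    then show ?thesis using b by simp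
  next
    case False
    then obtain i u where u: "u \<in> Units R" "r = p [^] (i::nat) \<otimes> u" using factor r by blast
    note uc = Units_closed[OF u(1)]
    show ?thesis
    proof (cases "k \<le> i")
      case True
      then have "p [^] i = p [^] k \<otimes> p [^] (i - k)" by (simp add: nat_pow_mult)
      then have "r = p [^] k \<otimes> (p [^] (i - k) \<otimes> u)" using u uc by (simp add: m_assoc)
      then show ?thesis using uc by blast
    next
      case False
      define v where "v = inv u"
      have v: "v \<in> carrier R" "v \<otimes> u = \<one>" using u by (auto simp: v_def)
      (* Here i < k: cancelling the unit u from r = p^i u brings p^k y - r b into the form of the hypothesis. *)
      define w where "w = v \<odot>\<^bsub>M\<^esub> (p [^] (k - Suc i) \<odot>\<^bsub>M\<^esub> y)"
      have w: "w \<in> carrier M" using v y by (simp add: w_def)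
      have "v \<odot>\<^bsub>M\<^esub> (p [^] k \<odot>\<^bsub>M\<^esub> y) = p [^] Suc i \<odot>\<^bsub>M\<^esub> w"
      proof -
        have "p [^] k \<odot>\<^bsub>M\<^esub> y = p [^] Suc i \<odot>\<^bsub>M\<^esub> (p [^] (k - Suc i) \<odot>\<^bsub>M\<^esub> y)"
          using False pow_add_smult[OF y, of "Suc i" "k - Suc i"] by simp
        then show ?thesis using v y unfolding w_def
          by (simp only: smult_comm nat_pow_closed p_closed smult_closed)
      qed
      moreover have "v \<odot>\<^bsub>M\<^esub> (r \<odot>\<^bsub>M\<^esub> b) = p [^] i \<odot>\<^bsub>M\<^esub> b"
      proof -
        have "v \<otimes> r = p [^] i \<otimes> (v \<otimes> u)" using u v uc m_lcomm[of v "p [^] i" u] by simp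
        then show ?thesis using v r b by (simp add: smult_assoc1[symmetric])
      qed
      moreover have "v \<odot>\<^bsub>M\<^esub> (p [^] k \<odot>\<^bsub>M\<^esub> y \<ominus>\<^bsub>M\<^esub> r \<odot>\<^bsub>M\<^esub> b) \<in> A"
        using submoduleE(4)[OF A v(1) mem] .
      ultimately have "p [^] Suc i \<odot>\<^bsub>M\<^esub> w \<ominus>\<^bsub>M\<^esub> p [^] i \<odot>\<^bsub>M\<^esub> b \<in> A"
        using v r y b by (simp add: smult_minus del: nat_pow_Suc)
      then have "p [^] i \<odot>\<^bsub>M\<^esub> b = \<zero>\<^bsub>M\<^esub>" using H w by blast
      then have "u \<odot>\<^bsub>M\<^esub> (p [^] i \<odot>\<^bsub>M\<^esub> b) = \<zero>\<^bsub>M\<^esub>" using uc by simp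
      then show ?thesis using u uc b by (simp add: smult_assoc1 smult_comm)
    qed
  qed
  have "cyclic b = {\<zero>\<^bsub>M\<^esub>}"
  proof (rule pure_essential_trivial[OF pe X(1)])
    have "z = \<zero>\<^bsub>M\<^esub>" if z: "z \<in> cyclic b" "z \<in> A" for z
    proof -
      obtain r where r: "r \<in> carrier R" "z = r \<odot>\<^bsub>M\<^esub> b" using z(1) by (auto simp: cyclic_def)
      show ?thesis
      proof (cases "r = \<zero>")
        case True
        then show ?thesis using r b by simp
      next
        case False
        then obtain i u where u: "u \<in> Units R" "r = p [^] (i::nat) \<otimes> u" using factor r by blast
        note uc = Units_closed[OF u(1)]
        have zu: "z = u \<odot>\<^bsub>M\<^esub> (p [^] i \<odot>\<^bsub>M\<^esub> b)" using u uc b r by (simp add: smult_assoc1 smult_comm)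
        then have "p [^] i \<odot>\<^bsub>M\<^esub> b \<in> A" using z(2) unit_cancel[OF A u(1)] b by auto
        then have "p [^] Suc i \<odot>\<^bsub>M\<^esub> \<zero>\<^bsub>M\<^esub> \<ominus>\<^bsub>M\<^esub> p [^] i \<odot>\<^bsub>M\<^esub> b \<in> A"
          using submodule_minus[OF A submodule_zero[OF A]] by (simp del: nat_pow_Suc)
        then have "p [^] i \<odot>\<^bsub>M\<^esub> b = \<zero>\<^bsub>M\<^esub>" by (rule H[rotated]) simp
        then show ?thesis using zu uc by simp
      qed
    qed
    then show "cyclic b \<inter> A = {\<zero>\<^bsub>M\<^esub>}" using submodule_zero[OF X(1)] submodule_zero[OF A] by blast
    show "relatively_divisible (cyclic b <+>\<^bsub>M\<^esub> A)"
    proof (rule relatively_divisibleI[OF S(1)])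
      fix k :: nat and y assume y: "y \<in> carrier M" "p [^] k \<odot>\<^bsub>M\<^esub> y \<in> cyclic b <+>\<^bsub>M\<^esub> A"
      then obtain r a where r: "r \<in> carrier R" and a: "a \<in> A" and eq: "p [^] k \<odot>\<^bsub>M\<^esub> y = r \<odot>\<^bsub>M\<^esub> b \<oplus>\<^bsub>M\<^esub> a"
        by (auto simp: mem_set_add cyclic_def)
      note ac = submodule_carrier[OF A a]
      have diff: "p [^] k \<odot>\<^bsub>M\<^esub> y \<ominus>\<^bsub>M\<^esub> r \<odot>\<^bsub>M\<^esub> b = a" using eq_diff[OF eq] r b ac by simp
      have "\<exists>s\<in>carrier R. r \<odot>\<^bsub>M\<^esub> b = p [^] k \<odot>\<^bsub>M\<^esub> (s \<odot>\<^bsub>M\<^esub> b)"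
        using key[OF r y(1), of k, unfolded diff, OF a]
      proof (elim disjE bexE)
        assume "r \<odot>\<^bsub>M\<^esub> b = \<zero>\<^bsub>M\<^esub>"
        then show ?thesis using b by (intro bexI[of _ \<zero>]) auto
      next
        fix s assume "s \<in> carrier R" "r = p [^] k \<otimes> s"
        then show ?thesis using b by (auto simp: smult_assoc1)
      qed
      then obtain s where s: "s \<in> carrier R" "r \<odot>\<^bsub>M\<^esub> b = p [^] k \<odot>\<^bsub>M\<^esub> (s \<odot>\<^bsub>M\<^esub> b)" by blast
      have "p [^] k \<odot>\<^bsub>M\<^esub> (y \<ominus>\<^bsub>M\<^esub> s \<odot>\<^bsub>M\<^esub> b) = a" using diff s y(1) b by (simp add: smult_minus)
      then obtain a' where a': "a' \<in> A" "p [^] k \<odot>\<^bsub>M\<^esub> a' = a"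
        using relatively_divisibleE[OF rd, of "y \<ominus>\<^bsub>M\<^esub> s \<odot>\<^bsub>M\<^esub> b" k] s(1) b y(1) a by auto
      have "p [^] k \<odot>\<^bsub>M\<^esub> (s \<odot>\<^bsub>M\<^esub> b \<oplus>\<^bsub>M\<^esub> a') = p [^] k \<odot>\<^bsub>M\<^esub> y"
        using a' s b submodule_carrier[OF A a'(1)] eq by (simp add: smult_r_distr)
      then show "\<exists>z\<in>cyclic b <+>\<^bsub>M\<^esub> A. p [^] k \<odot>\<^bsub>M\<^esub> z = p [^] k \<odot>\<^bsub>M\<^esub> y"
        using s(1) a'(1)
        by (intro bexI[of _ "s \<odot>\<^bsub>M\<^esub> b \<oplus>\<^bsub>M\<^esub> a'"]) (auto simp: mem_set_add cyclic_def)
    qed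
  qed
  then show ?thesis using X(2) by blast
qed

text \<open>
  Suppose \<open>b\<close> lies outside \<open>A + p M\<close>. If \<open>b\<close> can be chosen to be torsion, choose it of least possible
  order. Should \<open>p\<^bsup>i+1\<^esup> y - p\<^sup>i b\<close> be in \<open>A\<close>, then by purity \<open>p\<^sup>i\<close> kills \<open>p y - b - a\<close> for some \<open>a \<in> A\<close>. This
  element is again outside \<open>A + p M\<close>, so minimality gives \<open>p\<^sup>i b = 0\<close>, and if there is no torsion
  element outside \<open>A + p M\<close> this is a contradiction. Hence \<open>pure_essential_cyclic\<close> applies, and \<open>b = 0\<close>
  lies in \<open>A + p M\<close> after all.
\<close>

theorem pure_essential_quotient_divisible:
  assumes pe: "pure_essential R M A"
  shows "carrier M = A <+>\<^bsub>M\<^esub> multiples p"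
proof (rule ccontr)
  note rd = pure_essential_relatively_divisible[OF pe]
  have A: "submodule A R M" using rd by (simp add: relatively_divisible_def)
  note S = submodule_set_add[OF A submodule_multiples[OF p_closed]]
  let ?S = "A <+>\<^bsub>M\<^esub> multiples p"
  note Ac = submodule_carrier[OF A]
  assume "carrier M \<noteq> ?S"
  then obtain b0 where b0: "b0 \<in> carrier M" "b0 \<notin> ?S" using submoduleE(1)[OF S(1)] by blast
  (* If no element outside A + p M is torsion, b0 has the property of b vacuously; otherwise one of least order has it. *)
  define T where "T n \<longleftrightarrow> (\<exists>c\<in>carrier M. c \<notin> ?S \<and> p [^] n \<odot>\<^bsub>M\<^esub> c = \<zero>\<^bsub>M\<^esub>)" for n :: nat
  obtain b where b: "b \<in> carrier M" "b \<notin> ?S"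
    and least: "\<And>i. T i \<Longrightarrow> p [^] i \<odot>\<^bsub>M\<^esub> b = \<zero>\<^bsub>M\<^esub>"
  proof (cases "\<exists>n. T n")
    case False
    then show ?thesis using b0 that by blast
  next
    case True
    then have "T (LEAST n. T n)" by (rule LeastI_ex)
    then obtain c where c: "c \<in> carrier M" "c \<notin> ?S" "p [^] (LEAST n. T n) \<odot>\<^bsub>M\<^esub> c = \<zero>\<^bsub>M\<^esub>"
      unfolding T_def by blast
    have "p [^] i \<odot>\<^bsub>M\<^esub> c = \<zero>\<^bsub>M\<^esub>" if "T i" for i
    proof -
      have "(LEAST n. T n) \<le> i" using that by (rule Least_le)
      then have "p [^] i \<odot>\<^bsub>M\<^esub> c = p [^] (i - (LEAST n. T n)) \<odot>\<^bsub>M\<^esub> (p [^] (LEAST n. T n) \<odot>\<^bsub>M\<^esub> c)"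
        using pow_add_smult[OF c(1), of "i - (LEAST n. T n)" "LEAST n. T n"] by simp
      then show ?thesis using c(3) by simp
    qed
    then show ?thesis using c that by blast
  qed
  have "b = \<zero>\<^bsub>M\<^esub>"
  proof (rule pure_essential_cyclic[OF pe b(1)])
    fix i y assume y: "y \<in> carrier M" "p [^] Suc i \<odot>\<^bsub>M\<^esub> y \<ominus>\<^bsub>M\<^esub> p [^] i \<odot>\<^bsub>M\<^esub> b \<in> A"
    define z where "z = p \<odot>\<^bsub>M\<^esub> y \<ominus>\<^bsub>M\<^esub> b"
    have z: "z \<in> carrier M" using y b by (simp add: z_def)
    have "p [^] i \<odot>\<^bsub>M\<^esub> z \<in> A"
      using y(2) y(1) b unfolding pow_Suc_smult(1)[OF y(1)] by (simp add: z_def smult_minus)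
    then obtain a where a: "a \<in> A" "p [^] i \<odot>\<^bsub>M\<^esub> a = p [^] i \<odot>\<^bsub>M\<^esub> z"
      using relatively_divisibleE[OF rd z] by blast
    define c where "c = z \<ominus>\<^bsub>M\<^esub> a"
    have c: "c \<in> carrier M" using z Ac[OF a(1)] by (simp add: c_def)
    have pc: "p [^] i \<odot>\<^bsub>M\<^esub> c = \<zero>\<^bsub>M\<^esub>" 
      using z Ac[OF a(1)] a(2) by (simp add: c_def smult_minus) (simp add: M.r_neg M.minus_eq)
    have "c \<notin> ?S"
    proof
      assume "c \<in> ?S"
      moreover have "a \<in> ?S" using a(1) S(2) by blast
      moreover have "z = a \<oplus>\<^bsub>M\<^esub> c" using diff_eq[OF c_def[symmetric] z Ac[OF a(1)]] .
      ultimately have "z \<in> ?S" using submoduleE(5)[OF S(1)] by simp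
      moreover have "p \<odot>\<^bsub>M\<^esub> y \<in> ?S" using S(3) y(1) by (auto simp: multiples_def)
      moreover have "b = p \<odot>\<^bsub>M\<^esub> y \<ominus>\<^bsub>M\<^esub> z"
        using diff_eq[OF z_def[symmetric]] eq_diff[of "p \<odot>\<^bsub>M\<^esub> y" z b] y(1) b(1) z by (simp add: M.a_comm)
      ultimately show False using b(2) submodule_minus[OF S(1)] by metis
    qed
    then show "p [^] i \<odot>\<^bsub>M\<^esub> b = \<zero>\<^bsub>M\<^esub>" using least c pc by (auto simp: T_def)
  qed
  then show False using b(2) submodule_zero[OF S(1)] by simp
qed

section \<open>Complements of divisible submodules\<close>

text \<open>
  Injectivity of divisible modules, in the form needed here. A submodule \<open>C\<close> of \<open>X\<close> maximal with
  \<open>C \<inter> D = 0\<close> is a complement: if \<open>p z = c + p e\<close> with \<open>c \<in> C\<close>, \<open>e \<in> D\<close>, then \<open>p (z - e) \<in> C\<close>, and by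
  maximality of \<open>C\<close> no element outside \<open>C + D\<close> has its \<open>p\<close>-multiple in \<open>C\<close>.
\<close>

lemma p_divisible_complement:
  assumes X: "p_divisible X" and D: "p_divisible D" and DX: "D \<subseteq> X"
  shows "\<exists>C. p_divisible C \<and> C \<inter> D = {\<zero>\<^bsub>M\<^esub>} \<and> X = C <+>\<^bsub>M\<^esub> D"
proof -
  have Xs: "submodule X R M" and Ds: "submodule D R M" using X D by (auto simp: p_divisible_def)
  note Xc = submodule_carrier[OF Xs] and Dc = submodule_carrier[OF Ds]
  define F where "F = {C. submodule C R M \<and> C \<subseteq> X \<and> C \<inter> D = {\<zero>\<^bsub>M\<^esub>}}"
  have zs: "submodule {\<zero>\<^bsub>M\<^esub>} R M" by (rule submoduleI) auto
  have "\<exists>C\<in>F. \<forall>C'\<in>F. C \<subseteq> C' \<longrightarrow> C' = C"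
  proof (rule subset_Zorn_nonempty)
    show "F \<noteq> {}" using zs submodule_zero[OF Xs] submodule_zero[OF Ds] by (auto simp: F_def)
    fix K assume K: "K \<noteq> {}" "subset.chain F K"
    have KF: "C \<in> F" if "C \<in> K" for C using K(2) that by (auto simp: subset_chain_def)
    note Ks = KF[unfolded F_def, simplified]
    have two: "\<exists>C\<in>K. a \<in> C \<and> b \<in> C" if "a \<in> \<Union>K" "b \<in> \<Union>K" for a b
      using K(2) that unfolding subset_chain_def by blast
    obtain C0 where C0: "C0 \<in> K" using K(1) by blast
    have "submodule (\<Union>K) R M"
    proof (rule submoduleI)
      show "\<Union>K \<subseteq> carrier M" using Ks submoduleE(1) by blast
      show "\<zero>\<^bsub>M\<^esub> \<in> \<Union>K" using C0 Ks submodule_zero by blast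
      show "\<ominus>\<^bsub>M\<^esub> a \<in> \<Union>K" if "a \<in> \<Union>K" for a using Ks submoduleE(3) that by blast
      show "r \<odot>\<^bsub>M\<^esub> a \<in> \<Union>K" if "r \<in> carrier R" "a \<in> \<Union>K" for r a
        using Ks submoduleE(4) that by blast
      show "a \<oplus>\<^bsub>M\<^esub> b \<in> \<Union>K" if ab: "a \<in> \<Union>K" "b \<in> \<Union>K" for a b
        using two[OF ab] Ks submoduleE(5) by blast
    qed
    moreover have "\<Union>K \<inter> D = {\<zero>\<^bsub>M\<^esub>}" using Ks C0 by blast
    ultimately show "\<Union>K \<in> F" using Ks by (auto simp: F_def)
  qed
  then obtain C where C: "C \<in> F" and max: "\<And>C'. C' \<in> F \<Longrightarrow> C \<subseteq> C' \<Longrightarrow> C' = C" by blast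
  have Cs: "submodule C R M" and CX: "C \<subseteq> X" and CD: "C \<inter> D = {\<zero>\<^bsub>M\<^esub>}" using C by (auto simp: F_def)
  note Cc = submodule_carrier[OF Cs]
  note S = submodule_set_add[OF Cs Ds]
  let ?S = "C <+>\<^bsub>M\<^esub> D"
  have SX: "?S \<subseteq> X" using set_add_least[OF Xs CX DX] .
  (* By maximality of C the submodule C + R z meets D outside zero. *)
  have meet: "\<exists>r\<in>carrier R. r \<odot>\<^bsub>M\<^esub> z \<in> ?S \<and> r \<odot>\<^bsub>M\<^esub> z \<notin> C"
    if z: "z \<in> X" and zS: "z \<notin> ?S" for z
  proof -
    note Z = submodule_cyclic[OF Xc[OF z]]
    note CZ = submodule_set_add[OF Cs Z(1)]
    let ?C = "C <+>\<^bsub>M\<^esub> cyclic z"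
    have "?C \<noteq> C" using zS S(2) CZ(3) Z(2) by blast
    then have "?C \<notin> F" using max CZ(2) by blast
    moreover have "?C \<subseteq> X" by (rule set_add_least[OF Xs CX cyclic_least[OF Xs z]])
    moreover have "\<zero>\<^bsub>M\<^esub> \<in> ?C \<inter> D" using submodule_zero[OF CZ(1)] submodule_zero[OF Ds] by blast
    ultimately obtain d where d: "d \<in> ?C" "d \<in> D" "d \<noteq> \<zero>\<^bsub>M\<^esub>" using CZ(1) unfolding F_def by blast
    then obtain c r where c: "c \<in> C" and r: "r \<in> carrier R" and eq: "d = c \<oplus>\<^bsub>M\<^esub> r \<odot>\<^bsub>M\<^esub> z"
      by (auto simp: mem_set_add cyclic_def)
    have rz: "r \<odot>\<^bsub>M\<^esub> z = d \<ominus>\<^bsub>M\<^esub> c" using eq_diff[OF eq] Cc[OF c] r Xc[OF z] by simp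
    have "r \<odot>\<^bsub>M\<^esub> z \<in> ?S" unfolding rz using submodule_minus[OF S(1)] S(2,3) c d(2) by blast
    moreover have "r \<odot>\<^bsub>M\<^esub> z \<notin> C"
    proof
      assume "r \<odot>\<^bsub>M\<^esub> z \<in> C"
      then have "d \<in> C" using eq c submoduleE(5)[OF Cs] by simp
      then show False using d CD by blast
    qed
    ultimately show ?thesis using r by blast
  qed
  have step: "z \<in> ?S" if z: "z \<in> X" and pz: "p \<odot>\<^bsub>M\<^esub> z \<in> C" for z
  proof (rule ccontr)
    assume zS: "z \<notin> ?S"
    obtain r where r: "r \<in> carrier R" "r \<odot>\<^bsub>M\<^esub> z \<in> ?S" "r \<odot>\<^bsub>M\<^esub> z \<notin> C" using meet[OF z zS] by blast
    from r(1) show False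
    proof (cases rule: unit_or_multiple)
      case 1
      then show False using unit_cancel[OF S(1) 1 Xc[OF z] r(2)] zS by blast
    next
      case (2 s)
      then have "r \<odot>\<^bsub>M\<^esub> z = s \<odot>\<^bsub>M\<^esub> (p \<odot>\<^bsub>M\<^esub> z)" using Xc[OF z] by (simp add: smult_assoc1 smult_comm)
      then show False using submoduleE(4)[OF Cs 2(1) pz] r(3) by simp
    qed
  qed
  have step': "z \<in> ?S" if z: "z \<in> X" and pz: "p \<odot>\<^bsub>M\<^esub> z \<in> ?S" for z
  proof -
    obtain c d where cd: "c \<in> C" "d \<in> D" "p \<odot>\<^bsub>M\<^esub> z = c \<oplus>\<^bsub>M\<^esub> d" using pz by (auto simp: mem_set_add)
    obtain e where e: "e \<in> D" "d = p \<odot>\<^bsub>M\<^esub> e" using D cd(2) by (auto simp: p_divisible_def)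
    have "p \<odot>\<^bsub>M\<^esub> z \<ominus>\<^bsub>M\<^esub> d = c"
      using eq_diff[of "p \<odot>\<^bsub>M\<^esub> z" d c] cd Cc[OF cd(1)] Dc[OF cd(2)] by (simp add: M.a_comm)
    then have "p \<odot>\<^bsub>M\<^esub> (z \<ominus>\<^bsub>M\<^esub> e) = c" using e(2) Xc[OF z] Dc[OF e(1)] by (simp add: smult_minus)
    then have "z \<ominus>\<^bsub>M\<^esub> e \<in> ?S"
      using step[of "z \<ominus>\<^bsub>M\<^esub> e"] cd(1) submodule_minus[OF Xs z] e(1) DX by auto
    moreover have "z = e \<oplus>\<^bsub>M\<^esub> (z \<ominus>\<^bsub>M\<^esub> e)" using diff_eq[OF refl Xc[OF z] Dc[OF e(1)]] .
    ultimately show ?thesis using submoduleE(5)[OF S(1)] S(3) e(1) by (metis subsetD)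
  qed
  have step'': "z \<in> ?S" if z: "z \<in> X" and pz: "p [^] k \<odot>\<^bsub>M\<^esub> z \<in> ?S" for z and k :: nat
    using z pz
  proof (induction k arbitrary: z)
    case 0
    then show ?case using Xc by simp
  next
    case (Suc k)
    have "p [^] k \<odot>\<^bsub>M\<^esub> (p \<odot>\<^bsub>M\<^esub> z) \<in> ?S" using Suc.prems pow_Suc_smult(1)[OF Xc] by metis
    then have "p \<odot>\<^bsub>M\<^esub> z \<in> ?S" using Suc.IH submoduleE(4)[OF Xs] Suc.prems(1) by blast
    then show ?case using step' Suc.prems(1) by blast
  qed
  have "X \<subseteq> ?S"
  proof (rule ccontr)
    assume "\<not> X \<subseteq> ?S"
    then obtain z where z: "z \<in> X" "z \<notin> ?S" by blast
    obtain r where r: "r \<in> carrier R" and rzS: "r \<odot>\<^bsub>M\<^esub> z \<in> ?S" and rzC: "r \<odot>\<^bsub>M\<^esub> z \<notin> C"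
      using meet[OF z] by blast
    have "r \<noteq> \<zero>" using rzC submodule_zero[OF Cs] Xc[OF z(1)] by auto
    then obtain k u where u: "u \<in> Units R" "r = p [^] (k::nat) \<otimes> u" using factor r by blast
    then have "r \<odot>\<^bsub>M\<^esub> z = u \<odot>\<^bsub>M\<^esub> (p [^] k \<odot>\<^bsub>M\<^esub> z)"
      using Xc[OF z(1)] by (simp add: smult_assoc1 smult_comm Units_closed)
    then have "p [^] k \<odot>\<^bsub>M\<^esub> z \<in> ?S" using rzS unit_cancel[OF S(1) u(1)] Xc[OF z(1)] by auto
    then show False using step'' z by blast
  qed
  with SX have XS: "X = ?S" by blast
  have "\<exists>y\<in>C. c = p \<odot>\<^bsub>M\<^esub> y" if c: "c \<in> C" for c
  proof -
    obtain x where x: "x \<in> X" "c = p \<odot>\<^bsub>M\<^esub> x" using X CX c unfolding p_divisible_def by blast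
    then obtain y d where yd: "y \<in> C" "d \<in> D" "x = y \<oplus>\<^bsub>M\<^esub> d" using XS by (auto simp: mem_set_add)
    note cc = Cc[OF yd(1)] Dc[OF yd(2)]
    have "p \<odot>\<^bsub>M\<^esub> d = c \<ominus>\<^bsub>M\<^esub> p \<odot>\<^bsub>M\<^esub> y"
      using eq_diff[of c "p \<odot>\<^bsub>M\<^esub> y" "p \<odot>\<^bsub>M\<^esub> d"] x(2) yd(3) cc by (simp add: smult_r_distr)
    then have "p \<odot>\<^bsub>M\<^esub> d \<in> C \<inter> D"
      using submodule_minus[OF Cs c] submoduleE(4)[OF Cs p_closed yd(1)] submoduleE(4)[OF Ds p_closed yd(2)] by simp
    then have "p \<odot>\<^bsub>M\<^esub> d = \<zero>\<^bsub>M\<^esub>" using CD by blast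
    then have "c = p \<odot>\<^bsub>M\<^esub> y" using x(2) yd(3) cc by (simp add: smult_r_distr)
    then show ?thesis using yd(1) by blast
  qed
  then have "p_divisible C" using Cs by (simp add: p_divisible_def)
  then show ?thesis using CD XS by blast
qed

section \<open>Independence modulo the uniformizer\<close>

definition span_mod_p :: "'c set \<Rightarrow> 'c set" where
  "span_mod_p X = module_span R M (multiples p \<union> X)"

lemma span_mod_p:
  assumes "X \<subseteq> carrier M"
  shows submodule_span_mod_p: "submodule (span_mod_p X) R M"
    and multiples_span_mod_p: "multiples p \<subseteq> span_mod_p X"
    and subset_span_mod_p: "X \<subseteq> span_mod_p X"
    and span_mod_p_least:
      "\<And>N. submodule N R M \<Longrightarrow> multiples p \<subseteq> N \<Longrightarrow> X \<subseteq> N \<Longrightarrow> span_mod_p X \<subseteq> N"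
proof -
  have "multiples p \<union> X \<subseteq> carrier M"
    using assms submoduleE(1)[OF submodule_multiples[OF p_closed]] by blast
  note sp = submodule_span[OF this, folded span_mod_p_def]
  show "submodule (span_mod_p X) R M" "multiples p \<subseteq> span_mod_p X" "X \<subseteq> span_mod_p X"
    using sp by auto
  show "span_mod_p X \<subseteq> N" if "submodule N R M" "multiples p \<subseteq> N" "X \<subseteq> N" for N
    using sp(3) that by blast
qed

lemma span_mod_p_mono: "X \<subseteq> Y \<Longrightarrow> Y \<subseteq> carrier M \<Longrightarrow> span_mod_p X \<subseteq> span_mod_p Y"
  using span_mod_p[of Y] span_mod_p_least[of X] by (meson order_trans)

text \<open>
  The Steinitz exchange property of the vector space \<open>M/pM\<close>: a coefficient is either a unit or
  divisible by \<open>p\<close>, and in the second case the term vanishes modulo \<open>p\<close>.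
\<close>

lemma span_mod_p_exchange:
  assumes X: "X \<subseteq> carrier M" and x: "x \<in> carrier M"
    and z: "z \<in> span_mod_p (insert x X)" "z \<notin> span_mod_p X"
  shows "x \<in> span_mod_p (insert z X)"
proof -
  note sX = span_mod_p[OF X]
  have xX: "insert x X \<subseteq> carrier M" using x X by blast
  have zc: "z \<in> carrier M" using submodule_carrier[OF span_mod_p(1)[OF xX] z(1)] .
  then have zX: "insert z X \<subseteq> carrier M" using X by blast
  note sz = span_mod_p[OF zX]
  note S = submodule_set_add[OF sX(1) submodule_cyclic(1)[OF x]]
  have "span_mod_p (insert x X) \<subseteq> span_mod_p X <+>\<^bsub>M\<^esub> cyclic x"
    using S sX submodule_cyclic(2)[OF x] by (intro span_mod_p_least[OF xX]) auto
  then have "z \<in> span_mod_p X <+>\<^bsub>M\<^esub> cyclic x" using z(1) by blast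
  then obtain n r where n: "n \<in> span_mod_p X" and r: "r \<in> carrier R" and eq: "z = n \<oplus>\<^bsub>M\<^esub> r \<odot>\<^bsub>M\<^esub> x"
    by (auto simp: mem_set_add cyclic_def)
  have nz: "n \<in> span_mod_p (insert z X)" using n span_mod_p_mono[of X "insert z X"] zX by blast
  have rx: "r \<odot>\<^bsub>M\<^esub> x = z \<ominus>\<^bsub>M\<^esub> n" using eq_diff[OF eq] r x submodule_carrier[OF sX(1) n] by simp
  from r show ?thesis
  proof (cases rule: unit_or_multiple)
    case 1
    have "r \<odot>\<^bsub>M\<^esub> x \<in> span_mod_p (insert z X)" unfolding rx using submodule_minus[OF sz(1)] nz sz(3) by blast
    then show ?thesis using unit_cancel[OF sz(1) 1 x] by blast
  next
    case (2 s)
    then have "r \<odot>\<^bsub>M\<^esub> x \<in> multiples p" using x by (auto simp: multiples_def smult_assoc1)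
    then have "z \<in> span_mod_p X" using eq n sX(2) submoduleE(5)[OF sX(1)] by blast
    then show ?thesis using z(2) by blast
  qed
qed

lemma span_mod_p_empty: "span_mod_p {} = multiples p"
  using span_mod_p_least[of "{}", OF _ submodule_multiples[OF p_closed]] multiples_span_mod_p[of "{}"]
  by auto

lemma span_mod_p_finitary:
  fixes x :: "nat \<Rightarrow> 'c"
  assumes x: "\<And>i. x i \<in> carrier M" and z: "z \<in> span_mod_p (x ` I)"
  shows "\<exists>n. z \<in> span_mod_p (x ` (I \<inter> {..<n}))"
proof -
  let ?s = "\<lambda>n. span_mod_p (x ` (I \<inter> {..<n}))"
  have c: "x ` J \<subseteq> carrier M" for J using x by blast
  note s = span_mod_p[OF c]
  have mono: "?s n \<subseteq> ?s m" if "n \<le> m" for n m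
    by (rule span_mod_p_mono) (use c that in auto)
  have "submodule (\<Union>n. ?s n) R M"
  proof (rule submoduleI)
    show "(\<Union>n. ?s n) \<subseteq> carrier M" using submoduleE(1)[OF s(1)] by blast
    show "\<zero>\<^bsub>M\<^esub> \<in> (\<Union>n. ?s n)" using submodule_zero[OF s(1)] by blast
    show "\<ominus>\<^bsub>M\<^esub> a \<in> (\<Union>n. ?s n)" if "a \<in> (\<Union>n. ?s n)" for a using submoduleE(3)[OF s(1)] that by blast
    show "r \<odot>\<^bsub>M\<^esub> a \<in> (\<Union>n. ?s n)" if "r \<in> carrier R" "a \<in> (\<Union>n. ?s n)" for r a
      using submoduleE(4)[OF s(1)] that by blast
    show "a \<oplus>\<^bsub>M\<^esub> b \<in> (\<Union>n. ?s n)" if ab: "a \<in> (\<Union>n. ?s n)" "b \<in> (\<Union>n. ?s n)" for a b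
    proof -
      obtain n m where "a \<in> ?s n" "b \<in> ?s m" using ab by blast
      then have "a \<in> ?s (max n m)" "b \<in> ?s (max n m)"
        using mono[of n "max n m"] mono[of m "max n m"] by auto
      then have "a \<oplus>\<^bsub>M\<^esub> b \<in> ?s (max n m)" by (rule submoduleE(5)[OF s(1)])
      then show ?thesis by blast
    qed
  qed
  moreover have "multiples p \<subseteq> (\<Union>n. ?s n)" using s(2) by blast
  moreover have "x ` I \<subseteq> (\<Union>n. ?s n)"
  proof
    fix y assume "y \<in> x ` I"
    then obtain i where "i \<in> I" "y = x i" by blast
    then have "y \<in> x ` (I \<inter> {..<Suc i})" by blast
    then have "y \<in> ?s (Suc i)" by (rule subsetD[OF s(3)])
    then show "y \<in> (\<Union>n. ?s n)" by blast
  qed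
  ultimately have "span_mod_p (x ` I) \<subseteq> (\<Union>n. ?s n)" by (rule span_mod_p_least[OF c])
  then show ?thesis using z by auto
qed

definition independent_sequence :: "(nat \<Rightarrow> 'c) \<Rightarrow> bool" where
  "independent_sequence x \<longleftrightarrow> (\<forall>n. x n \<in> carrier M \<and> x n \<notin> span_mod_p (x ` {..<n}))"

lemma independent_sequence_notin_span_others:
  assumes "independent_sequence x"
  shows "x i \<notin> span_mod_p (x ` (- {i}))"
proof
  have x: "\<And>i. x i \<in> carrier M" and ind: "\<And>n. x n \<notin> span_mod_p (x ` {..<n})"
    using assms by (auto simp: independent_sequence_def)
  have c: "x ` J \<subseteq> carrier M" for J using x by blast
  have *: "x i \<notin> span_mod_p (x ` (- {i} \<inter> {..<n}))" for n
  proof (induction n)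
    case 0
    have "span_mod_p (x ` (- {i} \<inter> {..<0})) \<subseteq> span_mod_p (x ` {..<i})"
      by (rule span_mod_p_mono) (use c in auto)
    then show ?case using ind by blast
  next
    case (Suc m)
    show ?case
    proof (cases "m \<le> i")
      case True
      have "span_mod_p (x ` (- {i} \<inter> {..<Suc m})) \<subseteq> span_mod_p (x ` {..<i})"
        by (rule span_mod_p_mono) (use c True in auto)
      then show ?thesis using ind by blast
    next
      case False
      let ?X = "x ` (- {i} \<inter> {..<m})"
      have eq: "x ` (- {i} \<inter> {..<Suc m}) = insert (x m) ?X" using False by (auto simp: less_Suc_eq)
      have "x i \<notin> span_mod_p (insert (x m) ?X)"
      proof
        assume "x i \<in> span_mod_p (insert (x m) ?X)"
        then have "x m \<in> span_mod_p (insert (x i) ?X)" by (rule span_mod_p_exchange[OF c x _ Suc.IH])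
        moreover have "span_mod_p (insert (x i) ?X) \<subseteq> span_mod_p (x ` {..<m})"
          by (rule span_mod_p_mono) (use c False in auto)
        ultimately show False using ind by blast
      qed
      then show ?thesis by (simp add: eq)
    qed
  qed
  assume "x i \<in> span_mod_p (x ` (- {i}))"
  then show False using span_mod_p_finitary[of x, OF x] * by blast
qed

text \<open>
  The spans of the tails of an independent sequence intersect in zero, because the span of an initial
  segment meets the span of the remaining terms trivially.
\<close>

lemma independent_sequence_tails:
  assumes ind: "independent_sequence x" and z: "\<And>n. z \<in> span_mod_p (x ` {n..})"
  shows "z \<in> multiples p"
proof -
  have x: "\<And>i. x i \<in> carrier M" using ind by (auto simp: independent_sequence_def)
  have c: "x ` J \<subseteq> carrier M" for J using x by blast
  have "z \<in> span_mod_p (x ` {..<n}) \<Longrightarrow> z \<in> multiples p" for n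
  proof (induction n)
    case 0
    then show ?case by (simp add: span_mod_p_empty)
  next
    case (Suc n)
    have "z \<in> span_mod_p (x ` {..<n})"
    proof (rule ccontr)
      assume nz: "z \<notin> span_mod_p (x ` {..<n})"
      have "z \<in> span_mod_p (insert (x n) (x ` {..<n}))" using Suc.prems by (simp add: lessThan_Suc)
      then have xn: "x n \<in> span_mod_p (insert z (x ` {..<n}))" by (rule span_mod_p_exchange[OF c x _ nz])
      let ?T = "span_mod_p (x ` (- {n}))"
      have "span_mod_p (x ` {Suc n..}) \<subseteq> ?T" by (rule span_mod_p_mono) (use c in auto)
      then have "z \<in> ?T" using z by blast
      moreover have "x ` {..<n} \<subseteq> ?T" using subset_span_mod_p[OF c[of "- {n}"]] by auto
      ultimately have "span_mod_p (insert z (x ` {..<n})) \<subseteq> ?T"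
        using span_mod_p[OF c[of "- {n}"]] submodule_carrier[of ?T z] c
        by (intro span_mod_p_least) auto
      then show False using xn independent_sequence_notin_span_others[OF ind] by blast
    qed
    then show ?case by (rule Suc.IH)
  qed
  moreover have "z \<in> span_mod_p (x ` {0..})" using z .
  then obtain n where "z \<in> span_mod_p (x ` ({0..} \<inter> {..<n}))" using span_mod_p_finitary[of x, OF x] by blast
  moreover have "{0..} \<inter> {..<n} = {..<n}" by auto
  ultimately show ?thesis by metis
qed

text \<open>
  The sequence \<open>x\<^sub>0, x\<^sub>1 - x\<^sub>0, x\<^sub>2 - x\<^sub>1, \<dots>\<close> is again independent, as its initial segments lie in the spans
  of those of \<open>x\<close>. This yields a functional with the same nonzero value at all \<open>x\<^sub>i\<close>.
\<close>

lemma independent_sequence_differences: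
  assumes ind: "independent_sequence x"
  shows "x 0 \<notin> span_mod_p (range (\<lambda>i. x (Suc i) \<ominus>\<^bsub>M\<^esub> x i))"
proof -
  have x: "\<And>i. x i \<in> carrier M" and ind': "\<And>n. x n \<notin> span_mod_p (x ` {..<n})"
    using ind by (auto simp: independent_sequence_def)
  have c: "x ` J \<subseteq> carrier M" for J using x by blast
  note s = span_mod_p[OF c]
  define y where "y n = (case n of 0 \<Rightarrow> x 0 | Suc i \<Rightarrow> x (Suc i) \<ominus>\<^bsub>M\<^esub> x i)" for n
  have yc: "y n \<in> carrier M" for n using x by (auto simp: y_def split: nat.split)
  have x_in: "x j \<in> span_mod_p (x ` {..<n})" if "j < n" for j n
    using s(3)[of "{..<n}"] that by auto
  have y_in: "y j \<in> span_mod_p (x ` {..<n})" if "j < n" for j n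
    using that submodule_minus[OF s(1) x_in x_in] x_in by (auto simp: y_def split: nat.split)
  have "independent_sequence y"
    unfolding independent_sequence_def
  proof (intro allI conjI yc notI)
    fix n assume yn: "y n \<in> span_mod_p (y ` {..<n})"
    have "span_mod_p (y ` {..<n}) \<subseteq> span_mod_p (x ` {..<n})"
      using y_in yc by (intro span_mod_p_least s) auto
    then have yx: "y n \<in> span_mod_p (x ` {..<n})" using yn by blast
    have "x n \<in> span_mod_p (x ` {..<n})"
    proof (cases n)
      case 0
      then show ?thesis using yx by (simp add: y_def)
    next
      case (Suc i)
      have "x (Suc i) = x i \<oplus>\<^bsub>M\<^esub> y n" using diff_eq[of "x (Suc i)" "x i" "y n"] x Suc by (simp add: y_def)
      moreover have "x i \<in> span_mod_p (x ` {..<n})" using x_in Suc by simp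
      ultimately show ?thesis using submoduleE(5)[OF s(1) _ yx, of "x i"] Suc by simp
    qed
    then show False using ind' by blast
  qed
  then have "y 0 \<notin> span_mod_p (y ` (- {0}))" by (rule independent_sequence_notin_span_others)
  moreover have "y ` (- {0}) = range (\<lambda>i. x (Suc i) \<ominus>\<^bsub>M\<^esub> x i)"
  proof -
    have "- {0} = range Suc" by (auto simp: image_iff) (metis not0_implies_Suc)
    then show ?thesis by (simp add: image_image y_def)
  qed
  ultimately show ?thesis by (simp add: y_def)
qed

lemma finite_span_mod_p:
  assumes "\<nexists>x. independent_sequence x"
  shows "\<exists>F. finite F \<and> F \<subseteq> carrier M \<and> span_mod_p F = carrier M"
proof (rule ccontr)
  assume neg: "\<not> ?thesis"
  let ?P = "\<lambda>f n r. r \<in> carrier M \<and> r \<notin> span_mod_p (f ` {..<n})"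
  have "\<exists>x. \<forall>n. ?P x n (x (n::nat))"
  proof (rule dependent_wellorder_choice)
    fix r and f g :: "nat \<Rightarrow> 'c" and n assume "\<And>i. i < n \<Longrightarrow> f i = g i"
    then have "f ` {..<n} = g ` {..<n}" by auto
    then show "?P f n r = ?P g n r" by simp
  next
    fix n and f :: "nat \<Rightarrow> 'c" assume f: "\<And>i. i < n \<Longrightarrow> ?P f i (f i)"
    then have sub: "f ` {..<n} \<subseteq> carrier M" by auto
    then have "span_mod_p (f ` {..<n}) \<noteq> carrier M" using neg by (metis finite_imageI finite_lessThan)
    then show "\<exists>r. ?P f n r" using submoduleE(1)[OF span_mod_p(1)[OF sub]] by blast
  qed
  then show False using assms by (auto simp: independent_sequence_def)
qed

lemma chain_stabilises:
  fixes N :: "nat \<Rightarrow> 'c set"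
  assumes none: "\<nexists>x. independent_sequence x"
    and N: "\<And>n. submodule (N n) R M" "\<And>n. multiples p \<subseteq> N n" "\<And>n. N n \<subseteq> N (Suc n)"
  shows "\<exists>n0. \<forall>n\<ge>n0. N (Suc n) \<subseteq> N n"
proof (rule ccontr)
  assume neg: "\<not> ?thesis"
  define J where "J = {n. \<not> N (Suc n) \<subseteq> N n}"
  (* J collects the strict steps of the chain; an element new at each of them gives an independent sequence. *)
  have "infinite J" using neg by (auto simp: J_def infinite_nat_iff_unbounded_le)
  then have g: "strict_mono (enumerate J)" "\<And>k. enumerate J k \<in> J"
    by (simp_all add: strict_mono_enumerate enumerate_in_set)
  let ?g = "enumerate J"
  have "\<forall>k. \<exists>z. z \<in> N (Suc (?g k)) \<and> z \<notin> N (?g k)" using g(2) by (auto simp: J_def)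
  then obtain x where x: "\<And>k. x k \<in> N (Suc (?g k))" "\<And>k. x k \<notin> N (?g k)" by metis
  have xc: "x k \<in> carrier M" for k using submodule_carrier[OF N(1) x(1)] .
  have "x n \<notin> span_mod_p (x ` {..<n})" for n
  proof -
    have "x j \<in> N (?g n)" if "j < n" for j
    proof -
      have "Suc (?g j) \<le> ?g n" using g(1) that by (simp add: strict_mono_less Suc_leI)
      then have "N (Suc (?g j)) \<subseteq> N (?g n)" using lift_Suc_mono_le[of N] N(3) by blast
      then show ?thesis using x(1) by blast
    qed
    then have "span_mod_p (x ` {..<n}) \<subseteq> N (?g n)" using N xc by (intro span_mod_p_least) auto
    then show ?thesis using x(2) by blast
  qed
  then show False using none xc by (auto simp: independent_sequence_def)
qed

section \<open>Elements of infinite height\<close>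

definition infinite_height :: "'c set" where
  "infinite_height = (\<Inter>n. multiples (p [^] (n::nat)))"

lemma submodule_infinite_height: "submodule infinite_height R M"
  unfolding infinite_height_def by (rule submodule_Inter) (auto intro: submodule_multiples)

lemma submodule_annihilated_by:
  assumes r: "r \<in> carrier R"
  shows "submodule {x \<in> carrier M. r \<odot>\<^bsub>M\<^esub> x = \<zero>\<^bsub>M\<^esub>} R M"
  by (rule submoduleI) (use r in \<open>auto simp: smult_r_minus smult_r_distr smult_comm[of r]\<close>)

text \<open>
  The submodules \<open>M[p\<^sup>n] + p M\<close> increase with \<open>n\<close>, so they are constant from some \<open>n0\<close> on when \<open>M/pM\<close> is
  finite-dimensional. An element \<open>p\<^sup>n w\<close> of \<open>M[p]\<close> with \<open>n \<ge> n0\<close> has \<open>w \<in> M[p\<^bsup>n+1\<^esup>]\<close>, hence \<open>w = s + p v\<close> with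
  \<open>p\<^sup>n s = 0\<close>, and equals \<open>p\<^bsup>n+1\<^esup> v\<close>; so elements of \<open>M[p]\<close> of height at least \<open>n0\<close> have infinite
  height. Two solutions \<open>z\<close> of \<open>p z = y\<close> of height at least \<open>n0\<close> differ by such an element. If \<open>y\<close> has
  infinite height, then for every \<open>n\<close> some solution lies in \<open>p\<^sup>n M\<close>, so every solution of height at
  least \<open>n0\<close> lies in all \<open>p\<^sup>n M\<close>.
\<close>

theorem p_divisible_infinite_height:
  assumes none: "\<nexists>x. independent_sequence x"
  shows "p_divisible infinite_height"
proof -
  note mp = submodule_multiples[OF nat_pow_closed[OF p_closed]]
  define t where "t n = {x \<in> carrier M. p [^] n \<odot>\<^bsub>M\<^esub> x = \<zero>\<^bsub>M\<^esub>}" for n :: nat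
  have t: "submodule (t n) R M" for n
    unfolding t_def by (rule submodule_annihilated_by) simp
  note S = submodule_set_add[OF t submodule_multiples[OF p_closed]]
  have tSuc: "t n \<subseteq> t (Suc n)" for n
    unfolding t_def using pow_Suc_smult(2) by auto
  have "\<exists>n0. \<forall>n\<ge>n0. t (Suc n) <+>\<^bsub>M\<^esub> multiples p \<subseteq> t n <+>\<^bsub>M\<^esub> multiples p"
  proof (rule chain_stabilises[OF none])
    show "t n <+>\<^bsub>M\<^esub> multiples p \<subseteq> t (Suc n) <+>\<^bsub>M\<^esub> multiples p" for n
      by (rule set_add_least[OF S(1) order_trans[OF tSuc S(2)] S(3)])
  qed (rule S)+
  then obtain n0 where n0: "\<And>n. n \<ge> n0 \<Longrightarrow> t (Suc n) <+>\<^bsub>M\<^esub> multiples p \<subseteq> t n <+>\<^bsub>M\<^esub> multiples p"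
    by blast
  have step: "x \<in> multiples (p [^] Suc n)"
    if n: "n \<ge> n0" and x: "x \<in> multiples (p [^] n)" "p \<odot>\<^bsub>M\<^esub> x = \<zero>\<^bsub>M\<^esub>" for x n
  proof -
    obtain w where w: "w \<in> carrier M" "x = p [^] n \<odot>\<^bsub>M\<^esub> w" using x(1) by (auto simp: multiples_def)
    have "p [^] Suc n \<odot>\<^bsub>M\<^esub> w = \<zero>\<^bsub>M\<^esub>" using x(2) w pow_Suc_smult(2) by simp
    then have "w \<in> t (Suc n)" using w(1) unfolding t_def by blast
    then have "w \<in> t n <+>\<^bsub>M\<^esub> multiples p" using n0[OF n] S(2)[of "Suc n"] by blast
    then obtain s v where sv: "s \<in> carrier M" "p [^] n \<odot>\<^bsub>M\<^esub> s = \<zero>\<^bsub>M\<^esub>" "v \<in> carrier M"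
        "w = s \<oplus>\<^bsub>M\<^esub> p \<odot>\<^bsub>M\<^esub> v"
      by (auto simp: mem_set_add multiples_def t_def)
    then have "x = p [^] Suc n \<odot>\<^bsub>M\<^esub> v"
      using w(2) pow_Suc_smult(1)[OF sv(3)] by (simp add: smult_r_distr)
    then show ?thesis using sv(3) by (auto simp: multiples_def)
  qed
  have multiples_mono: "multiples (p [^] m) \<subseteq> multiples (p [^] n)" if "n \<le> m" for m n :: nat
  proof
    fix x assume "x \<in> multiples (p [^] m)"
    then obtain w where "w \<in> carrier M" "x = p [^] m \<odot>\<^bsub>M\<^esub> w" by (auto simp: multiples_def)
    then show "x \<in> multiples (p [^] n)"
      using pow_add_smult[of w n "m - n"] that by (auto simp: multiples_def)
  qed
  have socle: "x \<in> infinite_height" if x: "x \<in> multiples (p [^] n0)" "p \<odot>\<^bsub>M\<^esub> x = \<zero>\<^bsub>M\<^esub>" for x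
  proof -
    have "x \<in> multiples (p [^] (n0 + k))" for k
      by (induction k) (use x step in \<open>simp_all del: nat_pow_Suc\<close>)
    then have "x \<in> multiples (p [^] n)" for n :: nat using multiples_mono[of n "n0 + n"] by auto
    then show ?thesis by (auto simp: infinite_height_def)
  qed
  have "\<exists>z\<in>infinite_height. y = p \<odot>\<^bsub>M\<^esub> z" if y: "y \<in> infinite_height" for y
  proof -
    have rep: "\<exists>w\<in>carrier M. y = p \<odot>\<^bsub>M\<^esub> (p [^] k \<odot>\<^bsub>M\<^esub> w)" for k :: nat
    proof -
      have "y \<in> multiples (p [^] Suc k)" using y unfolding infinite_height_def by blast
      then show ?thesis using pow_Suc_smult(2)[of _ k] by (auto simp: multiples_def simp del: nat_pow_Suc)
    qed
    obtain w where w: "w \<in> carrier M" "y = p \<odot>\<^bsub>M\<^esub> (p [^] n0 \<odot>\<^bsub>M\<^esub> w)" using rep by blast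
    define z where "z = p [^] n0 \<odot>\<^bsub>M\<^esub> w"
    have z: "z \<in> carrier M" "z \<in> multiples (p [^] n0)" using w by (auto simp: z_def multiples_def)
    have "z \<in> multiples (p [^] n)" for n :: nat
    proof -
      obtain v where v: "v \<in> carrier M" "y = p \<odot>\<^bsub>M\<^esub> (p [^] (n0 + n) \<odot>\<^bsub>M\<^esub> v)" using rep by blast
      define u where "u = p [^] (n0 + n) \<odot>\<^bsub>M\<^esub> v"
      have u: "u \<in> carrier M" "u \<in> multiples (p [^] (n0 + n))" using v by (auto simp: u_def multiples_def)
      have "p \<odot>\<^bsub>M\<^esub> (z \<ominus>\<^bsub>M\<^esub> u) = \<zero>\<^bsub>M\<^esub>"
        using z(1) u(1) w(2) v(2) by (simp add: smult_minus z_def[symmetric] u_def[symmetric])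
          (simp add: M.minus_eq M.r_neg)
      moreover have "z \<ominus>\<^bsub>M\<^esub> u \<in> multiples (p [^] n0)"
        using z(2) u(2) multiples_mono[of n0 "n0 + n"] submodule_minus[OF mp] by auto
      ultimately have "z \<ominus>\<^bsub>M\<^esub> u \<in> multiples (p [^] n)" using socle by (auto simp: infinite_height_def)
      moreover have "u \<in> multiples (p [^] n)" using u(2) multiples_mono[of n "n0 + n"] by auto
      moreover have "z = u \<oplus>\<^bsub>M\<^esub> (z \<ominus>\<^bsub>M\<^esub> u)" using diff_eq[OF refl z(1) u(1)] .
      ultimately show ?thesis using submoduleE(5)[OF mp] by metis
    qed
    then have "z \<in> infinite_height" by (auto simp: infinite_height_def)
    then show ?thesis using w(2) by (auto simp: z_def)
  qed
  then show ?thesis using submodule_infinite_height by (auto simp: p_divisible_def)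
qed

end

section \<open>Matlis duality\<close>

lemma (in abelian_group) minus_eq_zero_iff:
  assumes "x \<in> carrier G" "y \<in> carrier G"
  shows "x \<ominus> y = \<zero> \<longleftrightarrow> x = y"
proof
  assume "x \<ominus> y = \<zero>"
  then have "(x \<ominus> y) \<oplus> y = y" using assms by simp
  then show "x = y" using assms by (simp add: minus_eq a_assoc l_neg)
qed (use assms in \<open>simp add: minus_eq r_neg\<close>)

lemma (in module) quot_module_proj:
  assumes N: "submodule N R M"
  shows "(\<lambda>x. N +>\<^bsub>M\<^esub> x) \<in> mod_hom R M (quot_module M N)"
    and "x \<in> carrier M \<Longrightarrow> N +>\<^bsub>M\<^esub> x = \<zero>\<^bsub>quot_module M N\<^esub> \<longleftrightarrow> x \<in> N"
proof -
  show "(\<lambda>x. N +>\<^bsub>M\<^esub> x) \<in> mod_hom R M (quot_module M N)"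
    by (auto simp: mod_hom_def quot_module_simps[OF N])
  assume x: "x \<in> carrier M"
  have asub: "additive_subgroup N M" using submodule.axioms(1)[OF N] by (rule additive_subgroup.intro)
  interpret N: abelian_subgroup N M by (rule abelian_subgroupI3[OF asub M.abelian_group_axioms])
  have "N +>\<^bsub>M\<^esub> x = N \<longleftrightarrow> x \<in> N"
    using N.a_rcos_self[OF x] N.a_rcos_const by auto
  then show "N +>\<^bsub>M\<^esub> x = \<zero>\<^bsub>quot_module M N\<^esub> \<longleftrightarrow> x \<in> N" by (simp add: quot_module_def)
qed

lemma mod_hom_comp:
  "f \<in> mod_hom R L M \<Longrightarrow> g \<in> mod_hom R M N \<Longrightarrow> (\<lambda>x. g (f x)) \<in> mod_hom R L N"
  by (auto simp: mod_hom_def Pi_def)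

text \<open>
  The element \<open>e\<close> spans a copy of the residue field, which makes the injective module \<open>E\<close> a cogenerator.
\<close>

locale matlis = dvr R p + E: module R E
  for R :: "('r, 'x) ring_scheme" (structure) and p and E :: "('r, 'e, 'z) module_scheme" +
  fixes e
  assumes injective: "injective_module TYPE('r) R E"
    and socle: "e \<in> carrier E" "e \<noteq> \<zero>\<^bsub>E\<^esub>" "p \<odot>\<^bsub>E\<^esub> e = \<zero>\<^bsub>E\<^esub>"
begin

text \<open>
  Injectivity is defined through modules of the plain record type, so a module of an extended record
  type has to be copied first.
\<close>

lemma extend_submodule:
  fixes M :: "('r, 'm, 'y) module_scheme"
  assumes "module R M" and N: "submodule N R M" and f: "f \<in> mod_hom R (M\<lparr>carrier := N\<rparr>) E"
  shows "\<exists>g\<in>mod_hom R M E. \<forall>x\<in>N. g x = f x"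
proof -
  interpret M: module R M by fact
  define M' :: "('r, 'm) module" where
    "M' = \<lparr>carrier = carrier M, mult = mult M, one = one M, zero = zero M, add = add M, smult = smult M\<rparr>"
  have simps [simp]: "carrier M' = carrier M" "zero M' = zero M" "add M' = add M" "smult M' = smult M"
    by (simp_all add: M'_def)
  have M': "module R M'"
  proof (rule moduleI)
    show "abelian_group M'"
    proof (rule abelian_groupI)
      fix x assume "x \<in> carrier M'"
      then show "\<exists>y\<in>carrier M'. y \<oplus>\<^bsub>M'\<^esub> x = \<zero>\<^bsub>M'\<^esub>"
        by (intro bexI[of _ "\<ominus>\<^bsub>M\<^esub> x"]) (auto simp: M.l_neg)
    qed (auto simp: M.a_ac)
  qed (auto simp: M.smult_l_distr M.smult_r_distr M.smult_assoc1 is_cring)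
  interpret M': module R M' by fact
  have N': "submodule N R M'"
  proof (rule M'.submoduleI)
    fix a assume a: "a \<in> N"
    then have ac: "a \<in> carrier M" using M.submoduleE(1)[OF N] by blast
    have "(\<ominus> \<one>) \<odot>\<^bsub>M\<^esub> a \<in> N" using M.submoduleE(4)[OF N _ a] by simp
    moreover have "(\<ominus> \<one>) \<odot>\<^bsub>M\<^esub> a = \<ominus>\<^bsub>M'\<^esub> a"
      using M'.smult_l_minus[of \<one> a] M'.smult_one[of a] ac by simp
    ultimately show "\<ominus>\<^bsub>M'\<^esub> a \<in> N" by simp
  qed (use M.submoduleE[OF N] N in \<open>auto simp: submodule_def dest!: subgroup.one_closed\<close>)
  have "f \<in> mod_hom R (M'\<lparr>carrier := N\<rparr>) E" using f by (simp add: mod_hom_def)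
  then have "\<exists>g\<in>mod_hom R M' E. \<forall>x\<in>N. g x = f x"
    using injective_module_any_type[OF injective, where 'n = 'm] M' N'
    unfolding injective_module_def by blast
  then show ?thesis by (simp add: mod_hom_def)
qed

end

locale matlis_module = matlis R p E e + dvr_module R p M
  for R :: "('r, 'x) ring_scheme" (structure) and p and E :: "('r, 'e, 'z) module_scheme" and e
    and M :: "('r, 'm, 'y) module_scheme" (structure)
begin

abbreviation dual where "dual \<equiv> Hom_module R M E"

lemma dual_apply:
  assumes "f \<in> carrier dual"
  shows dual_closed: "x \<in> carrier M \<Longrightarrow> f x \<in> carrier E"
    and dual_add: "x \<in> carrier M \<Longrightarrow> y \<in> carrier M \<Longrightarrow> f (x \<oplus>\<^bsub>M\<^esub> y) = f x \<oplus>\<^bsub>E\<^esub> f y"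
    and dual_smult: "r \<in> carrier R \<Longrightarrow> x \<in> carrier M \<Longrightarrow> f (r \<odot>\<^bsub>M\<^esub> x) = r \<odot>\<^bsub>E\<^esub> f x"
    and dual_zero: "f \<zero>\<^bsub>M\<^esub> = \<zero>\<^bsub>E\<^esub>"
proof -
  show c: "\<And>x. x \<in> carrier M \<Longrightarrow> f x \<in> carrier E"
    and "\<And>x y. x \<in> carrier M \<Longrightarrow> y \<in> carrier M \<Longrightarrow> f (x \<oplus>\<^bsub>M\<^esub> y) = f x \<oplus>\<^bsub>E\<^esub> f y"
    and s: "\<And>r x. r \<in> carrier R \<Longrightarrow> x \<in> carrier M \<Longrightarrow> f (r \<odot>\<^bsub>M\<^esub> x) = r \<odot>\<^bsub>E\<^esub> f x"
    using assms by (auto simp: Hom_module_def mod_hom_def)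
  show "f \<zero>\<^bsub>M\<^esub> = \<zero>\<^bsub>E\<^esub>" using s[of \<zero> "\<zero>\<^bsub>M\<^esub>"] c[of "\<zero>\<^bsub>M\<^esub>"] by simp
qed

lemma dual_minus:
  assumes "f \<in> carrier dual" "x \<in> carrier M" "y \<in> carrier M"
  shows "f (x \<ominus>\<^bsub>M\<^esub> y) = f x \<ominus>\<^bsub>E\<^esub> f y"
proof -
  have "\<ominus>\<^bsub>M\<^esub> y = (\<ominus> \<one>) \<odot>\<^bsub>M\<^esub> y" using assms by (simp add: smult_l_minus)
  then have "f (\<ominus>\<^bsub>M\<^esub> y) = \<ominus>\<^bsub>E\<^esub> f y"
    using assms dual_smult[of f "\<ominus> \<one>" y] dual_closed[of f y] by (simp add: E.smult_l_minus)
  then show ?thesis using assms by (simp add: M.minus_eq E.minus_eq dual_add)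
qed

lemma dual_ops:
  "x \<in> carrier M \<Longrightarrow> (f \<oplus>\<^bsub>dual\<^esub> g) x = f x \<oplus>\<^bsub>E\<^esub> g x"
  "x \<in> carrier M \<Longrightarrow> (r \<odot>\<^bsub>dual\<^esub> f) x = r \<odot>\<^bsub>E\<^esub> f x"
  "x \<in> carrier M \<Longrightarrow> \<zero>\<^bsub>dual\<^esub> x = \<zero>\<^bsub>E\<^esub>"
  by (simp_all add: Hom_module_def)

lemma dual_eqI:
  assumes "f \<in> carrier dual" "g \<in> carrier dual" "\<And>x. x \<in> carrier M \<Longrightarrow> f x = g x"
  shows "f = g"
  using assms by (auto simp: Hom_module_def intro: extensionalityI)

lemma dual_restrict: "f \<in> mod_hom R M E \<Longrightarrow> restrict f (carrier M) \<in> carrier dual"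
  by (auto simp: Hom_module_def mod_hom_def)

lemma dual_mod_hom: "f \<in> carrier dual \<Longrightarrow> f \<in> mod_hom R M E"
  by (simp add: Hom_module_def)

sublocale dual: dvr_module R p dual
  by (rule dvr_module.intro[OF dvr_axioms module_Hom_module[OF E.module_axioms]])

text \<open>
  Factoring \<open>g\<close> through \<open>h\<close> when \<open>h\<close> need not be injective.
\<close>

lemma extend_along:
  fixes L :: "('r, 'l, 'w) module_scheme"
  assumes "module R L" and h: "h \<in> mod_hom R L M" and g: "g \<in> mod_hom R L E"
    and ker: "\<And>l. l \<in> carrier L \<Longrightarrow> h l = \<zero>\<^bsub>M\<^esub> \<Longrightarrow> g l = \<zero>\<^bsub>E\<^esub>"
  shows "\<exists>f\<in>carrier dual. \<forall>l\<in>carrier L. f (h l) = g l"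
proof -
  interpret L: dvr_module R p L by (rule dvr_module.intro[OF dvr_axioms]) fact
  have hc: "h l \<in> carrier M" and gc: "g l \<in> carrier E" if "l \<in> carrier L" for l
    using h g that by (auto simp: mod_hom_def)
  have ha: "h (l \<oplus>\<^bsub>L\<^esub> l') = h l \<oplus>\<^bsub>M\<^esub> h l'" "g (l \<oplus>\<^bsub>L\<^esub> l') = g l \<oplus>\<^bsub>E\<^esub> g l'"
    if "l \<in> carrier L" "l' \<in> carrier L" for l l'
    using h g that by (auto simp: mod_hom_def)
  have hs: "h (r \<odot>\<^bsub>L\<^esub> l) = r \<odot>\<^bsub>M\<^esub> h l" "g (r \<odot>\<^bsub>L\<^esub> l) = r \<odot>\<^bsub>E\<^esub> g l"
    if "r \<in> carrier R" "l \<in> carrier L" for r l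
    using h g that by (auto simp: mod_hom_def)
  have hneg: "h (\<ominus>\<^bsub>L\<^esub> l) = \<ominus>\<^bsub>M\<^esub> h l" "g (\<ominus>\<^bsub>L\<^esub> l) = \<ominus>\<^bsub>E\<^esub> g l" if "l \<in> carrier L" for l
    using hs[of "\<ominus> \<one>" l] that hc gc by (simp_all add: L.smult_l_minus smult_l_minus E.smult_l_minus)
  let ?K = "h ` carrier L"
  have K: "submodule ?K R M"
  proof (rule submoduleI)
    show "\<zero>\<^bsub>M\<^esub> \<in> ?K"
      using hs(1)[of \<zero> "\<zero>\<^bsub>L\<^esub>"] hc[of "\<zero>\<^bsub>L\<^esub>"] by (intro image_eqI[of _ _ "\<zero>\<^bsub>L\<^esub>"]) auto
    show "\<ominus>\<^bsub>M\<^esub> a \<in> ?K" if "a \<in> ?K" for a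
      using that hneg(1) L.a_inv_closed by (metis (no_types, lifting) image_iff)
    show "a \<oplus>\<^bsub>M\<^esub> b \<in> ?K" if "a \<in> ?K" "b \<in> ?K" for a b
      using that ha(1) L.a_closed by (metis (no_types, lifting) image_iff)
    show "r \<odot>\<^bsub>M\<^esub> a \<in> ?K" if "r \<in> carrier R" "a \<in> ?K" for r a
      using that hs(1) L.smult_closed by (metis (no_types, lifting) image_iff)
  qed (use hc in auto)
  define f where "f = (\<lambda>x. g (SOME l. l \<in> carrier L \<and> h l = x))"
  have fh: "f (h l) = g l" if l: "l \<in> carrier L" for l
  proof -
    define l' where "l' = (SOME l'. l' \<in> carrier L \<and> h l' = h l)"
    have l': "l' \<in> carrier L" "h l' = h l"
      using someI[of "\<lambda>l'. l' \<in> carrier L \<and> h l' = h l" l] l by (auto simp: l'_def)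
    have "h (l' \<ominus>\<^bsub>L\<^esub> l) = \<zero>\<^bsub>M\<^esub>"
      using l l' hc by (simp add: L.minus_eq ha hneg M.r_neg)
    then have "g (l' \<ominus>\<^bsub>L\<^esub> l) = \<zero>\<^bsub>E\<^esub>" using ker l l' by simp
    then have "g l' \<ominus>\<^bsub>E\<^esub> g l = \<zero>\<^bsub>E\<^esub>" using l l' by (simp add: L.minus_eq E.minus_eq ha hneg)
    then have "g l' = g l" using gc l l'(1) E.minus_eq_zero_iff by simp
    then show ?thesis by (simp add: f_def l'_def)
  qed
  have "f \<in> mod_hom R (M\<lparr>carrier := ?K\<rparr>) E"
    using fh gc hc by (auto simp: mod_hom_def ha[symmetric] hs[symmetric])
  then obtain f' where f': "f' \<in> mod_hom R M E" "\<And>x. x \<in> ?K \<Longrightarrow> f' x = f x"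
    using extend_submodule[OF module_axioms K] by blast
  then show ?thesis
    using fh hc dual_restrict[OF f'(1)] by (intro bexI[of _ "restrict f' (carrier M)"]) auto
qed

end

context matlis
begin

lemma matlis_moduleI: "module R M \<Longrightarrow> matlis_module R p E e M"
  by (intro matlis_module.intro matlis_axioms dvr_module.intro dvr_axioms)

end

context matlis_module
begin

text \<open>
  The map \<open>r \<mapsto> r e\<close> kills the maximal ideal, hence the annihilator of the nonzero class of \<open>x\<close> in \<open>M/N\<close>.
  So it factors through \<open>r \<mapsto> r x + N\<close> and extends to \<open>M/N\<close>.
\<close>

lemma separation:
  assumes N: "submodule N R M" and x: "x \<in> carrier M" "x \<notin> N"
  shows "\<exists>f\<in>carrier dual. (\<forall>y\<in>N. f y = \<zero>\<^bsub>E\<^esub>) \<and> f x \<noteq> \<zero>\<^bsub>E\<^esub>"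
proof -
  let ?Q = "quot_module M N" and ?q = "\<lambda>x. N +>\<^bsub>M\<^esub> x"
  interpret Q: matlis_module R p E e ?Q
    by (rule matlis_moduleI) (rule module_quot_module[OF N])
  note q = quot_module_proj[OF N] and qs = quot_module_simps[OF N]
  have "\<exists>f\<in>carrier Q.dual. \<forall>r\<in>carrier (ring_module R). f (?q (r \<odot>\<^bsub>M\<^esub> x)) = r \<odot>\<^bsub>E\<^esub> e"
  proof (rule Q.extend_along)
    show "module R (ring_module R)" by (rule module_ring_module)
    show "(\<lambda>r. ?q (r \<odot>\<^bsub>M\<^esub> x)) \<in> mod_hom R (ring_module R) ?Q"
      using x by (auto simp: mod_hom_def ring_module_def qs smult_l_distr smult_assoc1)
    show "(\<lambda>r. r \<odot>\<^bsub>E\<^esub> e) \<in> mod_hom R (ring_module R) E"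
      using socle by (auto simp: mod_hom_def ring_module_def E.smult_l_distr E.smult_assoc1)
    fix r assume "r \<in> carrier (ring_module R)" and r0: "?q (r \<odot>\<^bsub>M\<^esub> x) = \<zero>\<^bsub>?Q\<^esub>"
    then have r: "r \<in> carrier R" by (simp add: ring_module_def)
    then have "r \<odot>\<^bsub>M\<^esub> x \<in> N" using r0 q(2)[of "r \<odot>\<^bsub>M\<^esub> x"] x by auto
    with r show "r \<odot>\<^bsub>E\<^esub> e = \<zero>\<^bsub>E\<^esub>"
    proof (cases rule: unit_or_multiple)
      case 1
      then show ?thesis using \<open>r \<odot>\<^bsub>M\<^esub> x \<in> N\<close> unit_cancel[OF N] x by blast
    next
      case (2 c)
      then have "r \<odot>\<^bsub>E\<^esub> e = c \<odot>\<^bsub>E\<^esub> (p \<odot>\<^bsub>E\<^esub> e)"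
        using socle(1) m_comm[of p c] by (simp add: E.smult_assoc1)
      then show ?thesis using socle 2 by simp
    qed
  qed
  then obtain f where f: "f \<in> carrier Q.dual" "\<And>r. r \<in> carrier R \<Longrightarrow> f (?q (r \<odot>\<^bsub>M\<^esub> x)) = r \<odot>\<^bsub>E\<^esub> e"
    by (auto simp: ring_module_def)
  define g where "g = restrict (\<lambda>x. f (?q x)) (carrier M)"
  have "g \<in> carrier dual"
    unfolding g_def by (rule dual_restrict[OF mod_hom_comp[OF q(1) Q.dual_mod_hom[OF f(1)]]])
  moreover have "g y = \<zero>\<^bsub>E\<^esub>" if y: "y \<in> N" for y
  proof -
    have "?q y = \<zero>\<^bsub>?Q\<^esub>" using q(2) y submodule_carrier[OF N y] by blast
    then show ?thesis using submodule_carrier[OF N y] Q.dual_zero[OF f(1)] by (simp add: g_def)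
  qed
  moreover have "g x \<noteq> \<zero>\<^bsub>E\<^esub>" using f(2)[of \<one>] x socle by (simp add: g_def)
  ultimately show ?thesis by blast
qed

end

text \<open>
  A locale of its own, because a sublocale declaration for the dual would produce the dual of the dual,
  and so on without end.
\<close>

locale matlis_bidual = matlis_module R p E e M + bidual: matlis_module R p E e "Hom_module R M E"
  for R :: "('r, 'x) ring_scheme" (structure) and p and E :: "('r, 'e, 'z) module_scheme" and e
    and M :: "('r, 'm, 'y) module_scheme" (structure)

lemma (in matlis) matlis_bidualI: "module R M \<Longrightarrow> matlis_bidual R p E e M"
  by (intro matlis_bidual.intro matlis_moduleI module.module_Hom_module E.module_axioms)

context matlis_bidual
begin

abbreviation ev where "ev \<equiv> eval_map R E M"

lemma ev_apply [simp]: "f \<in> carrier dual \<Longrightarrow> ev x f = f x"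
  by (simp add: eval_map_def)

lemma ev_closed: "x \<in> carrier M \<Longrightarrow> ev x \<in> carrier bidual.dual"
  unfolding eval_map_def
  by (rule bidual.dual_restrict) (auto simp: mod_hom_def dual_closed dual_ops)

lemma ev_hom: "ev \<in> mod_hom R M bidual.dual"
  unfolding mod_hom_def
proof (intro CollectI conjI ballI)
  show "ev \<in> carrier M \<rightarrow> carrier bidual.dual" using ev_closed by auto
  show "ev (x \<oplus>\<^bsub>M\<^esub> y) = ev x \<oplus>\<^bsub>bidual.dual\<^esub> ev y" if "x \<in> carrier M" "y \<in> carrier M" for x y
    using that by (intro bidual.dual_eqI) (auto simp: ev_closed bidual.dual_ops dual_add)
  show "ev (r \<odot>\<^bsub>M\<^esub> x) = r \<odot>\<^bsub>bidual.dual\<^esub> ev x" if "r \<in> carrier R" "x \<in> carrier M" for r x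
    using that by (intro bidual.dual_eqI) (auto simp: ev_closed bidual.dual_ops dual_smult)
qed

lemma ev_inj: "inj_on ev (carrier M)"
proof (rule inj_onI, rule ccontr)
  fix x y assume xy: "x \<in> carrier M" "y \<in> carrier M" "ev x = ev y" "x \<noteq> y"
  have "x \<ominus>\<^bsub>M\<^esub> y \<noteq> \<zero>\<^bsub>M\<^esub>" using xy M.minus_eq_zero_iff by simp
  moreover have "submodule {\<zero>\<^bsub>M\<^esub>} R M" by (rule submoduleI) auto
  ultimately obtain f where f: "f \<in> carrier dual" "f (x \<ominus>\<^bsub>M\<^esub> y) \<noteq> \<zero>\<^bsub>E\<^esub>"
    using separation[of "{\<zero>\<^bsub>M\<^esub>}" "x \<ominus>\<^bsub>M\<^esub> y"] xy by auto
  have "f x = f y" using xy(3) f(1) ev_apply by metis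
  then show False using f xy(1,2) dual_closed[OF f(1)] by (simp add: dual_minus E.minus_eq E.r_neg)
qed

text \<open>
  The hypothesis says that the canonical map of the vector space \<open>V = M/pM\<close> to \<open>V\<^sup>*\<^sup>*\<close> is onto. Given an
  independent sequence \<open>x\<close>, let \<open>S \<subseteq> V\<^sup>*\<close> consist of the functionals vanishing on some tail of \<open>x\<close>, and let
  \<open>f\<close> kill all differences \<open>x\<^sub>i\<^sub>+\<^sub>1 - x\<^sub>i\<close> but not \<open>x\<^sub>0\<close>. Then \<open>f\<close> is not in \<open>S\<close>, so some \<open>g \<in> V\<^sup>*\<^sup>*\<close> vanishes on
  \<open>S\<close> but not at \<open>f\<close>. If \<open>g\<close> is evaluation at \<open>z\<close>, then \<open>z\<close> lies in the span of every tail, hence in \<open>p M\<close>,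
  and \<open>g\<close> would vanish at \<open>f\<close>.
\<close>

lemma no_independent_sequence:
  assumes B: "carrier bidual.dual = ev ` carrier M <+>\<^bsub>bidual.dual\<^esub> bidual.dual.multiples p"
  shows "\<nexists>x. independent_sequence x"
proof
  assume "\<exists>x. independent_sequence x"
  then obtain x where ind: "independent_sequence x" by blast
  then have xc: "x i \<in> carrier M" for i by (auto simp: independent_sequence_def)
  then have c: "x ` J \<subseteq> carrier M" for J by blast
  note s = span_mod_p[OF c]
  define S where "S = {f \<in> carrier dual. \<exists>n. \<forall>y\<in>span_mod_p (x ` {n..}). f y = \<zero>\<^bsub>E\<^esub>}"
  have S: "submodule S R dual"
  proof (rule dual.submoduleI)
    show "S \<subseteq> carrier dual" by (auto simp: S_def)
    show "\<zero>\<^bsub>dual\<^esub> \<in> S" using submodule_carrier[OF s(1)] by (auto simp: S_def dual_ops)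
  next
    fix f assume "f \<in> S"
    then obtain n where f: "f \<in> carrier dual" and n: "\<And>y. y \<in> span_mod_p (x ` {n..}) \<Longrightarrow> f y = \<zero>\<^bsub>E\<^esub>"
      by (auto simp: S_def)
    have smu: "r \<odot>\<^bsub>dual\<^esub> f \<in> S" if "r \<in> carrier R" for r
    proof -
      have "\<forall>y\<in>span_mod_p (x ` {n..}). (r \<odot>\<^bsub>dual\<^esub> f) y = \<zero>\<^bsub>E\<^esub>"
        using submodule_carrier[OF s(1)] n that by (auto simp: dual_ops)
      then show ?thesis using f that by (auto simp: S_def)
    qed
    then show "r \<odot>\<^bsub>dual\<^esub> f \<in> S" if "r \<in> carrier R" for r using that .
    show "\<ominus>\<^bsub>dual\<^esub> f \<in> S" using smu[of "\<ominus> \<one>"] f dual.smult_l_minus[of \<one> f] by simp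
  next
    fix f g assume "f \<in> S" "g \<in> S"
    then obtain n m where f: "f \<in> carrier dual" and n: "\<And>y. y \<in> span_mod_p (x ` {n..}) \<Longrightarrow> f y = \<zero>\<^bsub>E\<^esub>"
      and g: "g \<in> carrier dual" and m: "\<And>y. y \<in> span_mod_p (x ` {m..}) \<Longrightarrow> g y = \<zero>\<^bsub>E\<^esub>"
      by (auto simp: S_def)
    have "span_mod_p (x ` {max n m..}) \<subseteq> span_mod_p (x ` {n..})"
      "span_mod_p (x ` {max n m..}) \<subseteq> span_mod_p (x ` {m..})"
      by (rule span_mod_p_mono; use c in auto)+
    then have "\<forall>y\<in>span_mod_p (x ` {max n m..}). (f \<oplus>\<^bsub>dual\<^esub> g) y = \<zero>\<^bsub>E\<^esub>"
      using submodule_carrier[OF s(1)] n m by (auto simp: dual_ops subset_eq)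
    then show "f \<oplus>\<^bsub>dual\<^esub> g \<in> S" using f g by (auto simp: S_def)
  qed
  let ?d = "\<lambda>i. x (Suc i) \<ominus>\<^bsub>M\<^esub> x i"
  have dc: "range ?d \<subseteq> carrier M" using xc by auto
  note d = span_mod_p[OF dc]
  obtain f where f: "f \<in> carrier dual" and fd: "\<And>y. y \<in> span_mod_p (range ?d) \<Longrightarrow> f y = \<zero>\<^bsub>E\<^esub>"
    and f0: "f (x 0) \<noteq> \<zero>\<^bsub>E\<^esub>"
    using separation[OF d(1) xc independent_sequence_differences[OF ind]] by blast
  have fx: "f (x i) = f (x 0)" for i
  proof (induction i)
    case (Suc i)
    have "f (?d i) = \<zero>\<^bsub>E\<^esub>" using fd d(3) by blast
    then have "f (x (Suc i)) \<ominus>\<^bsub>E\<^esub> f (x i) = \<zero>\<^bsub>E\<^esub>" using dual_minus[OF f] xc by simp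
    then show ?case using Suc dual_closed[OF f xc] E.minus_eq_zero_iff by simp
  qed simp
  have fp: "f y = \<zero>\<^bsub>E\<^esub>" if "y \<in> multiples p" for y using fd d(2) that by blast
  have "f \<notin> S"
  proof
    assume "f \<in> S"
    then obtain n where n: "\<And>y. y \<in> span_mod_p (x ` {n..}) \<Longrightarrow> f y = \<zero>\<^bsub>E\<^esub>" by (auto simp: S_def)
    have "x n \<in> span_mod_p (x ` {n..})" using s(3)[of "{n..}"] by auto
    then show False using n fx f0 by metis
  qed
  then obtain g where g: "g \<in> carrier bidual.dual" and gS: "\<And>h. h \<in> S \<Longrightarrow> g h = \<zero>\<^bsub>E\<^esub>"
    and gf: "g f \<noteq> \<zero>\<^bsub>E\<^esub>"
    using bidual.separation[OF S f] by blast
  have "g \<in> ev ` carrier M <+>\<^bsub>bidual.dual\<^esub> bidual.dual.multiples p" using g B by simp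
  then obtain z g' where z: "z \<in> carrier M" and g': "g' \<in> carrier bidual.dual"
    and eq: "g = ev z \<oplus>\<^bsub>bidual.dual\<^esub> p \<odot>\<^bsub>bidual.dual\<^esub> g'"
    by (auto simp: bidual.dual.mem_set_add bidual.dual.multiples_def)
  have g_eq: "g h = h z" if h: "h \<in> carrier dual" and hp: "\<And>y. y \<in> multiples p \<Longrightarrow> h y = \<zero>\<^bsub>E\<^esub>" for h
  proof -
    have "p \<odot>\<^bsub>dual\<^esub> h = \<zero>\<^bsub>dual\<^esub>"
    proof (rule dual_eqI)
      fix y assume y: "y \<in> carrier M"
      then show "(p \<odot>\<^bsub>dual\<^esub> h) y = \<zero>\<^bsub>dual\<^esub> y"
        using hp[of "p \<odot>\<^bsub>M\<^esub> y"] dual_smult[OF h _ y] by (simp add: dual_ops multiples_def)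
    qed (use h in auto)
    then have "p \<odot>\<^bsub>E\<^esub> g' h = \<zero>\<^bsub>E\<^esub>"
      using bidual.dual_smult[OF g' p_closed h] bidual.dual_zero[OF g'] by simp
    then show ?thesis using h z dual_closed[OF h z] by (simp add: eq bidual.dual_ops)
  qed
  have "z \<in> span_mod_p (x ` {n..})" for n
  proof (rule ccontr)
    assume "z \<notin> span_mod_p (x ` {n..})"
    then obtain h where h: "h \<in> carrier dual" "\<And>y. y \<in> span_mod_p (x ` {n..}) \<Longrightarrow> h y = \<zero>\<^bsub>E\<^esub>" "h z \<noteq> \<zero>\<^bsub>E\<^esub>"
      using separation[OF s(1) z] by blast
    then have "h \<in> S" by (auto simp: S_def)
    moreover have "h y = \<zero>\<^bsub>E\<^esub>" if "y \<in> multiples p" for y using h(2) s(2) that by blast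
    ultimately show False using g_eq[OF h(1)] gS h(3) by simp
  qed
  then have "z \<in> multiples p" by (rule independent_sequence_tails[OF ind])
  then show False using g_eq[OF f fp] fp gf by simp
qed

end

section \<open>The structure of quasi-reflexive modules\<close>

lemma (in dvr_module) radical_full_iff:
  assumes U: "submodule U R M"
  shows "radical_full R (M\<lparr>carrier := U\<rparr>) \<longleftrightarrow> p_divisible U"
proof -
  interpret U: dvr_module R p "M\<lparr>carrier := U\<rparr>"
    by (rule dvr_module.intro[OF dvr_axioms submodule.submodule_is_module[OF U module_axioms]])
  have gens: "{a \<odot>\<^bsub>M\<lparr>carrier := U\<rparr>\<^esub> x | a x. a \<in> max_ideal R \<and> x \<in> carrier (M\<lparr>carrier := U\<rparr>)} = U.multiples p"
    (is "?G = _")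
  proof (intro equalityI subsetI)
    fix y assume "y \<in> ?G"
    then obtain r x where rx: "r \<in> carrier R" "x \<in> U" "y = (p \<otimes> r) \<odot>\<^bsub>M\<^esub> x"
      by (auto simp: max_ideal_eq)
    then show "y \<in> U.multiples p"
      using submodule_carrier[OF U rx(2)] submoduleE(4)[OF U rx(1,2)]
      by (auto simp: U.multiples_def smult_assoc1 intro!: image_eqI[of _ _ "r \<odot>\<^bsub>M\<^esub> x"])
  next
    fix y assume "y \<in> U.multiples p"
    then obtain x where "x \<in> U" "y = p \<odot>\<^bsub>M\<^esub> x" by (auto simp: U.multiples_def)
    moreover have "p \<in> max_ideal R" by (auto simp: max_ideal_eq intro!: exI[of _ \<one>])
    ultimately show "y \<in> ?G" by auto
  qed
  have sub: "submodule (U.multiples p) R (M\<lparr>carrier := U\<rparr>)" by (rule U.submodule_multiples) simp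
  have "ideal_smult R (max_ideal R) (M\<lparr>carrier := U\<rparr>) = U.multiples p"
    unfolding ideal_smult_def gens
    using U.submodule_span[OF U.submoduleE(1)[OF sub]] sub by blast
  then have "radical_full R (M\<lparr>carrier := U\<rparr>) \<longleftrightarrow> U = (\<lambda>x. p \<odot>\<^bsub>M\<^esub> x) ` U"
    by (simp add: radical_full_def U.multiples_def)
  also have "\<dots> \<longleftrightarrow> p_divisible U"
    using U submoduleE(4)[OF U p_closed] by (auto simp: p_divisible_def)
  finally show ?thesis .
qed

lemma (in dvr_module) P_sub_properties:
  shows p_divisible_P_sub: "p_divisible (P_sub R M)"
    and p_divisible_subset_P_sub: "p_divisible V \<Longrightarrow> V \<subseteq> P_sub R M"
proof -
  have "is_largest_radical_full R M (P_sub R M)"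
    by (rule largest_radical_full) (auto simp: max_ideal_eq)
  then show "p_divisible (P_sub R M)" "p_divisible V \<Longrightarrow> V \<subseteq> P_sub R M"
    using radical_full_iff by (auto simp: is_largest_radical_full_def p_divisible_def[of V])
qed

lemma (in dvr_module) p_divisible_infinite_height_subset:
  assumes "p_divisible V"
  shows "V \<subseteq> infinite_height"
proof
  fix x assume x: "x \<in> V"
  have V: "submodule V R M" using assms by (simp add: p_divisible_def)
  show "x \<in> infinite_height"
    using p_divisible_pow[OF assms x] submodule_carrier[OF V]
    by (auto simp: infinite_height_def multiples_def)
qed

context dvr_module
begin

definition torsion :: "'c set" where
  "torsion = {x \<in> carrier M. \<exists>k::nat. p [^] k \<odot>\<^bsub>M\<^esub> x = \<zero>\<^bsub>M\<^esub>}"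

lemma submodule_torsion: "submodule torsion R M"
proof (rule submoduleI)
  show "\<zero>\<^bsub>M\<^esub> \<in> torsion" by (auto simp: torsion_def)
next
  fix x y assume "x \<in> torsion" "y \<in> torsion"
  then obtain k l where x: "x \<in> carrier M" "p [^] (k::nat) \<odot>\<^bsub>M\<^esub> x = \<zero>\<^bsub>M\<^esub>"
    and y: "y \<in> carrier M" "p [^] (l::nat) \<odot>\<^bsub>M\<^esub> y = \<zero>\<^bsub>M\<^esub>" by (auto simp: torsion_def)
  have "p [^] (l + k) \<odot>\<^bsub>M\<^esub> x = \<zero>\<^bsub>M\<^esub>" "p [^] (k + l) \<odot>\<^bsub>M\<^esub> y = \<zero>\<^bsub>M\<^esub>"
    using x y by (simp_all only: pow_add_smult smult_r_null nat_pow_closed p_closed)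
  then have "p [^] (k + l) \<odot>\<^bsub>M\<^esub> (x \<oplus>\<^bsub>M\<^esub> y) = \<zero>\<^bsub>M\<^esub>"
    using x y by (simp add: smult_r_distr add.commute)
  then show "x \<oplus>\<^bsub>M\<^esub> y \<in> torsion" using x(1) y(1) by (auto simp: torsion_def)
next
  fix r x assume r: "r \<in> carrier R" and "x \<in> torsion"
  then obtain k where x: "x \<in> carrier M" "p [^] (k::nat) \<odot>\<^bsub>M\<^esub> x = \<zero>\<^bsub>M\<^esub>" by (auto simp: torsion_def)
  have "p [^] k \<odot>\<^bsub>M\<^esub> (r \<odot>\<^bsub>M\<^esub> x) = \<zero>\<^bsub>M\<^esub>" using x r smult_comm[of "p [^] k" r x] by simp
  then show "r \<odot>\<^bsub>M\<^esub> x \<in> torsion" using r x by (auto simp: torsion_def)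
next
  fix x assume "x \<in> torsion"
  then obtain k where x: "x \<in> carrier M" "p [^] (k::nat) \<odot>\<^bsub>M\<^esub> x = \<zero>\<^bsub>M\<^esub>" by (auto simp: torsion_def)
  then show "\<ominus>\<^bsub>M\<^esub> x \<in> torsion" by (auto simp: torsion_def smult_r_minus intro!: exI[of _ k])
qed (auto simp: torsion_def)

lemma torsion_divide:
  assumes x: "x \<in> carrier M" and px: "p \<odot>\<^bsub>M\<^esub> x \<in> torsion"
  shows "x \<in> torsion"
proof -
  obtain k :: nat where "p [^] k \<odot>\<^bsub>M\<^esub> (p \<odot>\<^bsub>M\<^esub> x) = \<zero>\<^bsub>M\<^esub>" using px by (auto simp: torsion_def)
  then have "p [^] Suc k \<odot>\<^bsub>M\<^esub> x = \<zero>\<^bsub>M\<^esub>" by (simp only: pow_Suc_smult(1)[OF x])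
  then show ?thesis using x unfolding torsion_def by blast
qed

end

context matlis_bidual
begin

definition torsion_annihilator where
  "torsion_annihilator = {g \<in> carrier bidual.dual. \<forall>f\<in>dual.torsion. g f = \<zero>\<^bsub>E\<^esub>}"

lemma dual_torsion_iff:
  assumes f: "f \<in> carrier dual"
  shows "f \<in> dual.torsion \<longleftrightarrow> (\<exists>k::nat. \<forall>x\<in>carrier M. p [^] k \<odot>\<^bsub>E\<^esub> f x = \<zero>\<^bsub>E\<^esub>)"
proof -
  have "p [^] k \<odot>\<^bsub>dual\<^esub> f = \<zero>\<^bsub>dual\<^esub> \<longleftrightarrow> (\<forall>x\<in>carrier M. p [^] k \<odot>\<^bsub>E\<^esub> f x = \<zero>\<^bsub>E\<^esub>)" for k :: nat
  proof
    assume "p [^] k \<odot>\<^bsub>dual\<^esub> f = \<zero>\<^bsub>dual\<^esub>"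
    then show "\<forall>x\<in>carrier M. p [^] k \<odot>\<^bsub>E\<^esub> f x = \<zero>\<^bsub>E\<^esub>" by (metis dual_ops(2,3))
  next
    assume "\<forall>x\<in>carrier M. p [^] k \<odot>\<^bsub>E\<^esub> f x = \<zero>\<^bsub>E\<^esub>"
    then show "p [^] k \<odot>\<^bsub>dual\<^esub> f = \<zero>\<^bsub>dual\<^esub>"
      using f by (intro dual_eqI) (auto simp: dual_ops)
  qed
  then show ?thesis using f by (simp add: dual.torsion_def)
qed

text \<open>
  The annihilator of the torsion \<open>T\<close> is the dual of the torsion-free module \<open>M\<degree>/T\<close>, on which
  multiplication by \<open>p\<close> is injective; the dual of an injective map is onto.
\<close>

lemma p_divisible_torsion_annihilator: "bidual.dual.p_divisible torsion_annihilator"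
  unfolding bidual.dual.p_divisible_def
proof (intro conjI ballI)
  note T = dual.submodule_torsion
  note Tc = dual.submodule_carrier[OF T]
  show "submodule torsion_annihilator R bidual.dual"
  proof (rule bidual.dual.submoduleI)
    fix g assume g: "g \<in> torsion_annihilator"
    have smu: "r \<odot>\<^bsub>bidual.dual\<^esub> g \<in> torsion_annihilator" if "r \<in> carrier R" for r
      using that g Tc by (auto simp: torsion_annihilator_def bidual.dual_ops)
    then show "r \<odot>\<^bsub>bidual.dual\<^esub> g \<in> torsion_annihilator" if "r \<in> carrier R" for r using that .
    show "\<ominus>\<^bsub>bidual.dual\<^esub> g \<in> torsion_annihilator"
      using smu[of "\<ominus> \<one>"] g bidual.dual.smult_l_minus[of \<one> g] by (simp add: torsion_annihilator_def)
  qed (use Tc in \<open>auto simp: torsion_annihilator_def bidual.dual_ops\<close>)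
  fix g assume "g \<in> torsion_annihilator"
  then have g: "g \<in> carrier bidual.dual" and gT: "\<And>f. f \<in> dual.torsion \<Longrightarrow> g f = \<zero>\<^bsub>E\<^esub>"
    by (auto simp: torsion_annihilator_def)
  let ?Q = "quot_module dual dual.torsion" and ?q = "\<lambda>f. dual.torsion +>\<^bsub>dual\<^esub> f"
  interpret Q: matlis_module R p E e ?Q
    by (rule matlis_moduleI) (rule dual.module_quot_module[OF T])
  note q = dual.quot_module_proj[OF T]
  have "\<exists>h\<in>carrier Q.dual. \<forall>f\<in>carrier dual. h (?q (p \<odot>\<^bsub>dual\<^esub> f)) = g f"
  proof (rule Q.extend_along)
    show "module R dual" by (rule dual.module_axioms)
    show "(\<lambda>f. ?q (p \<odot>\<^bsub>dual\<^esub> f)) \<in> mod_hom R dual ?Q"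
    proof (rule mod_hom_comp[OF _ q(1)])
      show "(\<lambda>f. p \<odot>\<^bsub>dual\<^esub> f) \<in> mod_hom R dual dual"
        by (auto simp: mod_hom_def dual.smult_r_distr dual.smult_comm)
    qed
    show "g \<in> mod_hom R dual E" using bidual.dual_mod_hom[OF g] .
    fix f assume f: "f \<in> carrier dual" and "?q (p \<odot>\<^bsub>dual\<^esub> f) = \<zero>\<^bsub>?Q\<^esub>"
    then have "p \<odot>\<^bsub>dual\<^esub> f \<in> dual.torsion" using q(2)[of "p \<odot>\<^bsub>dual\<^esub> f"] by simp
    then show "g f = \<zero>\<^bsub>E\<^esub>" using dual.torsion_divide[OF f] gT by blast
  qed
  then obtain h where h: "h \<in> carrier Q.dual" "\<And>f. f \<in> carrier dual \<Longrightarrow> h (?q (p \<odot>\<^bsub>dual\<^esub> f)) = g f"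
    by blast
  define k where "k = restrict (\<lambda>f. h (?q f)) (carrier dual)"
  have kc: "k \<in> carrier bidual.dual"
    unfolding k_def by (rule bidual.dual_restrict[OF mod_hom_comp[OF q(1) Q.dual_mod_hom[OF h(1)]]])
  have "k f = \<zero>\<^bsub>E\<^esub>" if f: "f \<in> dual.torsion" for f
  proof -
    have "?q f = \<zero>\<^bsub>?Q\<^esub>" using q(2) f Tc[OF f] by blast
    then show ?thesis using Tc[OF f] Q.dual_zero[OF h(1)] by (simp add: k_def)
  qed
  then have "k \<in> torsion_annihilator" using kc by (simp add: torsion_annihilator_def)
  moreover have "g = p \<odot>\<^bsub>bidual.dual\<^esub> k"
  proof (rule bidual.dual_eqI)
    fix f assume f: "f \<in> carrier dual"
    have "(p \<odot>\<^bsub>bidual.dual\<^esub> k) f = k (p \<odot>\<^bsub>dual\<^esub> f)"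
      using f bidual.dual_smult[OF kc p_closed f] by (simp add: bidual.dual_ops)
    also have "\<dots> = g f" using h(2)[OF f] f by (simp add: k_def)
    finally show "g f = (p \<odot>\<^bsub>bidual.dual\<^esub> k) f" by simp
  qed (use g kc in auto)
  ultimately show "\<exists>k\<in>torsion_annihilator. g = p \<odot>\<^bsub>bidual.dual\<^esub> k" by blast
qed

text \<open>
  Torsion functionals are those that kill some \<open>p\<^sup>n M\<close>, and an element outside \<open>p\<^sup>n M\<close> is detected by
  such a functional.
\<close>

lemma ev_torsion_annihilator_iff:
  assumes x: "x \<in> carrier M"
  shows "ev x \<in> torsion_annihilator \<longleftrightarrow> x \<in> infinite_height"
proof
  assume ann: "ev x \<in> torsion_annihilator"
  have "x \<in> multiples (p [^] n)" for n :: nat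
  proof (rule ccontr)
    assume "x \<notin> multiples (p [^] n)"
    then obtain f where f: "f \<in> carrier dual" "\<And>y. y \<in> multiples (p [^] n) \<Longrightarrow> f y = \<zero>\<^bsub>E\<^esub>" "f x \<noteq> \<zero>\<^bsub>E\<^esub>"
      using separation[OF submodule_multiples x] by blast
    have "p [^] n \<odot>\<^bsub>E\<^esub> f y = \<zero>\<^bsub>E\<^esub>" if "y \<in> carrier M" for y
      using f(2)[of "p [^] n \<odot>\<^bsub>M\<^esub> y"] dual_smult[OF f(1) _ that, of "p [^] n"] that by (simp add: multiples_def)
    then have "f \<in> dual.torsion" using dual_torsion_iff[OF f(1)] by blast
    then show False using ann f(1,3) by (auto simp: torsion_annihilator_def)
  qed
  then show "x \<in> infinite_height" by (auto simp: infinite_height_def)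
next
  assume xh: "x \<in> infinite_height"
  have "f x = \<zero>\<^bsub>E\<^esub>" if f: "f \<in> dual.torsion" for f
  proof -
    have fc: "f \<in> carrier dual" using f dual.submodule_carrier[OF dual.submodule_torsion] by blast
    then obtain k :: nat where k: "\<And>y. y \<in> carrier M \<Longrightarrow> p [^] k \<odot>\<^bsub>E\<^esub> f y = \<zero>\<^bsub>E\<^esub>"
      using dual_torsion_iff f by blast
    have "x \<in> multiples (p [^] k)" using xh by (auto simp: infinite_height_def)
    then obtain y where "y \<in> carrier M" "x = p [^] k \<odot>\<^bsub>M\<^esub> y" by (auto simp: multiples_def)
    then show ?thesis using k dual_smult[OF fc] by simp
  qed
  then show "ev x \<in> torsion_annihilator"
    using ev_closed[OF x] dual.submodule_carrier[OF dual.submodule_torsion]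
    by (auto simp: torsion_annihilator_def)
qed

lemma p_divisible_ev_image:
  assumes D: "p_divisible D"
  shows "bidual.dual.p_divisible (ev ` D)"
proof -
  have Ds: "submodule D R M" using D by (simp add: p_divisible_def)
  note Dc = submodule_carrier[OF Ds]
  have ev_add: "ev x \<oplus>\<^bsub>bidual.dual\<^esub> ev y = ev (x \<oplus>\<^bsub>M\<^esub> y)" if "x \<in> carrier M" "y \<in> carrier M" for x y
    using ev_hom that by (simp add: mod_hom_def)
  have ev_smult: "r \<odot>\<^bsub>bidual.dual\<^esub> ev x = ev (r \<odot>\<^bsub>M\<^esub> x)" if "r \<in> carrier R" "x \<in> carrier M" for r x
    using ev_hom that by (simp add: mod_hom_def)
  have "submodule (ev ` D) R bidual.dual"
  proof (rule bidual.dual.submoduleI)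
    show "ev ` D \<subseteq> carrier bidual.dual" using ev_closed Dc by auto
    have "ev \<zero>\<^bsub>M\<^esub> = \<zero>\<^bsub>bidual.dual\<^esub>" using ev_smult[of \<zero> "\<zero>\<^bsub>M\<^esub>"] ev_closed[of "\<zero>\<^bsub>M\<^esub>"] by simp
    then show "\<zero>\<^bsub>bidual.dual\<^esub> \<in> ev ` D" using submodule_zero[OF Ds] by (metis imageI)
  next
    fix g assume "g \<in> ev ` D"
    then obtain x where x: "x \<in> D" "g = ev x" by blast
    show smu: "r \<odot>\<^bsub>bidual.dual\<^esub> g \<in> ev ` D" if "r \<in> carrier R" for r
      using x ev_smult[OF that Dc[OF x(1)]] submoduleE(4)[OF Ds that x(1)] by simp
    show "\<ominus>\<^bsub>bidual.dual\<^esub> g \<in> ev ` D"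
      using smu[of "\<ominus> \<one>"] x(2) ev_closed[OF Dc[OF x(1)]] bidual.dual.smult_l_minus[of \<one> g] by simp
  next
    fix g h assume "g \<in> ev ` D" "h \<in> ev ` D"
    then obtain x y where "x \<in> D" "g = ev x" "y \<in> D" "h = ev y" by blast
    then show "g \<oplus>\<^bsub>bidual.dual\<^esub> h \<in> ev ` D"
      using ev_add[OF Dc Dc] submoduleE(5)[OF Ds] by simp
  qed
  moreover have "\<exists>h\<in>ev ` D. ev x = p \<odot>\<^bsub>bidual.dual\<^esub> h" if x: "x \<in> D" for x
  proof -
    obtain y where y: "y \<in> D" "x = p \<odot>\<^bsub>M\<^esub> y" using D x by (auto simp: p_divisible_def)
    then have "ev x = p \<odot>\<^bsub>bidual.dual\<^esub> ev y" using ev_smult[OF p_closed Dc[OF y(1)]] by simp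
    then show ?thesis using y(1) by blast
  qed
  ultimately show ?thesis by (auto simp: bidual.dual.p_divisible_def)
qed

text \<open>
  The complement \<open>C\<close> of the image of \<open>P(M)\<close> in the annihilator of the torsion is the divisible test
  submodule: an element of \<open>C\<close> that comes from \<open>M\<close> has infinite height, so it comes from \<open>P(M)\<close> and
  is zero.
\<close>

theorem quasi_reflexive_structure:
  assumes pe: "quasi_reflexive R E M"
  shows "\<nexists>x. independent_sequence x"
    and "P_sub R M = infinite_height"
    and "torsion_annihilator = ev ` P_sub R M"
proof -
  note pe = pe[unfolded quasi_reflexive_def]
  show none: "\<nexists>x. independent_sequence x"
    by (rule no_independent_sequence[OF bidual.dual.pure_essential_quotient_divisible[OF pe]])
  show P: "P_sub R M = infinite_height"
    using p_divisible_infinite_height[OF none] p_divisible_subset_P_sub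
      p_divisible_infinite_height_subset[OF p_divisible_P_sub] by blast
  note D = p_divisible_P_sub
  have Ds: "submodule (P_sub R M) R M" using D by (simp add: p_divisible_def)
  note Dc = submodule_carrier[OF Ds]
  note eD = p_divisible_ev_image[OF D]
  have sub: "ev ` P_sub R M \<subseteq> torsion_annihilator"
    using ev_torsion_annihilator_iff P Dc by auto
  obtain C where C: "bidual.dual.p_divisible C" "C \<inter> ev ` P_sub R M = {\<zero>\<^bsub>bidual.dual\<^esub>}"
    "torsion_annihilator = C <+>\<^bsub>bidual.dual\<^esub> ev ` P_sub R M"
    using bidual.dual.p_divisible_complement[OF p_divisible_torsion_annihilator eD sub] by blast
  have Cs: "submodule C R bidual.dual" and eDs: "submodule (ev ` P_sub R M) R bidual.dual"
    using C(1) eD by (auto simp: bidual.dual.p_divisible_def)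
  note S = bidual.dual.submodule_set_add[OF Cs eDs]
  have "C \<inter> ev ` carrier M \<subseteq> C \<inter> ev ` P_sub R M" (is "?l \<subseteq> ?r")
    using S(2) C(3) ev_torsion_annihilator_iff P by auto
  moreover have "?r \<subseteq> ?l" by (intro Int_mono order_refl image_mono submoduleE(1)[OF Ds])
  ultimately have "C \<inter> ev ` carrier M = {\<zero>\<^bsub>bidual.dual\<^esub>}" unfolding C(2)[symmetric] by (rule equalityI)
  then have "C = {\<zero>\<^bsub>bidual.dual\<^esub>}"
    by (rule bidual.dual.pure_essential_divisible[OF pe C(1)])
  then have "torsion_annihilator \<subseteq> ev ` P_sub R M"
    unfolding C(3) using bidual.dual.submodule_carrier[OF eDs]
    by (auto simp: bidual.dual.mem_set_add)
  then show "torsion_annihilator = ev ` P_sub R M" using sub by blast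
qed

text \<open>
  A functional \<open>g\<close> on \<open>P(M)\<degree>\<close> gives the functional \<open>f \<mapsto> g (f|P(M))\<close> on \<open>M\<degree>\<close>, which kills torsion. So it
  is evaluation at some \<open>d \<in> P(M)\<close>; since every functional on \<open>P(M)\<close> extends to \<open>M\<close>, \<open>g\<close> itself is
  evaluation at \<open>d\<close>.
\<close>

theorem quasi_reflexive_imp_reflexive_P_sub:
  assumes qr: "quasi_reflexive R E M"
  shows "reflexive_module R E (M\<lparr>carrier := P_sub R M\<rparr>)"
proof -
  let ?D = "P_sub R M" and ?MD = "M\<lparr>carrier := P_sub R M\<rparr>"
  note st = quasi_reflexive_structure[OF qr]
  have Ds: "submodule ?D R M" using p_divisible_P_sub by (simp add: p_divisible_def)
  note Dc = submodule_carrier[OF Ds]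
  interpret D: matlis_bidual R p E e ?MD
    by (rule matlis_bidualI) (rule submodule.submodule_is_module[OF Ds module_axioms])
  have res: "restrict f ?D \<in> carrier D.dual" if f: "f \<in> carrier dual" for f
  proof -
    have "f \<in> mod_hom R ?MD E" using dual_mod_hom[OF f] Dc by (auto simp: mod_hom_def)
    then show ?thesis using D.dual_restrict by simp
  qed
  have "\<exists>d\<in>?D. g = D.ev d" if g: "g \<in> carrier D.bidual.dual" for g
  proof -
    define h where "h = restrict (\<lambda>f. g (restrict f ?D)) (carrier dual)"
    have "(\<lambda>f. restrict f ?D) \<in> mod_hom R dual D.dual"
      using res dual_ops(1,2) D.dual_ops(1,2) Dc
      by (auto simp: mod_hom_def intro!: D.dual_eqI)
    then have h: "h \<in> carrier bidual.dual"
      unfolding h_def by (intro bidual.dual_restrict) (rule mod_hom_comp[OF _ D.bidual.dual_mod_hom[OF g]])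
    have "h f = \<zero>\<^bsub>E\<^esub>" if f: "f \<in> dual.torsion" for f
    proof -
      have fc: "f \<in> carrier dual" using f dual.submodule_carrier[OF dual.submodule_torsion] by blast
      have "f d = \<zero>\<^bsub>E\<^esub>" if d: "d \<in> ?D" for d
        using ev_torsion_annihilator_iff[OF Dc[OF d]] st(2) d f fc by (auto simp: torsion_annihilator_def)
      then have "restrict f ?D = \<zero>\<^bsub>D.dual\<^esub>"
        using res[OF fc] by (intro D.dual_eqI) (auto simp: D.dual_ops)
      then show ?thesis using fc D.bidual.dual_zero[OF g] by (simp add: h_def)
    qed
    then have "h \<in> torsion_annihilator" using h by (simp add: torsion_annihilator_def)
    then obtain d where d: "d \<in> ?D" "h = ev d" using st(3) by blast
    have "g = D.ev d"
    proof (rule D.bidual.dual_eqI)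
      fix f assume f: "f \<in> carrier D.dual"
      obtain f' where f': "f' \<in> mod_hom R M E" "\<And>x. x \<in> ?D \<Longrightarrow> f' x = f x"
        using extend_submodule[OF module_axioms Ds D.dual_mod_hom[OF f]] by blast
      define F where "F = restrict f' (carrier M)"
      have F: "F \<in> carrier dual" using dual_restrict[OF f'(1)] by (simp add: F_def)
      have "restrict F ?D = f"
        using f f'(2) Dc res[OF F] by (intro D.dual_eqI) (auto simp: F_def)
      then have "h F = g f" using F by (simp add: h_def)
      moreover have "h F = f d" using d F f'(2) Dc by (simp add: F_def)
      ultimately show "g f = D.ev d f" using f by simp
    qed (use g d D.ev_closed in auto)
    then show ?thesis using d(1) by blast
  qed
  then have "D.ev ` ?D = carrier D.bidual.dual" using D.ev_closed by auto
  then show ?thesis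
    using D.ev_hom D.ev_inj by (simp add: reflexive_module_def mod_iso_def bij_betw_def)
qed

text \<open>
  A submodule \<open>N\<close> containing \<open>P(M)\<close> and generators of \<open>M\<close> modulo \<open>p M\<close> is all of \<open>M\<close>. Let \<open>f \<in> M\<degree>\<close> kill \<open>N\<close>.
  If \<open>f\<close> is torsion, then \<open>f = 0\<close>, as \<open>M = N + p\<^sup>k M\<close> for all \<open>k\<close>. If not, some \<open>g\<close> in the annihilator of
  the torsion is nonzero at \<open>f\<close>; but \<open>g\<close> is evaluation at an element of \<open>P(M)\<close>, where \<open>f\<close> vanishes.
\<close>

theorem quasi_reflexive_imp_fin_gen_quotient:
  assumes qr: "quasi_reflexive R E M"
  shows "fin_gen_module R (quot_module M (P_sub R M))"
proof -
  let ?D = "P_sub R M"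
  note st = quasi_reflexive_structure[OF qr]
  have Ds: "submodule ?D R M" using p_divisible_P_sub by (simp add: p_divisible_def)
  note Dc = submodule_carrier[OF Ds]
  obtain F where F: "finite F" "F \<subseteq> carrier M" "span_mod_p F = carrier M"
    using finite_span_mod_p[OF st(1)] by blast
  have gen: "N = carrier M" if N: "submodule N R M" and FN: "F \<subseteq> N" and DN: "?D \<subseteq> N" for N
  proof (rule ccontr)
    assume "N \<noteq> carrier M"
    then obtain x where x: "x \<in> carrier M" "x \<notin> N" using submoduleE(1)[OF N] by blast
    obtain f where f: "f \<in> carrier dual" and fN: "\<And>y. y \<in> N \<Longrightarrow> f y = \<zero>\<^bsub>E\<^esub>" and fx: "f x \<noteq> \<zero>\<^bsub>E\<^esub>"
      using separation[OF N x] by blast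
    show False
    proof (cases "f \<in> dual.torsion")
      case True
      then obtain k :: nat where k: "\<And>y. y \<in> carrier M \<Longrightarrow> p [^] k \<odot>\<^bsub>E\<^esub> f y = \<zero>\<^bsub>E\<^esub>"
        using dual_torsion_iff[OF f] by blast
      note mp = submodule_multiples[OF p_closed]
      note S = submodule_set_add[OF N mp]
      have "span_mod_p F \<subseteq> N <+>\<^bsub>M\<^esub> multiples p"
        using S FN by (intro span_mod_p_least[OF F(2)]) auto
      then have step: "\<exists>z\<in>carrier M. f y = p \<odot>\<^bsub>E\<^esub> f z" if y: "y \<in> carrier M" for y
      proof -
        have "y \<in> N <+>\<^bsub>M\<^esub> multiples p" using F(3) y \<open>span_mod_p F \<subseteq> _\<close> by blast
        then obtain n z where nz: "n \<in> N" "z \<in> carrier M" "y = n \<oplus>\<^bsub>M\<^esub> p \<odot>\<^bsub>M\<^esub> z"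
          by (auto simp: mem_set_add multiples_def)
        then have "f y = p \<odot>\<^bsub>E\<^esub> f z"
          using fN[OF nz(1)] submodule_carrier[OF N nz(1)] dual_closed[OF f nz(2)]
          by (simp add: dual_add[OF f] dual_smult[OF f])
        then show ?thesis using nz(2) by blast
      qed
      have "\<exists>z\<in>carrier M. f x = p [^] j \<odot>\<^bsub>E\<^esub> f z" for j :: nat
      proof (induction j)
        case 0
        then show ?case using x(1) dual_closed[OF f x(1)] by (intro bexI[of _ x]) auto
      next
        case (Suc j)
        then obtain z where z: "z \<in> carrier M" "f x = p [^] j \<odot>\<^bsub>E\<^esub> f z" by blast
        then obtain w where w: "w \<in> carrier M" "f z = p \<odot>\<^bsub>E\<^esub> f w" using step by blast
        then have "f x = p [^] Suc j \<odot>\<^bsub>E\<^esub> f w" using z dual_closed[OF f w(1)] by (simp add: E.smult_assoc1)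
        then show ?case using w(1) by blast
      qed
      then show False using k fx by metis
    next
      case False
      then obtain g where g: "g \<in> carrier bidual.dual" "\<And>h. h \<in> dual.torsion \<Longrightarrow> g h = \<zero>\<^bsub>E\<^esub>" "g f \<noteq> \<zero>\<^bsub>E\<^esub>"
        using bidual.separation[OF dual.submodule_torsion f] by blast
      then have "g \<in> torsion_annihilator" by (simp add: torsion_annihilator_def)
      then obtain d where "d \<in> ?D" "g = ev d" using st(3) by blast
      then show False using g(3) f fN DN by auto
    qed
  qed
  let ?Q = "quot_module M ?D" and ?q = "\<lambda>x. ?D +>\<^bsub>M\<^esub> x"
  interpret Q: dvr_module R p ?Q
    by (rule dvr_module.intro[OF dvr_axioms module_quot_module[OF Ds]])
  note qs = quot_module_simps[OF Ds] and q = quot_module_proj[OF Ds]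
  have W: "carrier ?Q \<subseteq> W" if W: "submodule W R ?Q" "?q ` F \<subseteq> W" for W
  proof -
    let ?N = "{x \<in> carrier M. ?q x \<in> W}"
    have smu: "r \<odot>\<^bsub>M\<^esub> x \<in> ?N" if "r \<in> carrier R" "x \<in> ?N" for r x
      using that Q.submoduleE(4)[OF W(1), of r "?q x"] by (simp add: qs(2))
    have "submodule ?N R M"
    proof (rule submoduleI)
      show "\<zero>\<^bsub>M\<^esub> \<in> ?N" using Q.submodule_zero[OF W(1)] by (simp add: qs(3))
      show "\<ominus>\<^bsub>M\<^esub> x \<in> ?N" if "x \<in> ?N" for x
        using smu[of "\<ominus> \<one>" x] that by (simp add: smult_l_minus)
      show "x \<oplus>\<^bsub>M\<^esub> y \<in> ?N" if "x \<in> ?N" "y \<in> ?N" for x y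
        using that Q.submoduleE(5)[OF W(1), of "?q x" "?q y"] by (simp add: qs(1))
    qed (use smu in auto)
    moreover have "F \<subseteq> ?N" using F(2) W(2) by auto
    moreover have "?D \<subseteq> ?N"
    proof
      fix d assume d: "d \<in> ?D"
      then have "?q d = \<zero>\<^bsub>?Q\<^esub>" using q(2) Dc by blast
      then show "d \<in> ?N" using Q.submodule_zero[OF W(1)] Dc[OF d] by simp
    qed
    ultimately have "?N = carrier M" by (rule gen)
    then show ?thesis by (auto simp: qs(4))
  qed
  have c: "?q ` F \<subseteq> carrier ?Q" using F(2) by (auto simp: qs(4))
  have "module_span R ?Q (?q ` F) = carrier ?Q"
    using W[OF Q.submodule_span(1,2)[OF c]] Q.submoduleE(1)[OF Q.submodule_span(1)[OF c]] by blast
  then show ?thesis unfolding fin_gen_module_def using F(1) c by (intro exI[of _ "?q ` F"]) auto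
qed

end

text \<open>
  The image of \<open>1\<close> under the embedding of the residue field is a nonzero element of \<open>E\<close> killed by \<open>p\<close>.
\<close>

lemma (in dvr) residue_hull_matlis:
  assumes hull: "injective_hull R (residue_module R) E"
  shows "\<exists>e. matlis R p E e"
proof -
  let ?m = "max_ideal R" and ?K = "residue_module R"
  have inj: "injective_module TYPE('a) R E" using hull by (simp add: injective_hull_def)
  then interpret E: module R E by (simp add: injective_module_def)
  interpret RM: dvr_module R p "ring_module R"
    by (rule dvr_module.intro[OF dvr_axioms module_ring_module])
  have m: "?m = RM.multiples p"
    unfolding RM.multiples_def by (auto simp: max_ideal_eq ring_module_def)
  have ms: "submodule ?m R (ring_module R)" unfolding m by (rule RM.submodule_multiples) simp
  interpret K: module R ?K unfolding residue_module_def by (rule RM.module_quot_module[OF ms])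
  obtain f where f: "f \<in> mod_hom R ?K E" "inj_on f (carrier ?K)"
    using hull by (auto simp: injective_hull_def)
  let ?q = "\<lambda>x. ?m +>\<^bsub>ring_module R\<^esub> x"
  note q = RM.quot_module_proj[OF ms, folded residue_module_def]
    and qs = RM.quot_module_simps[OF ms, folded residue_module_def]
  have rc: "carrier (ring_module R) = carrier R" "smult (ring_module R) = mult R" by (simp_all add: ring_module_def)
  have one: "?q \<one> \<in> carrier ?K" by (simp add: qs(4) rc)
  have fc: "f x \<in> carrier E" if "x \<in> carrier ?K" for x using f(1) that by (auto simp: mod_hom_def)
  have fs: "f (r \<odot>\<^bsub>?K\<^esub> x) = r \<odot>\<^bsub>E\<^esub> f x" if "r \<in> carrier R" "x \<in> carrier ?K" for r x
    using f(1) that by (simp add: mod_hom_def)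
  have f0: "f \<zero>\<^bsub>?K\<^esub> = \<zero>\<^bsub>E\<^esub>" using fs[of \<zero> "\<zero>\<^bsub>?K\<^esub>"] fc[of "\<zero>\<^bsub>?K\<^esub>"] by simp
  have "\<one> \<notin> ?m"
  proof
    assume "\<one> \<in> ?m"
    then obtain r where "r \<in> carrier R" "\<one> = p \<otimes> r" by (auto simp: max_ideal_eq)
    then have "p \<in> Units R" using m_comm[of p r] by (auto simp: Units_def)
    then show False using p_not_unit by blast
  qed
  then have nz: "?q \<one> \<noteq> \<zero>\<^bsub>?K\<^esub>" using q(2)[of \<one>] by (simp add: rc)
  have "p \<odot>\<^bsub>?K\<^esub> ?q \<one> = \<zero>\<^bsub>?K\<^esub>"
  proof -
    have "p \<in> ?m" by (auto simp: max_ideal_eq intro!: exI[of _ \<one>])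
    then show ?thesis using q(2)[of p] qs(2)[of p \<one>] by (simp add: rc)
  qed
  then have "p \<odot>\<^bsub>E\<^esub> f (?q \<one>) = \<zero>\<^bsub>E\<^esub>" using fs[OF p_closed one] f0 by simp
  moreover have "f (?q \<one>) \<in> carrier E" using fc one by blast
  moreover have "f (?q \<one>) \<noteq> \<zero>\<^bsub>E\<^esub>" using nz f0 f(2) one K.zero_closed by (metis inj_onD)
  ultimately have "matlis R p E (f (?q \<one>))" using inj by unfold_locales
  then show ?thesis by blast
qed

theorem mainTheorem2:
  fixes R :: "('r, 'x) ring_scheme"
    and E :: "('r, 'e, 'z) module_scheme"
    and M :: "('r, 'm, 'y) module_scheme"
  assumes "discrete_valuation_ring R"
    and "injective_hull R (residue_module R) E"
    and "module R M"
    and "quasi_reflexive R E M"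
  shows "in_class_C R E M"
proof -
  obtain p where "dvr R p" using discrete_valuation_ring_uniformizer[OF assms(1)] by blast
  then obtain e where "matlis R p E e" using dvr.residue_hull_matlis[OF _ assms(2)] by blast
  then interpret matlis_bidual R p E e M by (rule matlis.matlis_bidualI) (rule assms(3))
  show ?thesis
    using assms(3) quasi_reflexive_imp_reflexive_P_sub[OF assms(4)]
      quasi_reflexive_imp_fin_gen_quotient[OF assms(4)]
    by (simp add: in_class_C_def)
qed

end
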